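(* Let $d\ge 1$, let $d<s<2d$, let $\beta>0$, and let $\{P_k\}_{k\in\mathbb{Z}^d}$ satisfy $0\le P_k=P_{-k}<1$ for all $k$ and $P_k\sim\beta\|k\|_1^{-s}$. If $\{P_k\}$ is percolating, then it is not critical, i.e. there exists $\epsilon>0$ such that $\{P'_k\}_{k\in\mathbb{Z}^d}$ with $P'_k=(1-\epsilon)P_k$ is also percolating.
   Context: Independent long-range percolation on $\mathbb{Z}^d$ with parameters $\{P_k\}_{k\in\mathbb{Z}^d}$: for every pair of distinct $u,v\in\mathbb{Z}^d$ the bond between $u$ and $v$ is open with probability $P_{u-v}$, independently over the different (unordered) pairs. A cluster is a connected component of the graph of open bonds. $\{P_k\}$ is called percolating if almost surely there exists an infinite cluster. $P_k\sim f(k)$ means $\lim_{\|k\|\to\infty}P_k/f(k)=1$. *)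

theory Defs
  imports "HOL-Probability.Probability"
begin

definition norm1 :: "int ^ 'd \<Rightarrow> real" where
  "norm1 k = (\<Sum>i\<in>UNIV. \<bar>real_of_int (k $ i)\<bar>)"

definition bonds :: "(int ^ 'd) set set" where
  "bonds = {{u, v} | u v. u \<noteq> v}"

(* Bonds are unordered pairs, so the description picks out a unique value only when
   P k = P (- k) for all k; see bond_prob_doubleton. *)
definition bond_prob :: "(int ^ 'd \<Rightarrow> real) \<Rightarrow> (int ^ 'd) set \<Rightarrow> real" where
  "bond_prob P e = (THE p. \<exists>u v. u \<noteq> v \<and> e = {u, v} \<and> p = P (u - v))"

lemma bond_prob_doubleton:
  assumes "\<And>k. P k = P (- k)" and "u \<noteq> v"
  shows "bond_prob P {u, v} = P (u - v)"
  unfolding bond_prob_def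
proof (rule the_equality)
  show "\<exists>u' v'. u' \<noteq> v' \<and> {u, v} = {u', v'} \<and> P (u - v) = P (u' - v')"
    using assms(2) by blast
  show "p = P (u - v)"
    if "\<exists>u' v'. u' \<noteq> v' \<and> {u, v} = {u', v'} \<and> p = P (u' - v')" for p
    using that assms(1)[of "u - v"] by (auto simp: doubleton_eq_iff)
qed

(* A configuration maps each bond to True (open) or False (closed); all bonds are independent. *)
definition percolation_measure ::
    "(int ^ 'd \<Rightarrow> real) \<Rightarrow> ((int ^ 'd) set \<Rightarrow> bool) measure" where
  "percolation_measure P =
     (\<Pi>\<^sub>M e\<in>bonds. measure_pmf (bernoulli_pmf (bond_prob P e)))"

definition open_bond :: "((int ^ 'd) set \<Rightarrow> bool) \<Rightarrow> int ^ 'd \<Rightarrow> int ^ 'd \<Rightarrow> bool" where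
  "open_bond \<omega> u v \<longleftrightarrow> u \<noteq> v \<and> \<omega> {u, v}"

definition cluster :: "((int ^ 'd) set \<Rightarrow> bool) \<Rightarrow> int ^ 'd \<Rightarrow> (int ^ 'd) set" where
  "cluster \<omega> u = {v. (open_bond \<omega>)\<^sup>*\<^sup>* u v}"

definition percolating :: "(int ^ 'd \<Rightarrow> real) \<Rightarrow> bool" where
  "percolating P \<longleftrightarrow> (AE \<omega> in percolation_measure P. \<exists>u. infinite (cluster \<omega> u))"

end

theory Submission imports Defs begin

text \<open>
Write \<open>\<alpha> = s - d\<close>. If the model percolates, then for every \<open>A\<close> and all large \<open>r\<close> the cluster of a vertex
using only bonds shorter than \<open>r\<close> has at least \<open>A r\<^sup>\<alpha>\<close> vertices with probability bounded below: a cluster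
of size between \<open>n0\<close> and \<open>A r\<^sup>\<alpha>\<close> would be a finite cluster of the whole model with a probability
depending only on \<open>A\<close>, and large finite clusters are unlikely. Such clusters may be spread over a region
polynomially larger than \<open>r\<close>. Since a cluster of size \<open>A r\<^sup>\<alpha>\<close> has many long bonds, a union bound over
bipartitions shows that the bonds of length comparable to \<open>r\<close> connect most of these vertices within most tiles of
side \<open>h r\<close>, so a positive fraction of each of many tiles lies in one cluster of a larger box. Because
\<open>s < 2 d\<close>, two vertex sets of positive density in neighbouring tiles of side \<open>L\<close> are joined by about
\<open>L\<^bsup>2 d - s\<^esup>\<close> bonds on average, so clusters merge along dyadic scales with summable loss of density.
This gives a cluster of positive density in a finite box. The density in that box is
continuous in the bond probabilities, hence survives for \<open>(1 - \<epsilon>) P\<close>; tiling space by such boxes and merging once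
more yields clusters of positive density in arbitrarily large boxes, and thus percolation.
\<close>

section \<open>Expectations over finite sets of bonds, and clusters\<close>

text \<open>Two counts meet at the exponent \<alpha>. A vertex has on average O(r^-\<alpha>) bonds
  of length at least \<open>r\<close>, so a short-bond cluster of \<open>A\<close> r^\<alpha>
  vertices is isolated with probability at least some constant depending on \<open>A\<close>.
  Conversely, clusters of \<open>n\<close> vertices admit at most 2^(|V|/n) bipartitions; beating
  this number leaves about |V| (h r)^s / n disconnected pairs, which for n = A r^\<alpha> is a
  fraction h^\<alpha> / A of all pairs in tiles of side \<open>h r\<close>. So \<open>h\<close> has
  to be large compared with the density \<kappa> to be kept, and \<open>A\<close> large compared
  with h^\<alpha>. Since \<kappa> comes from the probability \<theta> of a large cluster, the scheme
  would be circular if \<theta> depended on \<open>A\<close>; it is therefore fixed before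
  \<open>A\<close>. As large clusters may sit in few tiles, \<kappa> arises from \<theta>^2 by
  convexity. Merging costs density of order h^-d for discarded small pieces and h^s r^(s - 2 d) for
  failed links. Neither term grows with \<open>r\<close>, and the constants serve all \<epsilon>
  \<le> 1/2 at once, so one \<open>h\<close> works before and after the perturbation.\<close>

definition weight :: "('e \<Rightarrow> real) \<Rightarrow> 'e set \<Rightarrow> 'e set \<Rightarrow> real" where
  "weight p F \<eta> = (\<Prod>e\<in>F. if e \<in> \<eta> then p e else 1 - p e)"

text \<open>A configuration is the set of open bonds and the Bernoulli expectation is a finite sum.
  Conditioning thus becomes Fubini over disjoint bond sets (\<open>expect_union\<close>), and
  continuity in \<open>p\<close> is that of a polynomial; measure theory is confined to the last
  section.\<close>

definition expect :: "('e \<Rightarrow> real) \<Rightarrow> 'e set \<Rightarrow> ('e set \<Rightarrow> real) \<Rightarrow> real" where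
  "expect p F f = (\<Sum>\<eta>\<in>Pow F. weight p F \<eta> * f \<eta>)"

lemma expect_empty [simp]: "expect p {} f = f {}"
  by (simp add: expect_def weight_def)

lemma expect_cong:
  assumes "\<And>\<eta>. \<eta> \<subseteq> F \<Longrightarrow> f \<eta> = g \<eta>"
  shows "expect p F f = expect p F g"
  unfolding expect_def using assms by (intro sum.cong) auto

lemma expect_cong_prob:
  assumes "\<And>e. e \<in> F \<Longrightarrow> p e = q e"
  shows "expect p F f = expect q F f"
  unfolding expect_def weight_def using assms by (intro sum.cong arg_cong2[where f="(*)"] prod.cong) auto

lemma expect_insert:
  assumes "finite F" "e \<notin> F"
  shows "expect p (insert e F) f = p e * expect p F (\<lambda>\<eta>. f (insert e \<eta>)) + (1 - p e) * expect p F f"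
proof -
  have inj: "inj_on (insert e) (Pow F)"
    using assms(2) by (auto simp: inj_on_def)
  have dj: "Pow F \<inter> insert e ` Pow F = {}"
    using assms(2) by auto
  have w1: "weight p (insert e F) \<eta> = (1 - p e) * weight p F \<eta>" if "\<eta> \<in> Pow F" for \<eta>
    using that assms by (auto simp: weight_def)
  have w2: "weight p (insert e F) (insert e \<eta>) = p e * weight p F \<eta>" if "\<eta> \<in> Pow F" for \<eta>
  proof -
    have "(\<Prod>x\<in>F. if x \<in> insert e \<eta> then p x else 1 - p x) = (\<Prod>x\<in>F. if x \<in> \<eta> then p x else 1 - p x)"
      using assms(2) by (intro prod.cong) auto
    then show ?thesis using assms by (simp add: weight_def)
  qed
  have "expect p (insert e F) f = (\<Sum>\<eta>\<in>Pow F. weight p (insert e F) \<eta> * f \<eta>)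
      + (\<Sum>\<eta>\<in>Pow F. weight p (insert e F) (insert e \<eta>) * f (insert e \<eta>))"
    unfolding expect_def Pow_insert using assms(1) dj
    by (subst sum.union_disjoint) (auto simp: sum.reindex[OF inj])
  also have "\<dots> = (\<Sum>\<eta>\<in>Pow F. (1 - p e) * (weight p F \<eta> * f \<eta>))
      + (\<Sum>\<eta>\<in>Pow F. p e * (weight p F \<eta> * f (insert e \<eta>)))"
    using w1 w2 by (intro arg_cong2[where f="(+)"] sum.cong) (auto simp: mult.assoc)
  finally show ?thesis
    by (simp add: expect_def sum_distrib_left)
qed

lemma expect_union:
  assumes "finite F" "finite G" "F \<inter> G = {}"
  shows "expect p (F \<union> G) f = expect p F (\<lambda>\<eta>. expect p G (\<lambda>\<zeta>. f (\<eta> \<union> \<zeta>)))"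
  using assms(1,3)
proof (induction F arbitrary: f rule: finite_induct)
  case (insert e F)
  have "expect p (insert e (F \<union> G)) f
      = p e * expect p (F \<union> G) (\<lambda>\<eta>. f (insert e \<eta>)) + (1 - p e) * expect p (F \<union> G) f"
    using insert assms(2) by (intro expect_insert) auto
  then show ?case
    using insert by (simp add: expect_insert)
qed simp

lemma expect_const [simp]: "finite F \<Longrightarrow> expect p F (\<lambda>_. c) = c"
  by (induction F rule: finite_induct) (auto simp: expect_insert algebra_simps)

lemma expect_add: "expect p F (\<lambda>\<eta>. f \<eta> + g \<eta>) = expect p F f + expect p F g"
  by (simp add: expect_def algebra_simps sum.distrib)

lemma expect_diff: "expect p F (\<lambda>\<eta>. f \<eta> - g \<eta>) = expect p F f - expect p F g"
  by (simp add: expect_def algebra_simps sum_subtractf)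

lemma expect_cmult: "expect p F (\<lambda>\<eta>. c * f \<eta>) = c * expect p F f"
  by (simp add: expect_def sum_distrib_left algebra_simps)

lemma expect_sum: "expect p F (\<lambda>\<eta>. \<Sum>i\<in>I. f i \<eta>) = (\<Sum>i\<in>I. expect p F (f i))"
  unfolding expect_def sum_distrib_left by (rule sum.swap)

lemma weight_nonneg:
  assumes "\<And>e. e \<in> F \<Longrightarrow> 0 \<le> p e \<and> p e \<le> 1"
  shows "0 \<le> weight p F \<eta>"
  unfolding weight_def using assms by (intro prod_nonneg) auto

lemma expect_mono:
  assumes "\<And>e. e \<in> F \<Longrightarrow> 0 \<le> p e \<and> p e \<le> 1" "\<And>\<eta>. \<eta> \<subseteq> F \<Longrightarrow> f \<eta> \<le> g \<eta>"
  shows "expect p F f \<le> expect p F g"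
  unfolding expect_def using assms by (intro sum_mono mult_left_mono weight_nonneg) auto

lemma expect_restrict:
  assumes "finite F" "G \<subseteq> F"
  shows "expect p F (\<lambda>\<eta>. f (\<eta> \<inter> G)) = expect p G f"
proof -
  have "expect p (G \<union> (F - G)) (\<lambda>\<eta>. f (\<eta> \<inter> G))
      = expect p G (\<lambda>\<eta>. expect p (F - G) (\<lambda>\<zeta>. f ((\<eta> \<union> \<zeta>) \<inter> G)))"
    using assms finite_subset by (intro expect_union) auto
  also have "\<dots> = expect p G (\<lambda>\<eta>. expect p (F - G) (\<lambda>\<zeta>. f \<eta>))"
    by (intro expect_cong arg_cong[where f=f]) blast
  finally show ?thesis
    using assms by (simp add: Un_absorb1)
qed

text \<open>For an increasing \<open>f\<close>, closing all bonds outside \<open>G\<close> can only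
  lower the value.\<close>

lemma expect_mono_set:
  assumes "finite F" "G \<subseteq> F" "\<And>e. e \<in> F \<Longrightarrow> 0 \<le> p e \<and> p e \<le> 1"
    and "\<And>\<eta> \<zeta>. \<eta> \<subseteq> \<zeta> \<Longrightarrow> \<zeta> \<subseteq> F \<Longrightarrow> f \<eta> \<le> f \<zeta>"
  shows "expect p G f \<le> expect p F f"
  unfolding expect_restrict[OF assms(1,2), symmetric]
  using assms(3,4) by (intro expect_mono) auto

lemma expect_all_closed:
  assumes "finite F" "D \<subseteq> F"
  shows "expect p F (\<lambda>\<eta>. of_bool (\<eta> \<inter> D = {})) = (\<Prod>e\<in>D. 1 - p e)"
proof -
  have "expect p D (\<lambda>\<eta>. of_bool (\<eta> = {})) = (\<Prod>e\<in>D. 1 - p e)" if "finite D"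
    using that
  proof (induction D rule: finite_induct)
    case (insert e D)
    have "expect p D (\<lambda>\<eta>. of_bool (insert e \<eta> = {})) = 0"
      using insert expect_const[of D p 0] by simp
    with insert show ?case by (simp add: expect_insert)
  qed simp
  with expect_restrict[OF assms, of p "\<lambda>\<eta>. of_bool (\<eta> = {})"] assms finite_subset show ?thesis
    by auto
qed

lemma expect_all_closed_le:
  assumes "finite F" "D \<subseteq> F" "\<And>e. e \<in> D \<Longrightarrow> c \<le> p e \<and> p e \<le> 1"
  shows "expect p F (\<lambda>\<eta>. of_bool (\<eta> \<inter> D = {})) \<le> exp (- c * real (card D))"
proof -
  have "(\<Prod>e\<in>D. 1 - p e) \<le> (\<Prod>e\<in>D. exp (- c))"
  proof (intro prod_mono conjI)
    fix e assume "e \<in> D"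
    with assms(3) show "0 \<le> 1 - p e" by auto
    have "1 - p e \<le> 1 + (- c)" using assms(3)[OF \<open>e \<in> D\<close>] by simp
    also have "\<dots> \<le> exp (- c)" by (rule exp_ge_add_one_self)
    finally show "1 - p e \<le> exp (- c)" .
  qed
  also have "\<dots> = exp (- c * real (card D))"
    by (simp add: exp_of_nat_mult[symmetric] mult.commute)
  finally show ?thesis using expect_all_closed[OF assms(1,2)] by simp
qed

lemma expect_some_open_le:
  assumes "finite F" "D \<subseteq> F" "\<And>e. e \<in> F \<Longrightarrow> 0 \<le> p e \<and> p e \<le> 1"
  shows "expect p F (\<lambda>\<eta>. of_bool (\<eta> \<inter> D \<noteq> {})) \<le> (\<Sum>e\<in>D. p e)"
proof -
  have fD: "finite D" using assms finite_subset by blast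
  have "expect p F (\<lambda>\<eta>. of_bool (\<eta> \<inter> D \<noteq> {})) \<le> expect p F (\<lambda>\<eta>. \<Sum>e\<in>D. 1 - of_bool (\<eta> \<inter> {e} = {}))"
  proof (rule expect_mono[OF assms(3)])
    fix \<eta>
    show "of_bool (\<eta> \<inter> D \<noteq> {}) \<le> (\<Sum>e\<in>D. 1 - of_bool (\<eta> \<inter> {e} = {}) :: real)"
    proof (cases "\<eta> \<inter> D = {}")
      case False
      then obtain e where e: "e \<in> \<eta>" "e \<in> D" by blast
      have "(1::real) - of_bool (\<eta> \<inter> {e} = {}) \<le> (\<Sum>e\<in>D. 1 - of_bool (\<eta> \<inter> {e} = {}))"
        using e fD by (intro member_le_sum) auto
      then show ?thesis using e by auto
    qed (auto intro!: sum_nonneg)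
  qed
  also have "\<dots> = (\<Sum>e\<in>D. 1 - expect p F (\<lambda>\<eta>. of_bool (\<eta> \<inter> {e} = {})))"
    using assms(1) by (simp add: expect_sum expect_diff del: Int_insert_right)
  also have "\<dots> = (\<Sum>e\<in>D. p e)"
  proof (rule sum.cong)
    fix e assume "e \<in> D"
    then have "expect p F (\<lambda>\<eta>. of_bool (\<eta> \<inter> {e} = {})) = (\<Prod>e\<in>{e}. 1 - p e)"
      using assms(1,2) by (intro expect_all_closed) auto
    then show "1 - expect p F (\<lambda>\<eta>. of_bool (\<eta> \<inter> {e} = {})) = p e" by simp
  qed simp
  finally show ?thesis .
qed

lemma expect_image:
  assumes "inj_on \<phi> F" "\<And>e. e \<in> F \<Longrightarrow> p (\<phi> e) = p e"
  shows "expect p (\<phi> ` F) f = expect p F (\<lambda>\<eta>. f (\<phi> ` \<eta>))"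
proof -
  have inj: "inj_on ((`) \<phi>) (Pow F)"
    using assms(1) by (auto simp: inj_on_def dest: inj_on_image_eq_iff[OF assms(1)])
  have "Pow (\<phi> ` F) = (`) \<phi> ` Pow F"
    by (simp add: image_Pow_surj)
  then have "expect p (\<phi> ` F) f = (\<Sum>\<eta>\<in>Pow F. weight p (\<phi> ` F) (\<phi> ` \<eta>) * f (\<phi> ` \<eta>))"
    by (simp add: expect_def sum.reindex[OF inj])
  also have "\<dots> = expect p F (\<lambda>\<eta>. f (\<phi> ` \<eta>))"
    unfolding expect_def
  proof (intro sum.cong refl arg_cong2[where f="(*)"])
    fix \<eta> assume "\<eta> \<in> Pow F"
    then have "\<phi> e \<in> \<phi> ` \<eta> \<longleftrightarrow> e \<in> \<eta>" if "e \<in> F" for e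
      using that assms(1) by (auto simp: inj_on_def)
    then show "weight p (\<phi> ` F) (\<phi> ` \<eta>) = weight p F \<eta>"
      using assms by (auto simp: weight_def prod.reindex intro!: prod.cong)
  qed
  finally show ?thesis .
qed

lemma tendsto_expect:
  assumes "\<And>e. e \<in> F \<Longrightarrow> ((\<lambda>x. p x e) \<longlongrightarrow> q e) G"
  shows "((\<lambda>x. expect (p x) F f) \<longlongrightarrow> expect q F f) G"
  unfolding expect_def weight_def
proof (intro tendsto_intros)
  fix \<eta> e assume "e \<in> F"
  with assms show "((\<lambda>x. if e \<in> \<eta> then p x e else 1 - p x e) \<longlongrightarrow> (if e \<in> \<eta> then q e else 1 - q e)) G"
    by (cases "e \<in> \<eta>") (auto intro!: tendsto_intros)
qed

section \<open>Clusters as reachability classes\<close>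

definition reach :: "'v set set \<Rightarrow> 'v \<Rightarrow> 'v set" where
  "reach \<eta> u = {v. (\<lambda>x y. {x, y} \<in> \<eta>)\<^sup>*\<^sup>* u v}"

definition pairs :: "'v set \<Rightarrow> 'v set set" where
  "pairs V = {{x, y} | x y. x \<in> V \<and> y \<in> V \<and> x \<noteq> y}"

lemma reach_refl [simp, intro]: "u \<in> reach \<eta> u"
  by (simp add: reach_def)

lemma reach_step: "v \<in> reach \<eta> u \<Longrightarrow> {v, w} \<in> \<eta> \<Longrightarrow> w \<in> reach \<eta> u"
  unfolding reach_def using rtranclp.rtrancl_into_rtrancl[of "\<lambda>x y. {x, y} \<in> \<eta>"] by blast

lemma reach_trans: "v \<in> reach \<eta> u \<Longrightarrow> w \<in> reach \<eta> v \<Longrightarrow> w \<in> reach \<eta> u"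
  unfolding reach_def by auto

lemma reach_sym: "v \<in> reach \<eta> u \<longleftrightarrow> u \<in> reach \<eta> v"
proof -
  have "(\<lambda>x y. {x, y} \<in> \<eta>)\<inverse>\<inverse> = (\<lambda>x y. {x, y} \<in> \<eta>)"
    by (simp add: fun_eq_iff insert_commute)
  then show ?thesis
    unfolding reach_def by (metis mem_Collect_eq rtranclp_conversep conversep_iff)
qed

lemma reach_eq: "v \<in> reach \<eta> u \<Longrightarrow> reach \<eta> v = reach \<eta> u"
  by (meson reach_sym reach_trans subsetI subset_antisym)

lemma reach_mono: "\<eta> \<subseteq> \<zeta> \<Longrightarrow> reach \<eta> u \<subseteq> reach \<zeta> u"
  unfolding reach_def
  by (auto elim!: rtranclp_mono[THEN predicate2D, rotated])

lemma reach_least: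
  assumes "u \<in> S" "\<And>x y. x \<in> S \<Longrightarrow> {x, y} \<in> \<eta> \<Longrightarrow> y \<in> S"
  shows "reach \<eta> u \<subseteq> S"
proof
  fix v assume "v \<in> reach \<eta> u"
  then have "(\<lambda>x y. {x, y} \<in> \<eta>)\<^sup>*\<^sup>* u v" by (simp add: reach_def)
  then show "v \<in> S" by (induction rule: rtranclp_induct) (use assms in auto)
qed

lemma reach_subset:
  assumes "\<eta> \<subseteq> pairs V" "u \<in> V"
  shows "reach \<eta> u \<subseteq> V"
proof (rule reach_least[OF assms(2)])
  fix x y assume "{x, y} \<in> \<eta>"
  with assms(1) have "{x, y} \<in> pairs V" by blast
  then show "y \<in> V" by (auto simp: pairs_def doubleton_eq_iff)
qed

lemma finite_pairs [simp]: "finite V \<Longrightarrow> finite (pairs V)"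
  by (rule finite_subset[of _ "(\<lambda>(x, y). {x, y}) ` (V \<times> V)"]) (auto simp: pairs_def)

lemma pairs_mono: "V \<subseteq> W \<Longrightarrow> pairs V \<subseteq> pairs W"
  by (auto simp: pairs_def)

lemma reach_finite:
  assumes "\<eta> \<subseteq> pairs V" "finite V"
  shows "finite (reach \<eta> u)"
proof -
  have "reach \<eta> u \<subseteq> insert u V"
    using assms(1) pairs_mono[of V "insert u V"] by (intro reach_subset) auto
  then show ?thesis using assms(2) finite_subset by blast
qed

lemma reach_image:
  assumes "inj \<phi>"
  shows "reach ((`) \<phi> ` \<eta>) (\<phi> u) = \<phi> ` reach \<eta> u"
proof
  have step: "\<exists>b. y = \<phi> b \<and> {a, b} \<in> \<eta>" if edge: "{\<phi> a, y} \<in> (`) \<phi> ` \<eta>" for a y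
  proof -
    from edge obtain e where e: "e \<in> \<eta>" "{\<phi> a, y} = \<phi> ` e" by blast
    have "y \<in> \<phi> ` e" unfolding e(2)[symmetric] by simp
    then obtain b where b: "y = \<phi> b" by blast
    with e(2) have "\<phi> ` {a, b} = \<phi> ` e" by simp
    then have "{a, b} = e" by (simp only: inj_image_eq_iff[OF assms])
    then show ?thesis using b e by blast
  qed
  show "reach ((`) \<phi> ` \<eta>) (\<phi> u) \<subseteq> \<phi> ` reach \<eta> u"
  proof (rule reach_least)
    fix x y assume "x \<in> \<phi> ` reach \<eta> u" and e: "{x, y} \<in> (`) \<phi> ` \<eta>"
    then obtain a where a: "x = \<phi> a" "a \<in> reach \<eta> u" by blast
    with e step obtain b where "y = \<phi> b" "{a, b} \<in> \<eta>" by blast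
    with a(2) reach_step show "y \<in> \<phi> ` reach \<eta> u" by fast
  qed simp
  have "reach \<eta> u \<subseteq> {v. \<phi> v \<in> reach ((`) \<phi> ` \<eta>) (\<phi> u)}"
  proof (rule reach_least)
    fix x y assume x: "x \<in> {v. \<phi> v \<in> reach ((`) \<phi> ` \<eta>) (\<phi> u)}" and e: "{x, y} \<in> \<eta>"
    from imageI[OF e, of "(`) \<phi>"] have "{\<phi> x, \<phi> y} \<in> (`) \<phi> ` \<eta>" by simp
    with x show "y \<in> {v. \<phi> v \<in> reach ((`) \<phi> ` \<eta>) (\<phi> u)}"
      using reach_step[of "\<phi> x" _ _ "\<phi> y"] by simp
  qed auto
  then show "\<phi> ` reach \<eta> u \<subseteq> reach ((`) \<phi> ` \<eta>) (\<phi> u)" by auto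
qed

section \<open>Boxes and tail sums in the lattice\<close>

lemma card_vec_box:
  fixes S :: "'d::finite \<Rightarrow> 'a set"
  shows "card {x :: 'a ^ 'd. \<forall>i. x $ i \<in> S i} = (\<Prod>i\<in>UNIV. card (S i))"
proof -
  have "bij_betw vec_lambda (PiE UNIV S) {x :: 'a ^ 'd. \<forall>i. x $ i \<in> S i}"
    by (rule bij_betw_byWitness[where f'=vec_nth]) (auto simp: PiE_UNIV_domain)
  from bij_betw_same_card[OF this] show ?thesis
    by (simp add: card_PiE)
qed

lemma finite_vec_box:
  fixes S :: "'d::finite \<Rightarrow> 'a set"
  assumes "\<And>i. finite (S i)"
  shows "finite {x :: 'a ^ 'd. \<forall>i. x $ i \<in> S i}"
proof -
  have "{x :: 'a ^ 'd. \<forall>i. x $ i \<in> S i} = vec_lambda ` PiE UNIV S"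
  proof (intro set_eqI iffI)
    fix x :: "'a ^ 'd" assume "x \<in> {x. \<forall>i. x $ i \<in> S i}"
    then show "x \<in> vec_lambda ` PiE UNIV S"
      by (intro image_eqI[of _ _ "vec_nth x"]) (auto simp: PiE_UNIV_domain)
  qed (auto simp: PiE_UNIV_domain)
  then show ?thesis using assms by (simp add: finite_PiE)
qed

lemma norm1_nonneg [simp]: "0 \<le> norm1 k"
  by (simp add: norm1_def sum_nonneg)

lemma norm1_zero [simp]: "norm1 0 = 0"
  by (simp add: norm1_def)

lemma norm1_minus [simp]: "norm1 (- k) = norm1 k"
  by (simp add: norm1_def)

lemma norm1_diff_commute: "norm1 (x - y) = norm1 (y - x)"
  by (metis minus_diff_eq norm1_minus)

lemma norm1_triangle: "norm1 (x + y) \<le> norm1 x + norm1 y"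
  unfolding norm1_def sum.distrib[symmetric] by (intro sum_mono) auto

lemma norm1_triangle_diff: "norm1 (x - z) \<le> norm1 (x - y) + norm1 (y - z)"
  using norm1_triangle[of "x - y" "y - z"] by simp

lemma abs_component_le_norm1: "\<bar>real_of_int (x $ i)\<bar> \<le> norm1 x"
  unfolding norm1_def by (rule member_le_sum) auto

lemma norm1_ge_1: "k \<noteq> 0 \<Longrightarrow> 1 \<le> norm1 k"
proof -
  assume "k \<noteq> 0"
  then obtain i where "k $ i \<noteq> 0" by (auto simp: vec_eq_iff)
  then have "1 \<le> \<bar>real_of_int (k $ i)\<bar>" by linarith
  also have "\<dots> \<le> norm1 k" by (rule abs_component_le_norm1)
  finally show ?thesis .
qed

lemma norm1_ball_subset_box: "{x :: int ^ 'd::finite. norm1 x < real r} \<subseteq> {x. \<forall>i. x $ i \<in> {- int r<..<int r}}"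
proof clarify
  fix x :: "int ^ 'd" and i
  assume "norm1 x < real r"
  with abs_component_le_norm1[of x i] have "\<bar>real_of_int (x $ i)\<bar> < real r" by linarith
  then show "x $ i \<in> {- int r<..<int r}" by auto
qed

lemma finite_norm1_ball: "finite {x :: int ^ 'd::finite. norm1 x < a}"
proof -
  obtain r where "a \<le> real r" using real_arch_simple by blast
  then have "{x :: int ^ 'd::finite. norm1 x < a} \<subseteq> {x. norm1 x < real r}" by auto
  also note norm1_ball_subset_box
  finally show ?thesis by (rule finite_subset) (rule finite_vec_box, rule finite_greaterThanLessThan_int)
qed

lemma card_norm1_ball: "card {x :: int ^ 'd::finite. norm1 x < real r} \<le> (2 * r) ^ CARD('d)"
proof -
  have "card {x :: int ^ 'd::finite. norm1 x < real r} \<le> card {x :: int ^ 'd. \<forall>i. x $ i \<in> {- int r<..<int r}}"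
    by (rule card_mono[OF _ norm1_ball_subset_box]) (rule finite_vec_box, rule finite_greaterThanLessThan_int)
  also have "\<dots> = (\<Prod>i\<in>(UNIV :: 'd set). nat (2 * int r - 1))"
    by (subst card_vec_box) (simp add: algebra_simps)
  also have "\<dots> \<le> (2 * r) ^ CARD('d)"
    unfolding prod_constant by (rule power_mono) auto
  finally show ?thesis .
qed

lemma finite_norm1_ball_around: "finite {y :: int ^ 'd::finite. norm1 (x - y) < a}"
proof -
  have "{y :: int ^ 'd. norm1 (x - y) < a} = (\<lambda>k. x - k) ` {k. norm1 k < a}"
    by (force simp: image_iff intro: exI[of _ "x - _"])
  then show ?thesis using finite_imageI[OF finite_norm1_ball] by metis
qed

lemma card_norm1_ball_around:
  "card {y :: int ^ 'd::finite. norm1 (x - y) < real r} \<le> (2 * r) ^ CARD('d)"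
proof -
  have "{y :: int ^ 'd. norm1 (x - y) < real r} = (\<lambda>k. x - k) ` {k. norm1 k < real r}"
    by (force simp: image_iff intro: exI[of _ "x - _"])
  then have "card {y :: int ^ 'd. norm1 (x - y) < real r} \<le> card {k :: int ^ 'd. norm1 k < real r}"
    using card_image_le[OF finite_norm1_ball] by metis
  with card_norm1_ball show ?thesis by (rule le_trans[rotated])
qed

section \<open>Nested tilings by cubes\<close>

definition cell :: "nat \<Rightarrow> int ^ 'd \<Rightarrow> int ^ 'd" where
  "cell L x = (\<chi> i. x $ i div int L)"

definition tile :: "nat \<Rightarrow> int ^ 'd \<Rightarrow> (int ^ 'd) set" where
  "tile L z = {x. cell L x = z}"

lemma mem_tile: "x \<in> tile L z \<longleftrightarrow> cell L x = z"
  by (simp add: tile_def)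

text \<open>Floor divisions compose, so tilings of sides \<open>L\<close> and \<open>L * K\<close>
  are nested exactly. Tile indices are again lattice points, and the subtiles of a large tile are
  indexed by a tile of side \<open>K\<close>.\<close>

lemma cell_mult: "cell (L * K) x = cell K (cell L x)"
  by (simp add: cell_def vec_eq_iff zdiv_zmult2_eq)

lemma cell_1 [simp]: "cell (Suc 0) x = x"
  by (simp add: cell_def vec_eq_iff)

lemma tile_conv_box:
  assumes "L > 0"
  shows "tile L z = {x :: int ^ 'd::finite. \<forall>i. x $ i \<in> {int L * z $ i..<int L * z $ i + int L}}"
proof -
  have "a div int L = b \<longleftrightarrow> a \<in> {int L * b..<int L * b + int L}" for a b :: int
  proof
    assume "a div int L = b"
    with assms(1) show "a \<in> {int L * b..<int L * b + int L}"
      using pos_mod_bound[of "int L" a] pos_mod_sign[of "int L" a] mult_div_mod_eq[of "int L" a]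
      by (simp del: mult_div_mod_eq minus_div_mult_eq_mod mod_mult_div_eq pos_mod_bound pos_mod_sign; linarith)
  next
    assume "a \<in> {int L * b..<int L * b + int L}"
    then show "a div int L = b"
      by (intro int_div_pos_eq[of _ _ _ "a - int L * b"]) auto
  qed
  then show ?thesis by (auto simp: tile_def cell_def vec_eq_iff)
qed

lemma finite_tile [simp]: "L > 0 \<Longrightarrow> finite (tile L z :: (int ^ 'd::finite) set)"
  unfolding tile_conv_box by (rule finite_vec_box) (rule finite_atLeastLessThan_int)

lemma card_tile: "L > 0 \<Longrightarrow> card (tile L z :: (int ^ 'd::finite) set) = L ^ CARD('d)"
  by (subst tile_conv_box, assumption, subst card_vec_box) simp

lemma tile_nonempty: "L > 0 \<Longrightarrow> tile L (z :: int ^ 'd::finite) \<noteq> {}"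
  using card_tile[of L z] by (metis card.empty power_not_zero less_numeral_extra(3) not_gr_zero)

lemma tile_mult: "tile (L * K) z = (\<Union>w\<in>tile K z. tile L w)"
  by (auto simp: mem_tile cell_mult)

lemma tile_disjoint: "z \<noteq> w \<Longrightarrow> tile L z \<inter> tile L w = {}"
  by (auto simp: mem_tile)

lemma sum_tile_mult:
  assumes "L > 0" "K > 0"
  shows "(\<Sum>x\<in>tile (L * K) (z :: int ^ 'd::finite). f x) = (\<Sum>w\<in>tile K z. \<Sum>x\<in>tile L w. f x)"
  unfolding tile_mult using assms by (intro sum.UNION_disjoint) (auto simp: mem_tile)

lemma norm1_diff_tile_le:
  assumes "L > 0" "x \<in> tile L z" "y \<in> tile L (z :: int ^ 'd::finite)"
  shows "norm1 (x - y) \<le> real CARD('d) * real L"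
proof -
  have "\<bar>real_of_int ((x - y) $ i)\<bar> \<le> real L" for i
  proof -
    have "x $ i \<in> {int L * z $ i..<int L * z $ i + int L}" "y $ i \<in> {int L * z $ i..<int L * z $ i + int L}"
      using assms by (auto simp: tile_conv_box)
    then have "\<bar>x $ i - y $ i\<bar> \<le> int L" by auto
    then show ?thesis by (simp add: abs_le_iff)
  qed
  then have "norm1 (x - y) \<le> (\<Sum>i\<in>(UNIV :: 'd set). real L)"
    unfolding norm1_def by (intro sum_mono)
  then show ?thesis by simp
qed

text \<open>Sum over dyadic shells: the shell of radius about 2^j r has O((2^j r)^d) points of
  weight O((2^j r)^-s), which gives a geometric series of ratio 2^(d - s) < 1. Finite
  \<open>K\<close> with a uniform constant take the place of an infinite sum.\<close>

lemma lattice_tail_sum: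
  fixes P :: "int ^ 'd::finite \<Rightarrow> real"
  assumes "real CARD('d) < s" "0 \<le> C" "\<And>k. k \<noteq> 0 \<Longrightarrow> P k \<le> C * norm1 k powr (- s)"
  shows "\<exists>C'\<ge>0. \<forall>r\<ge>1. \<forall>K. finite K \<longrightarrow> (\<forall>k\<in>K. real r \<le> norm1 k) \<longrightarrow>
    (\<Sum>k\<in>K. P k) \<le> C' * real r powr (real CARD('d) - s)"
proof -
  define d where "d = real CARD('d)"
  define x where "x = 2 powr (d - s)"
  have x: "0 < x" "x < 1" using assms(1) by (auto simp: x_def d_def powr_less_one)
  \<comment> \<open>The 4 comes from the outer shell radius \<open>2 * a\<close> and the bound (2
    \<rho>)^d for the number of points in a ball of radius \<rho>.\<close>
  define B where "B = C * 4 powr d"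
  have B0: "0 \<le> B" using assms(2) by (simp add: B_def)
  have shell: "(\<Sum>k\<in>K. P k) \<le> B * real r powr (d - s) * (\<Sum>j<J. x ^ j)"
    if "1 \<le> r" "finite K" "\<And>k. k \<in> K \<Longrightarrow> real r \<le> norm1 k" "\<And>k. k \<in> K \<Longrightarrow> norm1 k < 2 ^ J * real r"
    for r :: nat and K J
    using that(2-)
  proof (induction J arbitrary: K)
    case 0
    then have "K = {}" by fastforce
    then show ?case by simp
  next
    case (Suc J)
    define K1 where "K1 = {k \<in> K. norm1 k < 2 ^ J * real r}"
    define K2 where "K2 = {k \<in> K. norm1 k \<ge> 2 ^ J * real r}"
    define a where "a = 2 ^ J * real r"
    have a: "a \<ge> 1" using that(1) by (simp add: a_def mult_ge1_I)
    have "(\<Sum>k\<in>K1. P k) \<le> B * real r powr (d - s) * (\<Sum>j<J. x ^ j)"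
      using Suc.prems by (intro Suc.IH) (auto simp: K1_def)
    moreover have "(\<Sum>k\<in>K2. P k) \<le> B * real r powr (d - s) * x ^ J"
    proof -
      have "P k \<le> C * a powr (- s)" if "k \<in> K2" for k
      proof -
        have k: "a \<le> norm1 k" using that by (simp add: K2_def a_def)
        with a have "k \<noteq> 0" by auto
        then have "P k \<le> C * norm1 k powr (- s)" by (rule assms(3))
        also have "\<dots> \<le> C * a powr (- s)"
          using k a assms(1,2) by (intro mult_left_mono powr_mono2') (auto simp: order.trans[of 0 "real CARD('d)"])
        finally show ?thesis .
      qed
      then have "(\<Sum>k\<in>K2. P k) \<le> real (card K2) * (C * a powr (- s))"
        by (rule sum_bounded_above)
      also have "\<dots> \<le> (4 * a) powr d * (C * a powr (- s))"
      proof (rule mult_right_mono)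
        have "K2 \<subseteq> {k. norm1 k < real (2 ^ Suc J * r)}"
          using Suc.prems(3) by (auto simp: K2_def)
        then have "card K2 \<le> (2 * (2 ^ Suc J * r)) ^ CARD('d)"
          using le_trans[OF card_mono[OF finite_norm1_ball] card_norm1_ball] by blast
        then have "real (card K2) \<le> real ((2 * (2 ^ Suc J * r)) ^ CARD('d))"
          by (simp only: of_nat_le_iff)
        also have "\<dots> = (4 * a) powr d"
          using a by (simp add: a_def d_def powr_realpow)
        finally show "real (card K2) \<le> (4 * a) powr d" .
      qed (use assms(2) in auto)
      also have "\<dots> = B * a powr (d - s)"
        using a by (simp add: B_def powr_mult powr_diff powr_minus field_simps)
      also have "a powr (d - s) = x ^ J * real r powr (d - s)"
        by (simp add: a_def x_def powr_mult powr_power powr_powr powr_realpow[symmetric] mult.commute)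
      finally show ?thesis by (simp add: mult_ac)
    qed
    moreover have "(\<Sum>k\<in>K. P k) = (\<Sum>k\<in>K1. P k) + (\<Sum>k\<in>K2. P k)"
    proof -
      have "K = K1 \<union> K2" "K1 \<inter> K2 = {}" by (auto simp: K1_def K2_def)
      with Suc.prems(1) show ?thesis by (metis sum.union_disjoint finite_Un)
    qed
    ultimately show ?case by (simp add: algebra_simps)
  qed
  define C' where "C' = B / (1 - x)"
  have "(\<Sum>k\<in>K. P k) \<le> C' * real r powr (real CARD('d) - s)"
    if r: "1 \<le> r" and K: "finite K" "\<forall>k\<in>K. real r \<le> norm1 k" for r :: nat and K
  proof -
    obtain J where "Max (insert 0 (norm1 ` K)) < 2 ^ J"
      using real_arch_pow[of 2] by auto
    then have "norm1 k < 2 ^ J" if "k \<in> K" for k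
      using K that Max_ge[of "insert 0 (norm1 ` K)" "norm1 k"] by fastforce
    moreover have "(2::real) ^ J * 1 \<le> 2 ^ J * real r" using r by (intro mult_left_mono) auto
    ultimately have "norm1 k < 2 ^ J * real r" if "k \<in> K" for k
      using that by (metis mult.right_neutral order_less_le_trans)
    then have "(\<Sum>k\<in>K. P k) \<le> B * real r powr (d - s) * (\<Sum>j<J. x ^ j)"
      using K r by (intro shell) auto
    also have "\<dots> \<le> B * real r powr (d - s) * (1 / (1 - x))"
    proof (rule mult_left_mono)
      have "(\<Sum>j<J. x ^ j) \<le> (\<Sum>j. x ^ j)"
        using x by (intro sum_le_suminf summable_geometric) auto
      then show "(\<Sum>j<J. x ^ j) \<le> 1 / (1 - x)" using x by (simp add: suminf_geometric)
    qed (use B0 in auto)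
    finally show ?thesis by (simp add: C'_def d_def)
  qed
  moreover have "C' \<ge> 0" using B0 x by (simp add: C'_def)
  ultimately show ?thesis by blast
qed

section \<open>Merging clusters across dyadic scales\<close>

text \<open>Only the trace on \<open>B\<close> is counted: a connecting path may leave
  \<open>B\<close>. This makes \<open>peak\<close> increasing in the configuration and lets bonds
  crossing tile boundaries help.\<close>

definition peak :: "'v set set \<Rightarrow> 'v set \<Rightarrow> nat" where
  "peak \<eta> B = Max ((\<lambda>u. card (reach \<eta> u \<inter> B)) ` B)"

lemma card_reach_le_peak:
  assumes "finite B"
  shows "card (reach \<eta> u \<inter> B) \<le> peak \<eta> B"
proof (cases "reach \<eta> u \<inter> B = {}")
  case False
  then obtain v where v: "v \<in> reach \<eta> u" "v \<in> B" by blast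
  then have "card (reach \<eta> u \<inter> B) = card (reach \<eta> v \<inter> B)" by (simp add: reach_eq)
  also have "\<dots> \<le> peak \<eta> B" unfolding peak_def using v(2) assms by (intro Max_ge) auto
  finally show ?thesis .
qed simp

lemma peak_attained:
  assumes "finite B" "B \<noteq> {}"
  obtains u where "u \<in> B" "card (reach \<eta> u \<inter> B) = peak \<eta> B"
proof -
  have "peak \<eta> B \<in> (\<lambda>u. card (reach \<eta> u \<inter> B)) ` B"
    unfolding peak_def using assms by (intro Max_in) auto
  with that show ?thesis by auto
qed

lemma peak_le_card: "finite B \<Longrightarrow> B \<noteq> {} \<Longrightarrow> peak \<eta> B \<le> card B"
  by (metis peak_attained card_mono inf_le2)

lemma peak_mono:
  assumes "finite B" "B \<noteq> {}" "\<eta> \<subseteq> \<zeta>"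
  shows "peak \<eta> B \<le> peak \<zeta> B"
proof -
  obtain u where u: "card (reach \<eta> u \<inter> B) = peak \<eta> B"
    using assms by (metis peak_attained)
  have "card (reach \<eta> u \<inter> B) \<le> card (reach \<zeta> u \<inter> B)"
    using reach_mono[OF assms(3), of u] assms(1) by (intro card_mono) auto
  also have "\<dots> \<le> peak \<zeta> B" using assms(1) by (rule card_reach_le_peak)
  finally show ?thesis using u by simp
qed

text \<open>All pieces of size at least \<tau> are linked to a fixed one of them and end up in one
  cluster; every other piece forfeits less than \<tau>. The pieces depend on \<eta> alone, so
  \<zeta> can be drawn afterwards, independently of them.\<close>

lemma peak_merge:
  fixes \<tau> :: real
  assumes "finite W" and B: "\<And>w. w \<in> W \<Longrightarrow> finite (B w)"
    and disj: "\<And>w w'. w \<in> W \<Longrightarrow> w' \<in> W \<Longrightarrow> w \<noteq> w' \<Longrightarrow> B w \<inter> B w' = {}"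
    and S: "\<And>w. w \<in> W \<Longrightarrow> S w = reach \<eta> (u w) \<inter> B w"
    and card_S: "\<And>w. w \<in> W \<Longrightarrow> card (S w) = peak \<eta> (B w)"
    and linked: "\<And>w w'. w \<in> W \<Longrightarrow> w' \<in> W \<Longrightarrow> w \<noteq> w' \<Longrightarrow> \<tau> \<le> card (S w) \<Longrightarrow> \<tau> \<le> card (S w') \<Longrightarrow>
       \<exists>x\<in>S w. \<exists>y\<in>S w'. {x, y} \<in> \<zeta>"
    and "0 \<le> \<tau>"
  shows "(\<Sum>w\<in>W. real (peak \<eta> (B w))) \<le> real (peak (\<eta> \<union> \<zeta>) (\<Union>w\<in>W. B w)) + real (card W) * \<tau>"
proof -
  define W' where "W' = {w\<in>W. \<tau> \<le> card (S w)}"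
  have W': "W' \<subseteq> W" "finite W'" using assms(1) by (auto simp: W'_def)
  have big: "(\<Sum>w\<in>W'. card (S w)) \<le> peak (\<eta> \<union> \<zeta>) (\<Union>w\<in>W. B w)"
  proof (cases "W' = {}")
    case False
    then obtain w0 where w0: "w0 \<in> W'" by blast
    have sub: "S w \<subseteq> reach (\<eta> \<union> \<zeta>) (u w0)" if w: "w \<in> W'" for w
    proof (cases "w = w0")
      case True
      then show ?thesis using S[of w0] w0 W' reach_mono[of \<eta> "\<eta> \<union> \<zeta>" "u w0"] by blast
    next
      case False
      with linked[of w0 w] w w0 obtain x y where xy: "x \<in> S w0" "y \<in> S w" "{x, y} \<in> \<zeta>"
        unfolding W'_def by auto
      have "x \<in> reach (\<eta> \<union> \<zeta>) (u w0)"
        using xy(1) S[of w0] w0 W' reach_mono[of \<eta> "\<eta> \<union> \<zeta>" "u w0"] by blast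
      with xy(3) have y: "y \<in> reach (\<eta> \<union> \<zeta>) (u w0)" by (intro reach_step[of x _ _ y]) auto
      have "y \<in> reach \<eta> (u w)" using xy(2) S[of w] w W' by blast
      then have "S w \<subseteq> reach \<eta> y" using S[of w] w W' by (auto simp: reach_eq)
      also have "\<dots> \<subseteq> reach (\<eta> \<union> \<zeta>) y" by (rule reach_mono) auto
      also have "\<dots> = reach (\<eta> \<union> \<zeta>) (u w0)" using y by (rule reach_eq)
      finally show ?thesis .
    qed
    have "(\<Sum>w\<in>W'. card (S w)) = card (\<Union>w\<in>W'. S w)"
    proof (rule card_UN_disjoint[symmetric])
      show "\<forall>w\<in>W'. finite (S w)" using W' S B by auto
      show "\<forall>w\<in>W'. \<forall>w'\<in>W'. w \<noteq> w' \<longrightarrow> S w \<inter> S w' = {}"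
      proof (intro ballI impI)
        fix w w' assume w: "w \<in> W'" "w' \<in> W'" "w \<noteq> w'"
        then have "S w \<subseteq> B w" "S w' \<subseteq> B w'" using W' S by auto
        moreover have "B w \<inter> B w' = {}" using w W' disj by auto
        ultimately show "S w \<inter> S w' = {}" by blast
      qed
    qed (rule W'(2))
    also have "\<dots> \<le> card (reach (\<eta> \<union> \<zeta>) (u w0) \<inter> (\<Union>w\<in>W. B w))"
    proof (rule card_mono)
      show "finite (reach (\<eta> \<union> \<zeta>) (u w0) \<inter> (\<Union>w\<in>W. B w))" using assms(1) B by simp
      show "(\<Union>w\<in>W'. S w) \<subseteq> reach (\<eta> \<union> \<zeta>) (u w0) \<inter> (\<Union>w\<in>W. B w)"
        using sub S W' by (fastforce dest: subsetD)
    qed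
    also have "\<dots> \<le> peak (\<eta> \<union> \<zeta>) (\<Union>w\<in>W. B w)"
      using assms(1) B by (intro card_reach_le_peak) blast
    finally show ?thesis .
  qed auto
  have "(\<Sum>w\<in>W. real (peak \<eta> (B w))) = (\<Sum>w\<in>W'. real (card (S w))) + (\<Sum>w\<in>W-W'. real (card (S w)))"
  proof -
    have "(\<Sum>w\<in>W. real (peak \<eta> (B w))) = (\<Sum>w\<in>W. real (card (S w)))"
      using card_S by (intro sum.cong) auto
    then show ?thesis using assms(1) W' by (simp add: sum.subset_diff[of W' W])
  qed
  also have "(\<Sum>w\<in>W-W'. real (card (S w))) \<le> real (card (W - W')) * \<tau>"
    by (rule sum_bounded_above) (auto simp: W'_def)
  also have "\<dots> \<le> real (card W) * \<tau>"
    using assms(1,7) by (intro mult_right_mono) (auto intro!: card_mono)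
  also have "(\<Sum>w\<in>W'. real (card (S w))) \<le> real (peak (\<eta> \<union> \<zeta>) (\<Union>w\<in>W. B w))"
    using big by (metis of_nat_sum of_nat_le_iff)
  finally show ?thesis by simp
qed

text \<open>Cells of side 1 are single points, so \<open>local_pairs V r 1\<close> consists of the bonds of length less than \<open>r\<close>.\<close>

definition local_pairs :: "(int ^ 'd) set \<Rightarrow> nat \<Rightarrow> nat \<Rightarrow> (int ^ 'd) set set" where
  "local_pairs V r L = {{x, y} | x y. x \<in> V \<and> y \<in> V \<and> x \<noteq> y \<and> (norm1 (x - y) < real r \<or> cell L x = cell L y)}"

lemma local_pairs_subset: "local_pairs V r L \<subseteq> pairs V"
  by (auto simp: local_pairs_def pairs_def)

lemma doubleton_in_local_pairs:
  "{x, y} \<in> local_pairs V r L \<longleftrightarrow>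
    x \<in> V \<and> y \<in> V \<and> x \<noteq> y \<and> (norm1 (x - y) < real r \<or> cell L x = cell L y)"
  by (auto simp: local_pairs_def doubleton_eq_iff norm1_diff_commute)

lemma finite_local_pairs [simp]: "finite V \<Longrightarrow> finite (local_pairs V r L)"
  using local_pairs_subset finite_pairs by (rule finite_subset)

lemma pairs_subset_bonds: "pairs V \<subseteq> bonds"
  by (auto simp: pairs_def bonds_def)

text \<open>A vertex of \<open>S\<close> is closer than \<open>r\<close> to at most (2 r)^d \<le>
  \<tau> / 2 vertices of \<open>T\<close>, which leaves it \<tau> / 2 partners. Disjointness of
  \<open>S\<close> and \<open>T\<close> prevents an unordered pair from being counted twice.\<close>

lemma card_far_pairs_ge:
  fixes S T :: "(int ^ 'd::finite) set" and \<tau> :: real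
  assumes "finite S" "finite T" "S \<inter> T = {}"
    and "2 * (2 * real r) ^ CARD('d) \<le> \<tau>" "\<tau> \<le> card S" "\<tau> \<le> card T"
  shows "\<tau>\<^sup>2 / 2 \<le> card {{x, y} | x y. x \<in> S \<and> y \<in> T \<and> real r \<le> norm1 (x - y)}"
proof -
  define f where "f = (\<lambda>(x, y). {x, y :: int ^ 'd})"
  define D where "D = Sigma S (\<lambda>x. {y \<in> T. real r \<le> norm1 (x - y)})"
  have fib: "\<tau> / 2 \<le> card {y \<in> T. real r \<le> norm1 (x - y)}" for x
  proof -
    have "card T \<le> card ({y \<in> T. real r \<le> norm1 (x - y)} \<union> {y. norm1 (x - y) < real r})"
      using assms(2) by (intro card_mono) (auto simp: finite_norm1_ball_around)
    also have "\<dots> \<le> card {y \<in> T. real r \<le> norm1 (x - y)} + card {y. norm1 (x - y) < real r}"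
      by (rule card_Un_le)
    also have "\<dots> \<le> card {y \<in> T. real r \<le> norm1 (x - y)} + (2 * r) ^ CARD('d)"
      using card_norm1_ball_around by (intro add_left_mono)
    finally have "real (card T) \<le> real (card {y \<in> T. real r \<le> norm1 (x - y)} + (2 * r) ^ CARD('d))"
      by (rule of_nat_mono)
    with assms(4,6) show ?thesis by simp
  qed
  have \<tau>0: "0 \<le> \<tau>" using assms(4) by (rule order_trans[rotated]) simp
  have "\<tau>\<^sup>2 / 2 \<le> real (card S) * (\<tau> / 2)"
    using assms(5) \<tau>0 by (simp add: power2_eq_square mult_right_mono)
  also have "\<dots> \<le> (\<Sum>x\<in>S. real (card {y \<in> T. real r \<le> norm1 (x - y)}))"
    using fib by (intro sum_bounded_below)
  also have "\<dots> = real (card D)"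
    unfolding D_def using assms(1,2) by (subst card_SigmaI) auto
  also have "card D = card (f ` D)"
  proof (rule card_image[symmetric])
    show "inj_on f D" using assms(3) by (auto simp: inj_on_def f_def D_def doubleton_eq_iff)
  qed
  also have "f ` D = {{x, y} | x y. x \<in> S \<and> y \<in> T \<and> real r \<le> norm1 (x - y)}"
    by (auto simp: f_def D_def)
  finally show ?thesis .
qed

text \<open>Formulated for a function on bonds with an explicit \<open>c\<close>, so that it covers
  the original probabilities and, with \<open>c / 2\<close>, all their rescalings by at least 1/2.
  Merging uses long bonds only through this lower bound.\<close>

locale power_law_kernel =
  fixes p :: "(int ^ 'd::finite) set \<Rightarrow> real" and s c :: real and r0 :: nat
  assumes prob: "\<And>e. e \<in> bonds \<Longrightarrow> 0 \<le> p e \<and> p e \<le> 1"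
    and lower: "\<And>x y. x \<noteq> y \<Longrightarrow> real r0 \<le> norm1 (x - y) \<Longrightarrow> c * norm1 (x - y) powr (- s) \<le> p {x, y}"
    and c_pos: "0 < c"
    and s_gt: "real CARD('d) < s" and s_lt: "s < 2 * real CARD('d)"
begin

lemma s_pos: "0 < s"
  using s_gt by (rule le_less_trans[rotated]) simp

lemma prob_pairs: "e \<in> pairs V \<Longrightarrow> 0 \<le> p e \<and> p e \<le> 1"
  using prob pairs_subset_bonds by blast

lemma lower_tile:
  assumes "L > 0" "x \<in> tile L z" "y \<in> tile L z" "x \<noteq> y" "real r0 \<le> norm1 (x - y)"
  shows "c * (real CARD('d) * real L) powr (- s) \<le> p {x, y}"
proof -
  have "1 \<le> norm1 (x - y)" using assms(4) by (intro norm1_ge_1) simp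
  then have "(real CARD('d) * real L) powr (- s) \<le> norm1 (x - y) powr (- s)"
    using norm1_diff_tile_le[OF assms(1-3)] s_pos by (intro powr_mono2') auto
  then have "c * (real CARD('d) * real L) powr (- s) \<le> c * norm1 (x - y) powr (- s)"
    using c_pos by simp
  also have "\<dots> \<le> p {x, y}" using assms(4,5) by (rule lower)
  finally show ?thesis .
qed

text \<open>Two pieces with at least \<open>\<tau>\<close> vertices in sibling tiles have at least \<open>\<tau>\<^sup>2 / 2\<close> still unexplored
  bonds of length at least \<open>r\<close> between them, so they fail to merge with probability at most \<open>q\<close>;
  smaller pieces are discarded.\<close>

lemma doubling_tile:
  fixes L r :: nat and \<tau> :: real
  assumes "L > 0" "r0 \<le> r" "2 * (2 * real r) ^ CARD('d) \<le> \<tau>"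
    and V: "finite V" "tile (L * 2) z \<subseteq> V" and \<eta>: "\<eta> \<subseteq> local_pairs V r L"
  defines "q \<equiv> exp (- (c * (real CARD('d) * real (L * 2)) powr (- s)) * (\<tau>\<^sup>2 / 2))"
  shows "(\<Sum>w\<in>tile 2 z. real (peak \<eta> (tile L w)))
    \<le> expect p (local_pairs V r (L * 2) - local_pairs V r L) (\<lambda>\<zeta>. real (peak (\<eta> \<union> \<zeta>) (tile (L * 2) z)))
      + (2 ^ CARD('d) * \<tau> + real (L * 2) ^ CARD('d) * 4 ^ CARD('d) * q)"
proof -
  define G where "G = local_pairs V r (L * 2) - local_pairs V r L"
  have finG: "finite G" using V(1) by (simp add: G_def)
  have probG: "0 \<le> p e \<and> p e \<le> 1" if "e \<in> G" for e
    using that local_pairs_subset[of V r "L * 2"] by (intro prob_pairs[of e V]) (auto simp: G_def)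
  have "\<exists>u. card (reach \<eta> u \<inter> tile L w) = peak \<eta> (tile L w)" for w
    using peak_attained[of "tile L w"] assms(1) tile_nonempty[OF assms(1)] by (metis finite_tile)
  then obtain u where u: "\<And>w. card (reach \<eta> (u w) \<inter> tile L w) = peak \<eta> (tile L w)"
    by metis
  define S where "S = (\<lambda>w. reach \<eta> (u w) \<inter> tile L w)"
  define D where "D = (\<lambda>w w'. {{x, y} | x y. x \<in> S w \<and> y \<in> S w' \<and> real r \<le> norm1 (x - y)})"
  \<comment> \<open>Pairs of pieces that have to be linked. There are 2^d subtiles, hence at most
    4^d pairs in the union bound.\<close>
  define A where "A = {(w, w'). w \<in> tile 2 z \<and> w' \<in> tile 2 z \<and> w \<noteq> w' \<and> \<tau> \<le> card (S w) \<and> \<tau> \<le> card (S w')}"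
  have A_sub: "A \<subseteq> tile 2 z \<times> tile 2 z" by (auto simp: A_def)
  have finA: "finite A" using A_sub by (rule finite_subset) simp
  have cardA: "card A \<le> 4 ^ CARD('d)"
  proof -
    have "card A \<le> card (tile 2 z \<times> tile 2 z)" using A_sub by (intro card_mono) auto
    then show ?thesis by (simp add: card_cartesian_product card_tile power_mult_distrib[symmetric])
  qed
  have \<tau>0: "0 \<le> \<tau>" using assms(3) by (rule order_trans[rotated]) simp
  have Lz: "tile L w \<subseteq> tile (L * 2) z" if "w \<in> tile 2 z" for w
    using that by (auto simp: tile_mult)
  have DG: "D w w' \<subseteq> G" and Dq: "expect p G (\<lambda>\<zeta>. of_bool (\<zeta> \<inter> D w w' = {})) \<le> q" if "(w, w') \<in> A" for w w'
  proof -
    have ww: "w \<in> tile 2 z" "w' \<in> tile 2 z" "w \<noteq> w'" "\<tau> \<le> card (S w)" "\<tau> \<le> card (S w')"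
      using that by (auto simp: A_def)
    have xy: "{x, y} \<in> G \<and> c * (real CARD('d) * real (L * 2)) powr (- s) \<le> p {x, y}"
      if "x \<in> S w" "y \<in> S w'" "real r \<le> norm1 (x - y)" for x y
    proof
      have x: "x \<in> tile (L * 2) z" "cell L x = w" and y: "y \<in> tile (L * 2) z" "cell L y = w'"
        using that Lz[OF ww(1)] Lz[OF ww(2)] by (auto simp: S_def mem_tile[of _ L])
      then show "{x, y} \<in> G"
        using that V(2) ww(3) by (auto simp: G_def doubleton_in_local_pairs mem_tile)
      show "c * (real CARD('d) * real (L * 2)) powr (- s) \<le> p {x, y}"
        using x y that assms(1,2) ww(3) by (intro lower_tile) auto
    qed
    then show DG: "D w w' \<subseteq> G" by (auto simp: D_def)
    have "expect p G (\<lambda>\<zeta>. of_bool (\<zeta> \<inter> D w w' = {}))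
        \<le> exp (- (c * (real CARD('d) * real (L * 2)) powr (- s)) * real (card (D w w')))"
    proof (rule expect_all_closed_le[OF finG DG])
      fix e assume "e \<in> D w w'"
      with xy probG DG show "c * (real CARD('d) * real (L * 2)) powr (- s) \<le> p e \<and> p e \<le> 1"
        by (auto simp: D_def)
    qed
    also have "\<dots> \<le> q"
    proof -
      have "\<tau>\<^sup>2 / 2 \<le> card (D w w')"
        unfolding D_def using ww assms(1,3) tile_disjoint[OF ww(3), of L]
        by (intro card_far_pairs_ge) (auto simp: S_def)
      then show ?thesis using c_pos by (auto simp: q_def intro!: mult_left_mono)
    qed
    finally show "expect p G (\<lambda>\<zeta>. of_bool (\<zeta> \<inter> D w w' = {})) \<le> q" .
  qed
  \<comment> \<open>If some pair in \<open>A\<close> has no open link, the sum of indicators is at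
    least 1 and the volume of the tile, multiplied by it, already bounds all peaks together.
    Otherwise \<open>peak_merge\<close> applies.\<close>
  have pointwise: "(\<Sum>w\<in>tile 2 z. real (peak \<eta> (tile L w)))
      \<le> real (peak (\<eta> \<union> \<zeta>) (tile (L * 2) z)) + 2 ^ CARD('d) * \<tau>
        + real (L * 2) ^ CARD('d) * (\<Sum>(w, w')\<in>A. of_bool (\<zeta> \<inter> D w w' = {}))" for \<zeta>
  proof (cases "\<exists>(w, w')\<in>A. \<zeta> \<inter> D w w' = {}")
    case True
    then obtain a where a: "a \<in> A" "case a of (w, w') \<Rightarrow> \<zeta> \<inter> D w w' = {}" by blast
    have "1 \<le> (\<Sum>(w, w')\<in>A. of_bool (\<zeta> \<inter> D w w' = {}) :: real)"
      using a finA member_le_sum[of a A "\<lambda>(w, w'). of_bool (\<zeta> \<inter> D w w' = {}) :: real"] by (auto split: prod.splits)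
    then have "real (L * 2) ^ CARD('d) * 1 \<le> real (L * 2) ^ CARD('d) * (\<Sum>(w, w')\<in>A. of_bool (\<zeta> \<inter> D w w' = {}))"
      by (intro mult_left_mono) auto
    moreover have "(\<Sum>w\<in>tile 2 z. real (peak \<eta> (tile L w))) \<le> (\<Sum>w\<in>tile 2 z. real (L ^ CARD('d)))"
    proof (rule sum_mono)
      fix w :: "int ^ 'd"
      have "peak \<eta> (tile L w) \<le> L ^ CARD('d)"
        using peak_le_card[of "tile L w" \<eta>] assms(1) tile_nonempty[of L w] by (simp add: card_tile)
      then show "real (peak \<eta> (tile L w)) \<le> real (L ^ CARD('d))" by (simp only: of_nat_le_iff)
    qed
    moreover have "0 \<le> real (peak (\<eta> \<union> \<zeta>) (tile (L * 2) z)) + 2 ^ CARD('d) * \<tau>" using \<tau>0 by simp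
    moreover have "(\<Sum>w\<in>tile 2 z. real (L ^ CARD('d))) = real (L * 2) ^ CARD('d) * 1"
      by (simp add: card_tile power_mult_distrib)
    ultimately show ?thesis by linarith
  next
    case False
    have "(\<Sum>w\<in>tile 2 z. real (peak \<eta> (tile L w)))
        \<le> real (peak (\<eta> \<union> \<zeta>) (\<Union>w\<in>tile 2 z. tile L w)) + real (card (tile 2 z)) * \<tau>"
    proof (rule peak_merge[where S=S and u=u])
      fix w w' assume w: "w \<in> tile 2 z" "w' \<in> tile 2 z" "w \<noteq> w'" "\<tau> \<le> card (S w)" "\<tau> \<le> card (S w')"
      then have "(w, w') \<in> A" by (simp add: A_def)
      with False have "\<zeta> \<inter> D w w' \<noteq> {}" by blast
      then show "\<exists>x\<in>S w. \<exists>y\<in>S w'. {x, y} \<in> \<zeta>" by (auto simp: D_def)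
    qed (use assms(1) u \<tau>0 in \<open>auto simp: S_def tile_disjoint\<close>)
    moreover have "0 \<le> (\<Sum>(w, w')\<in>A. of_bool (\<zeta> \<inter> D w w' = {}) :: real)"
      by (rule sum_nonneg) auto
    ultimately show ?thesis by (simp add: card_tile tile_mult add_increasing2)
  qed
  have "(\<Sum>w\<in>tile 2 z. real (peak \<eta> (tile L w))) = expect p G (\<lambda>_. \<Sum>w\<in>tile 2 z. real (peak \<eta> (tile L w)))"
    using finG by simp
  also have "\<dots> \<le> expect p G (\<lambda>\<zeta>. real (peak (\<eta> \<union> \<zeta>) (tile (L * 2) z)) + 2 ^ CARD('d) * \<tau>
        + real (L * 2) ^ CARD('d) * (\<Sum>a\<in>A. of_bool (\<zeta> \<inter> D (fst a) (snd a) = {})))"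
    using pointwise by (intro expect_mono probG) (auto simp: case_prod_beta)
  also have "\<dots> = expect p G (\<lambda>\<zeta>. real (peak (\<eta> \<union> \<zeta>) (tile (L * 2) z))) + 2 ^ CARD('d) * \<tau>
        + real (L * 2) ^ CARD('d) * (\<Sum>a\<in>A. expect p G (\<lambda>\<zeta>. of_bool (\<zeta> \<inter> D (fst a) (snd a) = {})))"
    using finG by (simp only: expect_add expect_cmult expect_sum expect_const)
  also have "(\<Sum>a\<in>A. expect p G (\<lambda>\<zeta>. of_bool (\<zeta> \<inter> D (fst a) (snd a) = {}))) \<le> (\<Sum>a\<in>A. q)"
    using Dq by (intro sum_mono) auto
  also have "\<dots> \<le> 4 ^ CARD('d) * q"
  proof -
    have "real (card A) \<le> real (4 ^ CARD('d))" using cardA by (simp only: of_nat_le_iff)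
    then have "real (card A) * q \<le> 4 ^ CARD('d) * q" by (intro mult_right_mono) (auto simp: q_def)
    then show ?thesis by simp
  qed
  finally show ?thesis by (simp add: G_def mult.assoc mult_left_mono)
qed

text \<open>The newly revealed bonds \<open>G\<close> have length at least \<open>r\<close> and join
  different tiles of side \<open>L\<close> within one tile of side \<open>2 L\<close>. They are
  independent of the bonds in \<open>F\<close> that determine the pieces, so
  \<open>doubling_tile\<close> is averaged by Fubini; the loss is expressed per vertex of
  \<open>V\<close>.\<close>

lemma doubling_step:
  fixes L K r :: nat and \<tau> :: real and z0 :: "int ^ 'd"
  assumes "L > 0" "K > 0" "r0 \<le> r" "2 * (2 * real r) ^ CARD('d) \<le> \<tau>"
  defines "V \<equiv> tile (L * 2 * K) z0"
  defines "q \<equiv> exp (- (c * (real CARD('d) * real (L * 2)) powr (- s)) * (\<tau>\<^sup>2 / 2))"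
  shows "expect p (local_pairs V r L) (\<lambda>\<eta>. \<Sum>z\<in>tile (2 * K) z0. real (peak \<eta> (tile L z)))
    \<le> expect p (local_pairs V r (L * 2)) (\<lambda>\<eta>. \<Sum>z\<in>tile K z0. real (peak \<eta> (tile (L * 2) z)))
      + real (card V) * (\<tau> / real L ^ CARD('d) + 4 ^ CARD('d) * q)"
proof -
  define F where "F = local_pairs V r L"
  define G where "G = local_pairs V r (L * 2) - F"
  define loss where "loss = 2 ^ CARD('d) * \<tau> + real (L * 2) ^ CARD('d) * 4 ^ CARD('d) * q"
  have finV: "finite V" using assms(1,2) by (simp add: V_def)
  have fin: "finite F" "finite G" using finV by (simp_all add: F_def G_def)
  have F_sub: "F \<subseteq> local_pairs V r (L * 2)"
  proof
    fix e assume "e \<in> F"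
    then obtain x y where "e = {x, y}" "{x, y} \<in> local_pairs V r L"
      by (auto simp: F_def local_pairs_def)
    then show "e \<in> local_pairs V r (L * 2)" by (auto simp: doubleton_in_local_pairs cell_mult)
  qed
  have "expect p F (\<lambda>\<eta>. \<Sum>z\<in>tile (2 * K) z0. real (peak \<eta> (tile L z)))
      \<le> expect p F (\<lambda>\<eta>. \<Sum>z\<in>tile K z0. expect p G (\<lambda>\<zeta>. real (peak (\<eta> \<union> \<zeta>) (tile (L * 2) z))) + loss)"
  proof (rule expect_mono)
    fix e assume "e \<in> F"
    then show "0 \<le> p e \<and> p e \<le> 1"
      using local_pairs_subset[of V r L] by (intro prob_pairs[of e V]) (auto simp: F_def)
  next
    fix \<eta> assume \<eta>: "\<eta> \<subseteq> F"
    have "(\<Sum>z\<in>tile (2 * K) z0. real (peak \<eta> (tile L z))) = (\<Sum>z\<in>tile K z0. \<Sum>w\<in>tile 2 z. real (peak \<eta> (tile L w)))"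
      using assms(2) by (intro sum_tile_mult) auto
    also have "\<dots> \<le> (\<Sum>z\<in>tile K z0. expect p G (\<lambda>\<zeta>. real (peak (\<eta> \<union> \<zeta>) (tile (L * 2) z))) + loss)"
      unfolding loss_def q_def G_def F_def using assms(1,3,4) finV \<eta>
      by (intro sum_mono doubling_tile) (auto simp: F_def V_def tile_mult[of "L * 2" K])
    finally show "(\<Sum>z\<in>tile (2 * K) z0. real (peak \<eta> (tile L z)))
      \<le> (\<Sum>z\<in>tile K z0. expect p G (\<lambda>\<zeta>. real (peak (\<eta> \<union> \<zeta>) (tile (L * 2) z))) + loss)" .
  qed
  also have "\<dots> = expect p (F \<union> G) (\<lambda>\<eta>. \<Sum>z\<in>tile K z0. real (peak \<eta> (tile (L * 2) z))) + real (K ^ CARD('d)) * loss"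
    using fin assms(2) by (subst expect_union) (auto simp: G_def expect_sum expect_add sum.distrib card_tile)
  also have "F \<union> G = local_pairs V r (L * 2)" using F_sub by (auto simp: G_def)
  also have "real (K ^ CARD('d)) * loss = real (card V) * (\<tau> / real L ^ CARD('d) + 4 ^ CARD('d) * q)"
    using assms(1,2) by (simp add: loss_def V_def card_tile power_mult_distrib field_simps)
  finally show ?thesis by (simp add: F_def)
qed

text \<open>Telescoping of \<open>doubling_step\<close>. The thresholds are left free at every
  scale, since their growth has to be tuned to make the losses summable.\<close>

lemma doubling_iterate:
  fixes H J r :: nat and \<tau> :: "nat \<Rightarrow> real" and z0 :: "int ^ 'd"
  assumes "H > 0" "r0 \<le> r" "\<And>i. 2 * (2 * real r) ^ CARD('d) \<le> \<tau> i" "j \<le> J"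
  defines "V \<equiv> tile (H * 2 ^ J) z0"
  shows "expect p (local_pairs V r H) (\<lambda>\<eta>. \<Sum>z\<in>tile (2 ^ J) z0. real (peak \<eta> (tile H z)))
    \<le> expect p (local_pairs V r (H * 2 ^ j)) (\<lambda>\<eta>. \<Sum>z\<in>tile (2 ^ (J - j)) z0. real (peak \<eta> (tile (H * 2 ^ j) z)))
      + real (card V) * (\<Sum>i<j. \<tau> i / real (H * 2 ^ i) ^ CARD('d) + 4 ^ CARD('d) *
          exp (- (c * (real CARD('d) * real (H * 2 ^ i * 2)) powr (- s)) * ((\<tau> i)\<^sup>2 / 2)))"
  using assms(4)
proof (induction j)
  case (Suc j)
  define K where "K = (2::nat) ^ (J - Suc j)"
  have K: "2 ^ (J - j) = 2 * K"
    using Suc.prems by (simp add: K_def Suc_diff_Suc flip: power_Suc)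
  have V: "V = tile (H * 2 ^ j * 2 * K) z0"
  proof -
    have "(2::nat) ^ J = 2 ^ Suc j * K"
      unfolding K_def power_add[symmetric] using Suc.prems by simp
    then show ?thesis by (simp add: V_def mult_ac)
  qed
  have "expect p (local_pairs V r (H * 2 ^ j)) (\<lambda>\<eta>. \<Sum>z\<in>tile (2 * K) z0. real (peak \<eta> (tile (H * 2 ^ j) z)))
    \<le> expect p (local_pairs V r (H * 2 ^ j * 2)) (\<lambda>\<eta>. \<Sum>z\<in>tile K z0. real (peak \<eta> (tile (H * 2 ^ j * 2) z)))
      + real (card V) * (\<tau> j / real (H * 2 ^ j) ^ CARD('d) + 4 ^ CARD('d) *
          exp (- (c * (real CARD('d) * real (H * 2 ^ j * 2)) powr (- s)) * ((\<tau> j)\<^sup>2 / 2)))"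
    unfolding V using assms(1-3) by (intro doubling_step) (auto simp: K_def)
  with Suc.IH Suc.prems show ?case
    by (simp add: K K_def[symmetric] algebra_simps)
qed simp

end

lemma exp_minus_le_inverse: "0 < y \<Longrightarrow> exp (- y) \<le> 1 / (y::real)"
  using order_trans[OF _ exp_ge_add_one_self[of y], of y] by (simp add: exp_minus field_simps)

lemma geometric_partial_le: "0 \<le> x \<Longrightarrow> x < 1 \<Longrightarrow> (\<Sum>i<n. x ^ i) \<le> 1 / (1 - x :: real)"
  using sum_le_suminf[of "\<lambda>i. x ^ i" "{..<n}"] by (simp add: suminf_geometric summable_geometric)

text \<open>At scale L_i = h r 2^i the discarded pieces cost density \<tau>_i / L_i^d, while two
  kept pieces have of order \<tau>_i^2 / L_i^s expected links. If \<tau>_i grows like 2^(b i), the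
  first loss decays geometrically for b < d and the second for b > s / 2; both are possible because
  s < 2 d. The bound is uniform in \<open>J\<close> and in the kernel.\<close>

lemma dyadic_merging:
  fixes s c :: real
  assumes "real CARD('d::finite) < s" "s < 2 * real CARD('d)" "0 < c"
  shows "\<exists>Ca>0. \<exists>Cb>0. \<forall>p r0 h r J (z0 :: int ^ 'd). power_law_kernel p s c r0 \<longrightarrow> h > 0 \<longrightarrow> r > 0 \<longrightarrow> r0 \<le> r \<longrightarrow>
    expect p (local_pairs (tile (h * r * 2 ^ J) z0) r (h * r)) (\<lambda>\<eta>. \<Sum>z\<in>tile (2 ^ J) z0. real (peak \<eta> (tile (h * r) z)))
    \<le> expect p (pairs (tile (h * r * 2 ^ J) z0)) (\<lambda>\<eta>. real (peak \<eta> (tile (h * r * 2 ^ J) z0)))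
      + real (h * r * 2 ^ J) ^ CARD('d) * (Ca * real h powr (- real CARD('d)) + Cb * real h powr s * real r powr (s - 2 * real CARD('d)))"
proof -
  define d where "d = real CARD('d)"
  \<comment> \<open>The midpoint of \<open>s / 2\<close> and \<open>d\<close>.\<close>
  define b where "b = (s + 2 * d) / 4"
  define x where "x = 2 powr (b - d)"
  define y where "y = 2 powr (s - 2 * b)"
  have d: "d \<ge> 1" "0 < d" "0 < s"
    using assms(1) by (auto simp: d_def Suc_le_eq)
  have x: "0 < x" "x < 1" and y: "0 < y" "y < 1"
    using assms(1,2) by (auto simp: x_def y_def b_def d_def powr_less_one field_simps)
  define Ca where "Ca = 2 * 2 powr d / (1 - x)"
  define Cb where "Cb = (2 * d) powr s / (2 * c) / (1 - y)"
  have C: "Ca > 0" "Cb > 0" using x y d assms(3) by (auto simp: Ca_def Cb_def)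
  have "expect p (local_pairs (tile (h * r * 2 ^ J) z0) r (h * r)) (\<lambda>\<eta>. \<Sum>z\<in>tile (2 ^ J) z0. real (peak \<eta> (tile (h * r) z)))
    \<le> expect p (pairs (tile (h * r * 2 ^ J) z0)) (\<lambda>\<eta>. real (peak \<eta> (tile (h * r * 2 ^ J) z0)))
      + real (h * r * 2 ^ J) ^ CARD('d) * (Ca * real h powr (- real CARD('d)) + Cb * real h powr s * real r powr (s - 2 * real CARD('d)))"
    if ker: "power_law_kernel p s c r0" and pos: "h > 0" "r > 0" "r0 \<le> r"
    for p r0 h r J and z0 :: "int ^ 'd"
  proof -
    interpret power_law_kernel p s c r0 by (rule ker)
    define V where "V = tile (h * r * 2 ^ J) z0"
    \<comment> \<open>The value at \<open>i = 0\<close> is the least one that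
      \<open>card_far_pairs_ge\<close> admits.\<close>
    define \<tau> where "\<tau> = (\<lambda>i. 2 * (2 * real r) ^ CARD('d) * 2 powr (b * real i))"
    define loss where "loss = (\<lambda>i. \<tau> i / real (h * r * 2 ^ i) ^ CARD('d) + 4 ^ CARD('d) *
          exp (- (c * (real CARD('d) * real (h * r * 2 ^ i * 2)) powr (- s)) * ((\<tau> i)\<^sup>2 / 2)))"
    have V: "finite V" "real (card V) = real (h * r * 2 ^ J) ^ CARD('d)"
      using pos by (simp_all add: V_def card_tile)
    have b0: "b \<ge> 0" using d by (simp add: b_def)
    have \<tau>_ge: "2 * (2 * real r) ^ CARD('d) \<le> \<tau> i" for i
      unfolding \<tau>_def using mult_left_mono[OF ge_one_powr_ge_zero[of 2 "b * real i"], of "2 * (2 * real r) ^ CARD('d)"] b0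
      by simp
    have "expect p (local_pairs V r (h * r)) (\<lambda>\<eta>. \<Sum>z\<in>tile (2 ^ J) z0. real (peak \<eta> (tile (h * r) z)))
      \<le> expect p (local_pairs V r (h * r * 2 ^ J)) (\<lambda>\<eta>. \<Sum>z\<in>tile (2 ^ (J - J)) z0. real (peak \<eta> (tile (h * r * 2 ^ J) z)))
       + real (card V) * (\<Sum>i<J. loss i)"
      unfolding V_def loss_def using pos \<tau>_ge by (intro doubling_iterate) auto
    also have "local_pairs V r (h * r * 2 ^ J) = pairs V"
      by (auto simp: local_pairs_def pairs_def V_def mem_tile)
    also have "(\<lambda>\<eta>. \<Sum>z\<in>tile (2 ^ (J - J)) z0. real (peak \<eta> (tile (h * r * 2 ^ J) z)))
        = (\<lambda>\<eta>. real (peak \<eta> (tile (h * r * 2 ^ J) z0)))"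
      by (simp add: tile_def)
    also have "(\<Sum>i<J. loss i) \<le> Ca * real h powr (- d) + Cb * real h powr s * real r powr (s - 2 * d)"
    proof -
      have hr: "real h > 0" "real r > 0" using pos by auto
      have t1: "\<tau> i / real (h * r * 2 ^ i) ^ CARD('d) = 2 * 2 powr d * real h powr (- d) * x ^ i" for i
      proof -
        have "real (h * r * 2 ^ i) ^ CARD('d) = real h powr d * real r powr d * 2 powr (d * real i)"
          using hr by (simp add: d_def powr_realpow[symmetric] powr_mult powr_powr mult_ac)
        moreover have "(2 * real r) ^ CARD('d) = 2 powr d * real r powr d"
          using hr by (simp add: d_def powr_realpow[symmetric] powr_mult)
        moreover have "x ^ i = 2 powr (b * real i) / 2 powr (d * real i)"
          by (simp add: x_def powr_realpow[symmetric] powr_powr powr_diff[symmetric] algebra_simps)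
        ultimately show ?thesis
          using hr by (simp add: \<tau>_def powr_minus field_simps)
      qed
      have t2: "4 ^ CARD('d) * exp (- (c * (real CARD('d) * real (h * r * 2 ^ i * 2)) powr (- s)) * ((\<tau> i)\<^sup>2 / 2))
          \<le> (2 * d) powr s / (2 * c) * real h powr s * real r powr (s - 2 * d) * y ^ i" for i
      proof -
        define w where "w = c * (real CARD('d) * real (h * r * 2 ^ i * 2)) powr (- s) * ((\<tau> i)\<^sup>2 / 2)"
        have 1: "(real CARD('d) * real (h * r * 2 ^ i * 2)) powr (- s)
            = 1 / ((2 * d) powr s * real h powr s * real r powr s * 2 powr (s * real i))"
          using hr d by (simp add: d_def[symmetric] powr_realpow[symmetric] powr_mult powr_powr powr_minus field_simps)
        have 2: "(\<tau> i)\<^sup>2 / 2 = 2 * 4 powr d * real r powr (2 * d) * 2 powr (2 * b * real i)"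
        proof -
          have "(2 * real r) ^ CARD('d) = 2 powr d * real r powr d"
            using hr by (simp add: d_def powr_realpow[symmetric] powr_mult)
          moreover have "4 powr d = (2 powr d)\<^sup>2"
            by (simp add: power2_eq_square powr_mult[symmetric])
          moreover have "real r powr (2 * d) = (real r powr d)\<^sup>2" "2 powr (2 * b * real i) = (2 powr (b * real i))\<^sup>2"
            by (simp_all add: power2_eq_square powr_add[symmetric] mult.assoc)
          ultimately show ?thesis by (simp add: \<tau>_def power_mult_distrib)
        qed
        have w: "w = (2 * c) / (2 * d) powr s * 4 powr d / (real h powr s * real r powr (s - 2 * d) * y ^ i)"
        proof -
          have yi: "y ^ i = 2 powr (s * real i) / 2 powr (2 * b * real i)"
            by (simp add: y_def powr_realpow[symmetric] powr_powr powr_diff[symmetric] algebra_simps)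
          have rr: "real r powr (s - 2 * d) = real r powr s / real r powr (2 * d)"
            by (simp add: powr_diff)
          show ?thesis
            unfolding w_def 1 2 yi rr using hr d by (simp add: field_simps)
        qed
        have w0: "w > 0" unfolding w using hr d y assms(3) by (intro mult_pos_pos divide_pos_pos) auto
        \<comment> \<open>The expected number of links \<open>w\<close> grows geometrically in
          \<open>i\<close>, so the crude bound \<open>1 / w\<close> for \<open>exp (- w)\<close> is
          already summable. The factor 4^d of the union bound cancels against the one in the square
          of \<tau>.\<close>
        have "4 ^ CARD('d) * exp (- w) \<le> 4 powr d * (1 / w)"
          using mult_left_mono[OF exp_minus_le_inverse[OF w0], of "4 ^ CARD('d)"] by (simp add: d_def powr_realpow)
        also have "\<dots> = (2 * d) powr s / (2 * c) * real h powr s * real r powr (s - 2 * d) * y ^ i"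
          unfolding w using hr d y assms(3) by (simp add: field_simps)
        finally show ?thesis by (simp add: w_def)
      qed
      have "(\<Sum>i<J. loss i) \<le> (\<Sum>i<J. 2 * 2 powr d * real h powr (- d) * x ^ i
          + (2 * d) powr s / (2 * c) * real h powr s * real r powr (s - 2 * d) * y ^ i)"
        unfolding loss_def t1 using t2 by (intro sum_mono add_left_mono) auto
      also have "\<dots> = 2 * 2 powr d * real h powr (- d) * (\<Sum>i<J. x ^ i)
          + (2 * d) powr s / (2 * c) * real h powr s * real r powr (s - 2 * d) * (\<Sum>i<J. y ^ i)"
        by (simp add: sum.distrib sum_distrib_left)
      also have "\<dots> \<le> 2 * 2 powr d * real h powr (- d) * (1 / (1 - x))
          + (2 * d) powr s / (2 * c) * real h powr s * real r powr (s - 2 * d) * (1 / (1 - y))"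
        using x y assms(3) by (intro add_mono mult_left_mono geometric_partial_le) auto
      also have "\<dots> = Ca * real h powr (- d) + Cb * real h powr s * real r powr (s - 2 * d)"
        by (simp add: Ca_def Cb_def)
      finally show ?thesis .
    qed
    finally show ?thesis using V(2) by (simp add: V_def d_def mult_left_mono)
  qed
  with C show ?thesis by blast
qed

section \<open>Large cluster pieces in coarse tiles\<close>

text \<open>The greedy max-cut bound: classes are placed one at a time, each on the side where it
  cuts at least half of its pairs with the classes already placed.\<close>

lemma max_cut_ge_half:
  assumes "finite C" "finite D" "\<And>x y. (x, y) \<in> D \<Longrightarrow> f x \<in> C \<and> f y \<in> C \<and> f x \<noteq> f y"
  shows "\<exists>W\<subseteq>C. card D \<le> 2 * card {(x, y) \<in> D. (f x \<in> W) \<noteq> (f y \<in> W)}"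
  using assms
proof (induction C arbitrary: D rule: finite_induct)
  case empty
  then have "D = {}" by auto
  then show ?case by simp
next
  case (insert c C)
  define cut where "cut = (\<lambda>E W. {(x, y) \<in> E. (f x \<in> W) \<noteq> (f y \<in> W)})"
  define D1 where "D1 = {(x, y) \<in> D. f x \<noteq> c \<and> f y \<noteq> c}"
  define D2 where "D2 = D - D1"
  have D: "D = D1 \<union> D2" "D1 \<inter> D2 = {}" by (auto simp: D1_def D2_def)
  have fin: "finite D1" "finite D2"
    using D insert.prems(1) by (metis finite_Un)+
  have "\<exists>W\<subseteq>C. card D1 \<le> 2 * card (cut D1 W)"
    unfolding cut_def by (rule insert.IH) (use fin insert.prems(2) in \<open>auto simp: D1_def\<close>)
  then obtain W where W: "W \<subseteq> C" "card D1 \<le> 2 * card (cut D1 W)" by blast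
  have cW: "c \<notin> W" using W(1) insert.hyps by blast
  \<comment> \<open>Pairs in \<open>D2\<close> have exactly one endpoint in class \<open>c\<close>,
    so moving \<open>c\<close> to the other side exchanges cut and uncut pairs; pairs in
    \<open>D1\<close> are unaffected.\<close>
  have D2_cut: "cut D2 (insert c W) = D2 - cut D2 W"
  proof -
    have "((f x \<in> insert c W) \<noteq> (f y \<in> insert c W)) \<longleftrightarrow> (f x \<in> W) = (f y \<in> W)"
      if "(x, y) \<in> D2" for x y
    proof -
      have "(x, y) \<in> D" "f x = c \<or> f y = c" using that by (auto simp: D1_def D2_def)
      with cW insert.prems(2)[of x y] show ?thesis by auto
    qed
    then show ?thesis by (auto simp: cut_def)
  qed
  have D1_cut: "cut D1 (insert c W) = cut D1 W"
    by (auto simp: cut_def D1_def)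
  have cut_D: "card (cut D X) = card (cut D1 X) + card (cut D2 X)" for X
  proof -
    have "cut D X = cut D1 X \<union> cut D2 X" using D by (auto simp: cut_def)
    moreover have "cut D1 X \<inter> cut D2 X = {}" using D by (auto simp: cut_def)
    moreover have "finite (cut D1 X)" "finite (cut D2 X)"
      using fin by (auto simp: cut_def intro: rev_finite_subset)
    ultimately show ?thesis by (simp add: card_Un_disjoint)
  qed
  have sub: "cut D2 W \<subseteq> D2" by (auto simp: cut_def)
  then have "card (cut D2 W) + card (cut D2 (insert c W)) = card D2"
    using fin by (simp add: D2_cut card_Diff_subset finite_subset card_mono)
  moreover have "card D = card D1 + card D2" using D fin by (simp add: card_Un_disjoint)
  ultimately have "card D \<le> 2 * card (cut D W) \<or> card D \<le> 2 * card (cut D (insert c W))"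
    using W(2) cut_D[of W] cut_D[of "insert c W"] by (simp add: D1_cut) linarith
  then show ?case
  proof
    assume "card D \<le> 2 * card (cut D W)"
    with W(1) show ?thesis unfolding cut_def by (intro exI[of _ W]) auto
  next
    assume "card D \<le> 2 * card (cut D (insert c W))"
    with W(1) show ?thesis unfolding cut_def by (intro exI[of _ "insert c W"]) auto
  qed
qed

text \<open>Distinct clusters are disjoint. The bound on their number keeps the union bound over
  bipartitions affordable.\<close>

lemma card_classes_le:
  assumes "finite V" "X \<subseteq> V" "\<eta> \<subseteq> pairs V" "\<And>x. x \<in> X \<Longrightarrow> n \<le> card (reach \<eta> x)"
  shows "n * card (reach \<eta> ` X) \<le> card V"
proof -
  have sub: "reach \<eta> x \<subseteq> V" if "x \<in> X" for x
    using reach_subset[OF assms(3)] that assms(2) by blast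
  have "n * card (reach \<eta> ` X) = (\<Sum>B\<in>reach \<eta> ` X. n)" by simp
  also have "\<dots> \<le> (\<Sum>B\<in>reach \<eta> ` X. card B)"
    using assms(4) by (intro sum_mono) auto
  also have "\<dots> = card (\<Union>(reach \<eta> ` X))"
  proof (rule card_Union_disjoint[symmetric])
    show "pairwise disjnt (reach \<eta> ` X)"
      unfolding pairwise_def disjnt_def
    proof (intro ballI impI, rule ccontr)
      fix A B assume AB: "A \<in> reach \<eta> ` X" "B \<in> reach \<eta> ` X" "A \<noteq> B" "A \<inter> B \<noteq> {}"
      then obtain x y z where "A = reach \<eta> x" "B = reach \<eta> y" "z \<in> reach \<eta> x" "z \<in> reach \<eta> y" by blast
      then have "A = B" by (metis reach_eq)
      with AB show False by simp
    qed
    show "\<And>A. A \<in> reach \<eta> ` X \<Longrightarrow> finite A" using sub assms(1) finite_subset by blast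
  qed
  also have "\<dots> \<le> card V" using sub assms(1) by (intro card_mono) auto
  finally show ?thesis .
qed

context power_law_kernel
begin

text \<open>Conditionally on the bonds shorter than \<open>r\<close> there are at most \<open>|V| / n\<close> clusters with \<open>n\<close> or more
  vertices. A union bound over all bipartitions of these clusters shows that no bipartition cut by
  more than \<open>t\<close> bonds of \<open>G\<close> has all these bonds closed. Applied to a bipartition of the final clusters
  that separates at least half of the disconnected pairs, this leaves few disconnected pairs inside
  the tiles.\<close>

lemma coarse_peaks_pointwise:
  fixes H r n M :: nat and z0 :: "int ^ 'd"
  assumes "H > 0" "M > 0" "n > 0" "r0 \<le> r"
  defines "V \<equiv> tile (H * M) z0"
  assumes \<eta>: "\<eta> \<subseteq> local_pairs V r 1"
  defines "X \<equiv> {x \<in> V. n \<le> card (reach \<eta> x)}"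
  defines "t \<equiv> 2 * (real (card V) / real n) / (c * (real CARD('d) * real H) powr (- s))"
  shows "(\<Sum>z\<in>tile M z0. (real (card (X \<inter> tile H z)))\<^sup>2)
    \<le> real H ^ CARD('d) * expect p (local_pairs V r H - local_pairs V r 1)
        (\<lambda>\<zeta>. \<Sum>z\<in>tile M z0. real (peak (\<eta> \<union> \<zeta>) (tile H z)))
      + real (card V) * (2 * real r) ^ CARD('d) + 4 * t + real H ^ CARD('d) * real n"
proof -
  define G where "G = local_pairs V r H - local_pairs V r 1"
  have finV: "finite V" using assms(1,2) by (simp add: V_def)
  have finG: "finite G" using finV by (simp add: G_def)
  have probG: "0 \<le> p e \<and> p e \<le> 1" if "e \<in> G" for e
    using that local_pairs_subset[of V r H] by (intro prob_pairs[of e V]) (auto simp: G_def)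
  have XV: "X \<subseteq> V" and finX: "finite X" using finV by (auto simp: X_def)
  define \<B> where "\<B> = reach \<eta> ` X"
  have fin\<B>: "finite \<B>" using finX by (simp add: \<B>_def)
  have card\<B>: "n * card \<B> \<le> card V"
    unfolding \<B>_def using \<eta> local_pairs_subset[of V r 1]
    by (intro card_classes_le[OF finV XV]) (auto simp: X_def)
  define mbar where "mbar = real (card V) / real n"
  define pmin where "pmin = c * (real CARD('d) * real H) powr (- s)"
  have t: "t = 2 * mbar / pmin" by (simp add: t_def mbar_def pmin_def)
  have V_ne: "card V > 0" using assms(1,2) by (simp add: V_def card_tile)
  have mbar: "mbar > 0" using V_ne assms(3) by (simp add: mbar_def)
  have pmin: "pmin > 0" using c_pos assms(1) by (simp add: pmin_def)
  have m_le: "real (card \<B>) \<le> mbar"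
  proof -
    have "real (n * card \<B>) \<le> real (card V)" using card\<B> by (simp only: of_nat_le_iff)
    then show ?thesis using assms(3) by (simp add: mbar_def field_simps)
  qed
  \<comment> \<open>A bipartition of the large \<eta>-clusters is encoded by one side
    \<open>U\<close>; \<open>E U\<close> collects the unexplored bonds that it cuts.\<close>
  define E where "E = (\<lambda>U. {{x, y} | x y. {x, y} \<in> G \<and> x \<in> X \<and> y \<in> X \<and> reach \<eta> x \<in> U \<and> reach \<eta> y \<notin> U})"
  have EG: "E U \<subseteq> G" for U by (auto simp: E_def)
  define \<U> where "\<U> = {U \<in> Pow \<B>. t \<le> card (E U)}"
  have fin\<U>: "finite \<U>" using fin\<B> by (simp add: \<U>_def)
  have G_lower: "pmin \<le> p e" if "e \<in> G" for e
  proof -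
    obtain x y where xy: "e = {x, y}" using \<open>e \<in> G\<close> by (auto simp: G_def local_pairs_def)
    with \<open>e \<in> G\<close> have "x \<noteq> y" "real r \<le> norm1 (x - y)" "cell H x = cell H y"
      by (auto simp: G_def doubleton_in_local_pairs)
    with assms(1,4) show ?thesis
      unfolding pmin_def xy by (intro lower_tile[of _ _ "cell H x"]) (auto simp: mem_tile)
  qed
  \<comment> \<open>The value of \<open>t\<close> makes one heavily cut bipartition closed with
    probability at most \<open>exp (- 2 * mbar)\<close>, against at most
    \<open>2 ^ card \<B> \<le> exp mbar\<close> bipartitions.\<close>
  have fail: "(\<Sum>U\<in>\<U>. expect p G (\<lambda>\<zeta>. of_bool (\<zeta> \<inter> E U = {}))) \<le> real n / real (card V)"
  proof -
    have "(\<Sum>U\<in>\<U>. expect p G (\<lambda>\<zeta>. of_bool (\<zeta> \<inter> E U = {}))) \<le> (\<Sum>U\<in>\<U>. exp (- 2 * mbar))"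
    proof (rule sum_mono)
      fix U assume U: "U \<in> \<U>"
      have "expect p G (\<lambda>\<zeta>. of_bool (\<zeta> \<inter> E U = {})) \<le> exp (- pmin * real (card (E U)))"
        using EG[of U] G_lower probG by (intro expect_all_closed_le[OF finG]) blast+
      also have "\<dots> \<le> exp (- pmin * t)"
        using U pmin by (simp add: \<U>_def)
      also have "- pmin * t = - 2 * mbar" using pmin by (simp add: t)
      finally show "expect p G (\<lambda>\<zeta>. of_bool (\<zeta> \<inter> E U = {})) \<le> exp (- 2 * mbar)" .
    qed
    also have "\<dots> \<le> 2 ^ card \<B> * exp (- 2 * mbar)"
    proof -
      have "card \<U> \<le> card (Pow \<B>)" using fin\<B> by (intro card_mono) (auto simp: \<U>_def)
      then have "real (card \<U>) \<le> real (2 ^ card \<B>)" using fin\<B> by (simp only: card_Pow of_nat_le_iff)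
      then have "real (card \<U>) * exp (- 2 * mbar) \<le> 2 ^ card \<B> * exp (- 2 * mbar)"
        by (intro mult_right_mono) auto
      then show ?thesis by simp
    qed
    also have "\<dots> \<le> exp mbar * exp (- 2 * mbar)"
    proof (rule mult_right_mono)
      have "(2::real) ^ card \<B> \<le> exp 1 ^ card \<B>"
        using exp_ge_add_one_self[of 1] by (intro power_mono) auto
      also have "\<dots> = exp (real (card \<B>))" by (simp add: exp_of_nat_mult[symmetric])
      also have "\<dots> \<le> exp mbar" using m_le by simp
      finally show "(2::real) ^ card \<B> \<le> exp mbar" .
    qed simp
    also have "\<dots> = exp (- mbar)" by (simp add: exp_add[symmetric])
    also have "\<dots> \<le> 1 / mbar" using mbar by (rule exp_minus_le_inverse)
    also have "\<dots> = real n / real (card V)" by (simp add: mbar_def)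
    finally show ?thesis .
  qed
  have XH: "card (X \<inter> tile H z) \<le> H ^ CARD('d)" for z
    using card_mono[of "tile H z" "X \<inter> tile H z"] assms(1) by (simp add: card_tile)
  have sum_X: "(\<Sum>z\<in>tile M z0. card (X \<inter> tile H z)) = card X"
  proof -
    have "X = (\<Union>z\<in>tile M z0. X \<inter> tile H z)"
      using XV by (auto simp: V_def tile_mult)
    moreover have "card (\<Union>z\<in>tile M z0. X \<inter> tile H z) = (\<Sum>z\<in>tile M z0. card (X \<inter> tile H z))"
      using assms(1,2) finX by (intro card_UN_disjoint) (auto simp: mem_tile)
    ultimately show ?thesis by simp
  qed
  have pointwise: "(\<Sum>z\<in>tile M z0. (real (card (X \<inter> tile H z)))\<^sup>2)
      \<le> real H ^ CARD('d) * (\<Sum>z\<in>tile M z0. real (peak (\<eta> \<union> \<zeta>) (tile H z)))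
        + real (card V) * (2 * real r) ^ CARD('d) + 4 * t
        + real H ^ CARD('d) * real (card V) * (\<Sum>U\<in>\<U>. of_bool (\<zeta> \<inter> E U = {}))" for \<zeta>
  \<comment> \<open>If a heavily cut bipartition is closed, the last term alone suffices: the left
    side never exceeds H^d |V|.\<close>
  proof (cases "\<exists>U\<in>\<U>. \<zeta> \<inter> E U = {}")
    case True
    then obtain U where U: "U \<in> \<U>" "\<zeta> \<inter> E U = {}" by blast
    have "1 \<le> (\<Sum>U\<in>\<U>. of_bool (\<zeta> \<inter> E U = {}) :: real)"
      using U fin\<U> member_le_sum[of U \<U> "\<lambda>U. of_bool (\<zeta> \<inter> E U = {}) :: real"] by auto
    then have 1: "real H ^ CARD('d) * real (card V) * 1 \<le> real H ^ CARD('d) * real (card V) * (\<Sum>U\<in>\<U>. of_bool (\<zeta> \<inter> E U = {}))"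
      by (intro mult_left_mono) auto
    have "(\<Sum>z\<in>tile M z0. (real (card (X \<inter> tile H z)))\<^sup>2) \<le> (\<Sum>z\<in>tile M z0. real (H ^ CARD('d)) * real (card (X \<inter> tile H z)))"
      unfolding power2_eq_square using XH by (intro sum_mono mult_right_mono) (simp_all only: of_nat_le_iff of_nat_0_le_iff)
    also have "\<dots> = real H ^ CARD('d) * real (card X)"
      by (simp add: sum_distrib_left[symmetric] sum_X[symmetric])
    also have "\<dots> \<le> real H ^ CARD('d) * real (card V)"
      using XV finV by (intro mult_left_mono) (auto intro: card_mono)
    finally have "(\<Sum>z\<in>tile M z0. (real (card (X \<inter> tile H z)))\<^sup>2) \<le> real H ^ CARD('d) * real (card V)" .
    moreover have "0 \<le> real H ^ CARD('d) * (\<Sum>z\<in>tile M z0. real (peak (\<eta> \<union> \<zeta>) (tile H z)))"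
      by (intro mult_nonneg_nonneg sum_nonneg) auto
    moreover have "0 \<le> real (card V) * (2 * real r) ^ CARD('d)" "0 \<le> t" using mbar pmin by (auto simp: t)
    ultimately show ?thesis using 1 by linarith
  next
    case False
    define f where "f = reach (\<eta> \<union> \<zeta>)"
    \<comment> \<open>Ordered far pairs inside a tile that remain disconnected after revealing
      \<zeta>. The aim is \<open>card D \<le> 4 * t\<close>.\<close>
    define D where "D = {(x, y). x \<in> X \<and> y \<in> X \<and> cell H x = cell H y \<and> real r \<le> norm1 (x - y) \<and> f x \<noteq> f y}"
    have D_sub: "D \<subseteq> X \<times> X" by (auto simp: D_def)
    then have finD: "finite D" using finX finite_subset by blast
    have "\<exists>W\<subseteq>f ` X. card D \<le> 2 * card {(x, y) \<in> D. (f x \<in> W) \<noteq> (f y \<in> W)}"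
      by (rule max_cut_ge_half) (use finX finD in \<open>auto simp: D_def\<close>)
    then obtain W where W: "card D \<le> 2 * card {(x, y) \<in> D. (f x \<in> W) \<noteq> (f y \<in> W)}" by blast
    \<comment> \<open>The side \<open>W\<close> of the final clusters, read back on the
      \<eta>-clusters. This is consistent because each \<eta>-cluster lies in a single final
      cluster.\<close>
    define U where "U = reach \<eta> ` {x \<in> X. f x \<in> W}"
    have f_mono: "f x = f y" if "reach \<eta> x = reach \<eta> y" for x y
    proof -
      have "x \<in> reach \<eta> y" using that reach_refl[of x \<eta>] by simp
      then have "x \<in> f y" unfolding f_def using reach_mono[of \<eta> "\<eta> \<union> \<zeta>"] by blast
      then show ?thesis unfolding f_def by (rule reach_eq)
    qed
    have U_iff: "reach \<eta> x \<in> U \<longleftrightarrow> f x \<in> W" if "x \<in> X" for x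
    proof
      assume "reach \<eta> x \<in> U"
      then obtain x' where x': "f x' \<in> W" "reach \<eta> x = reach \<eta> x'" unfolding U_def by blast
      with f_mono[OF x'(2)] show "f x \<in> W" by simp
    next
      assume "f x \<in> W"
      with that show "reach \<eta> x \<in> U" unfolding U_def by blast
    qed
    \<comment> \<open>\<open>W\<close> splits no final cluster, so no open bond crosses it; by the
      case assumption this bipartition is then cut by fewer than \<open>t\<close> bonds.\<close>
    have "\<zeta> \<inter> E U = {}"
    proof (rule ccontr)
      assume "\<zeta> \<inter> E U \<noteq> {}"
      then obtain x y where xy: "{x, y} \<in> \<zeta>" "x \<in> X" "y \<in> X" "reach \<eta> x \<in> U" "reach \<eta> y \<notin> U"
        by (auto simp: E_def)
      have "y \<in> f x" unfolding f_def using xy(1) by (intro reach_step[of x _ x y]) auto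
      then have "f y = f x" unfolding f_def by (rule reach_eq)
      with xy U_iff show False by simp
    qed
    moreover have "U \<subseteq> \<B>" by (auto simp: U_def \<B>_def)
    ultimately have E_small: "real (card (E U)) < t"
      using False by (auto simp: \<U>_def not_le)
    have in_G: "{x, y} \<in> G" if "(x, y) \<in> D" for x y
      using that XV by (auto simp: D_def G_def doubleton_in_local_pairs f_def)
    \<comment> \<open>For a fixed orientation \<open>b\<close> ordered pairs inject into bonds. Two
      orientations and the factor 2 of \<open>max_cut_ge_half\<close> give
      \<open>4 * t\<close>.\<close>
    have half: "card A \<le> card (E U)"
      if A: "A \<subseteq> D" "\<And>x y. (x, y) \<in> A \<Longrightarrow> (f x \<in> W) = b \<and> (f y \<in> W) = (\<not> b)" for A b
    proof (rule card_inj_on_le[of "\<lambda>(x, y). {x, y}"])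
      show "inj_on (\<lambda>(x, y). {x, y}) A"
      proof (rule inj_onI, clarify)
        fix x y x' y' assume "(x, y) \<in> A" "(x', y') \<in> A" "{x, y} = {x', y'}"
        with A(2)[of x y] A(2)[of x' y'] show "x = x' \<and> y = y'"
          by (auto simp: doubleton_eq_iff)
      qed
      show "(\<lambda>(x, y). {x, y}) ` A \<subseteq> E U"
      proof clarify
        fix x y assume xy: "(x, y) \<in> A"
        then have D: "(x, y) \<in> D" "x \<in> X" "y \<in> X" using A(1) by (auto simp: D_def)
        have "{x, y} \<in> G" "{y, x} \<in> G" using in_G[OF D(1)] by (simp_all add: insert_commute)
        moreover have "(reach \<eta> x \<in> U \<and> reach \<eta> y \<notin> U) \<or> (reach \<eta> y \<in> U \<and> reach \<eta> x \<notin> U)"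
          using A(2)[OF xy] U_iff D by auto
        ultimately show "{x, y} \<in> E U" using D(2,3) unfolding E_def by blast
      qed
      show "finite (E U)" using EG finG finite_subset by blast
    qed
    have "card {(x, y) \<in> D. (f x \<in> W) \<noteq> (f y \<in> W)}
        \<le> card ({(x, y) \<in> D. f x \<in> W \<and> f y \<notin> W} \<union> {(x, y) \<in> D. f x \<notin> W \<and> f y \<in> W})"
      using finD by (intro card_mono finite_UnI) (auto intro: finite_subset[OF _ finD])
    also have "\<dots> \<le> card {(x, y) \<in> D. f x \<in> W \<and> f y \<notin> W} + card {(x, y) \<in> D. f x \<notin> W \<and> f y \<in> W}"
      by (rule card_Un_le)
    also have "\<dots> \<le> card (E U) + card (E U)"
    proof (rule add_mono)
      show "card {(x, y) \<in> D. f x \<in> W \<and> f y \<notin> W} \<le> card (E U)" by (rule half[where b=True]) auto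
      show "card {(x, y) \<in> D. f x \<notin> W \<and> f y \<in> W} \<le> card (E U)" by (rule half[where b=False]) auto
    qed
    finally have cardD: "real (card D) \<le> 4 * t" using W E_small by linarith
    define Dx where "Dx = (\<lambda>x. {y. (x, y) \<in> D})"
    have finDx: "finite (Dx x)" for x
      using finX D_sub by (intro finite_subset[of "Dx x" X]) (auto simp: Dx_def)
    \<comment> \<open>Every vertex of \<open>X\<close> in the tile of \<open>x\<close> is in the
      final cluster of \<open>x\<close>, closer than \<open>r\<close> to \<open>x\<close>, or a
      partner of \<open>x\<close> in \<open>D\<close>. Summing over \<open>x\<close> in the tile
      turns the left side into the square.\<close>
    have fib: "card (X \<inter> tile H z) \<le> peak (\<eta> \<union> \<zeta>) (tile H z) + (2 * r) ^ CARD('d) + card (Dx x)"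
      if x: "x \<in> X \<inter> tile H z" for x z
    proof -
      have "X \<inter> tile H z \<subseteq> (f x \<inter> tile H z) \<union> {y. norm1 (x - y) < real r} \<union> Dx x"
      proof
        fix y assume y: "y \<in> X \<inter> tile H z"
        then have "f x = f y \<Longrightarrow> y \<in> f x" by (simp add: f_def)
        with x y show "y \<in> (f x \<inter> tile H z) \<union> {y. norm1 (x - y) < real r} \<union> Dx x"
          by (auto simp: Dx_def D_def mem_tile)
      qed
      then have "card (X \<inter> tile H z) \<le> card ((f x \<inter> tile H z) \<union> {y. norm1 (x - y) < real r} \<union> Dx x)"
        using finDx finite_norm1_ball_around assms(1) by (intro card_mono) auto
      also have "\<dots> \<le> card (f x \<inter> tile H z) + card {y. norm1 (x - y) < real r} + card (Dx x)"
        by (meson card_Un_le add_right_mono le_trans)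
      also have "\<dots> \<le> peak (\<eta> \<union> \<zeta>) (tile H z) + (2 * r) ^ CARD('d) + card (Dx x)"
        unfolding f_def using assms(1) by (intro add_mono card_reach_le_peak card_norm1_ball_around) auto
      finally show ?thesis .
    qed
    have "(\<Sum>z\<in>tile M z0. (real (card (X \<inter> tile H z)))\<^sup>2)
        \<le> (\<Sum>z\<in>tile M z0. real H ^ CARD('d) * real (peak (\<eta> \<union> \<zeta>) (tile H z))
            + real (card (X \<inter> tile H z)) * (2 * real r) ^ CARD('d) + (\<Sum>x\<in>X \<inter> tile H z. real (card (Dx x))))"
    proof (rule sum_mono)
      fix z :: "int ^ 'd"
      have "(real (card (X \<inter> tile H z)))\<^sup>2 = (\<Sum>x\<in>X \<inter> tile H z. real (card (X \<inter> tile H z)))"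
        by (simp add: power2_eq_square)
      also have "\<dots> \<le> (\<Sum>x\<in>X \<inter> tile H z. real (peak (\<eta> \<union> \<zeta>) (tile H z) + (2 * r) ^ CARD('d) + card (Dx x)))"
        using fib by (intro sum_mono) (simp only: of_nat_le_iff)
      also have "\<dots> = real (card (X \<inter> tile H z)) * real (peak (\<eta> \<union> \<zeta>) (tile H z))
          + real (card (X \<inter> tile H z)) * (2 * real r) ^ CARD('d) + (\<Sum>x\<in>X \<inter> tile H z. real (card (Dx x)))"
        by (simp add: sum.distrib distrib_left)
      also have "real (card (X \<inter> tile H z)) * real (peak (\<eta> \<union> \<zeta>) (tile H z)) \<le> real (H ^ CARD('d)) * real (peak (\<eta> \<union> \<zeta>) (tile H z))"
        using XH[of z] by (intro mult_right_mono) (simp_all only: of_nat_le_iff of_nat_0_le_iff)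
      finally show "(real (card (X \<inter> tile H z)))\<^sup>2 \<le> real H ^ CARD('d) * real (peak (\<eta> \<union> \<zeta>) (tile H z))
            + real (card (X \<inter> tile H z)) * (2 * real r) ^ CARD('d) + (\<Sum>x\<in>X \<inter> tile H z. real (card (Dx x)))"
        by simp
    qed
    also have "\<dots> = real H ^ CARD('d) * (\<Sum>z\<in>tile M z0. real (peak (\<eta> \<union> \<zeta>) (tile H z)))
        + real (card X) * (2 * real r) ^ CARD('d) + (\<Sum>z\<in>tile M z0. \<Sum>x\<in>X \<inter> tile H z. real (card (Dx x)))"
      by (simp add: sum.distrib sum_distrib_left sum_X[symmetric] sum_distrib_right)
    also have "(\<Sum>z\<in>tile M z0. \<Sum>x\<in>X \<inter> tile H z. real (card (Dx x))) = real (card D)"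
    proof -
      have X_eq: "X = (\<Union>z\<in>tile M z0. X \<inter> tile H z)"
        using XV by (auto simp: V_def tile_mult)
      have "(\<Sum>x\<in>X. real (card (Dx x))) = (\<Sum>z\<in>tile M z0. \<Sum>x\<in>X \<inter> tile H z. real (card (Dx x)))"
        by (subst X_eq, rule sum.UNION_disjoint) (use assms(1,2) finX in \<open>auto simp: mem_tile\<close>)
      moreover have "D = Sigma X Dx" by (auto simp: D_def Dx_def)
      then have "card D = (\<Sum>x\<in>X. card (Dx x))" using finX finDx by (simp add: card_SigmaI)
      ultimately show ?thesis by simp
    qed
    also have "real (card X) * (2 * real r) ^ CARD('d) \<le> real (card V) * (2 * real r) ^ CARD('d)"
      using XV finV by (intro mult_right_mono) (auto intro: card_mono)
    also note cardD
    finally have "(\<Sum>z\<in>tile M z0. (real (card (X \<inter> tile H z)))\<^sup>2) \<le> real H ^ CARD('d) * (\<Sum>z\<in>tile M z0. real (peak (\<eta> \<union> \<zeta>) (tile H z)))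
        + real (card V) * (2 * real r) ^ CARD('d) + 4 * t" by simp
    moreover have "0 \<le> real H ^ CARD('d) * real (card V) * (\<Sum>U\<in>\<U>. of_bool (\<zeta> \<inter> E U = {}))"
      by (intro mult_nonneg_nonneg sum_nonneg) auto
    ultimately show ?thesis by linarith
  qed
  have "(\<Sum>z\<in>tile M z0. (real (card (X \<inter> tile H z)))\<^sup>2)
      = expect p G (\<lambda>_. \<Sum>z\<in>tile M z0. (real (card (X \<inter> tile H z)))\<^sup>2)"
    using finG by simp
  also have "\<dots> \<le> expect p G (\<lambda>\<zeta>. real H ^ CARD('d) * (\<Sum>z\<in>tile M z0. real (peak (\<eta> \<union> \<zeta>) (tile H z)))
        + real (card V) * (2 * real r) ^ CARD('d) + 4 * t
        + real H ^ CARD('d) * real (card V) * (\<Sum>U\<in>\<U>. of_bool (\<zeta> \<inter> E U = {})))"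
    using pointwise by (intro expect_mono probG)
  also have "\<dots> = real H ^ CARD('d) * expect p G (\<lambda>\<zeta>. \<Sum>z\<in>tile M z0. real (peak (\<eta> \<union> \<zeta>) (tile H z)))
        + real (card V) * (2 * real r) ^ CARD('d) + 4 * t
        + real H ^ CARD('d) * real (card V) * (\<Sum>U\<in>\<U>. expect p G (\<lambda>\<zeta>. of_bool (\<zeta> \<inter> E U = {})))"
    using finG by (simp only: expect_add expect_cmult expect_sum expect_const)
  also have "real H ^ CARD('d) * real (card V) * (\<Sum>U\<in>\<U>. expect p G (\<lambda>\<zeta>. of_bool (\<zeta> \<inter> E U = {})))
      \<le> real H ^ CARD('d) * real (card V) * (real n / real (card V))"
    using fail by (intro mult_left_mono) auto
  also have "\<dots> = real H ^ CARD('d) * real n" using V_ne by simp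
  finally show ?thesis by (simp add: G_def)
qed

text \<open>Averages \<open>coarse_peaks_pointwise\<close> over the short bonds. Only the mean
  number of vertices in large clusters is known, not how they spread over the tiles, so the sum of
  squares is bounded below by convexity; hence \<theta>^2. The 4^d is the square of the 2^d lost in
  passing from \<open>V\<close> to \<open>V0\<close>.\<close>

lemma coarse_peaks:
  fixes H r n M :: nat and z0 :: "int ^ 'd" and \<theta> :: real
  assumes "H > 0" "M > 0" "n > 0" "r0 \<le> r" "0 \<le> \<theta>"
  defines "V \<equiv> tile (H * M) z0"
  assumes V0: "V0 \<subseteq> V" "card V \<le> 2 ^ CARD('d) * card V0"
    and many: "\<And>x. x \<in> V0 \<Longrightarrow> \<theta> \<le> expect p (local_pairs V r 1) (\<lambda>\<eta>. of_bool (n \<le> card (reach \<eta> x)))"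
  shows "real (card V) * (\<theta>\<^sup>2 / 4 ^ CARD('d) - (2 * real r / real H) ^ CARD('d)
        - 8 / (real n * real H ^ CARD('d) * (c * (real CARD('d) * real H) powr (- s))) - real n / real (card V))
    \<le> expect p (local_pairs V r H) (\<lambda>\<eta>. \<Sum>z\<in>tile M z0. real (peak \<eta> (tile H z)))"
proof -
  define F where "F = local_pairs V r 1"
  define G where "G = local_pairs V r H - F"
  define X where "X = (\<lambda>\<eta>. {x \<in> V. n \<le> card (reach \<eta> x)})"
  define g where "g = real H ^ CARD('d)"
  define t where "t = 2 * (real (card V) / real n) / (c * (real CARD('d) * real H) powr (- s))"
  \<comment> \<open>A lower bound for the mean number of large-cluster vertices per tile. The
    tangent inequality 2 a x - a^2 \<le> x^2 at this point does the work of Cauchy-Schwarz.\<close>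
  define a where "a = \<theta> / 2 ^ CARD('d) * g"
  define loss where "loss = real (card V) * (2 * real r) ^ CARD('d) + 4 * t + g * real n"
  have finV: "finite V" using assms(1,2) by (simp add: V_def)
  have fin: "finite F" "finite G" using finV by (simp_all add: F_def G_def)
  have g: "g > 0" using assms(1) by (simp add: g_def)
  have cardV: "real (card V) = real M ^ CARD('d) * g" "card V > 0"
    using assms(1,2) by (simp_all add: V_def card_tile g_def power_mult_distrib)
  have F_sub: "F \<subseteq> local_pairs V r H"
    by (auto simp: F_def local_pairs_def)
  have prob_F: "0 \<le> p e \<and> p e \<le> 1" if "e \<in> F" for e
    using that local_pairs_subset[of V r 1] by (intro prob_pairs[of e V]) (auto simp: F_def)
  have a0: "a \<ge> 0" using assms(5) g by (simp add: a_def)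
  have sum_X: "(\<Sum>z\<in>tile M z0. real (card (X \<eta> \<inter> tile H z))) = (\<Sum>x\<in>V. of_bool (n \<le> card (reach \<eta> x)))" for \<eta>
  proof -
    have "(\<Sum>x\<in>V. of_bool (n \<le> card (reach \<eta> x)) :: real)
        = (\<Sum>z\<in>tile M z0. \<Sum>x\<in>tile H z. of_bool (n \<le> card (reach \<eta> x)))"
      unfolding V_def using assms(1,2) by (rule sum_tile_mult)
    also have "\<dots> = (\<Sum>z\<in>tile M z0. real (card (X \<eta> \<inter> tile H z)))"
    proof (rule sum.cong)
      fix z assume z: "z \<in> tile M z0"
      have "X \<eta> \<inter> tile H z = {x \<in> tile H z. n \<le> card (reach \<eta> x)}"
        using z by (auto simp: X_def V_def tile_mult)
      then show "(\<Sum>x\<in>tile H z. of_bool (n \<le> card (reach \<eta> x)) :: real) = real (card (X \<eta> \<inter> tile H z))"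
        using assms(1) by (simp add: sum_of_bool_eq Int_def)
    qed simp
    finally show ?thesis by simp
  qed
  have "\<theta> * real (card V0) \<le> (\<Sum>x\<in>V0. expect p F (\<lambda>\<eta>. of_bool (n \<le> card (reach \<eta> x))))"
    using many sum_bounded_below[of V0 \<theta>] by (simp add: F_def mult.commute)
  also have "\<dots> \<le> (\<Sum>x\<in>V. expect p F (\<lambda>\<eta>. of_bool (n \<le> card (reach \<eta> x))))"
  proof (rule sum_mono2[OF finV V0(1)])
    fix x
    have "expect p F (\<lambda>_. 0) \<le> expect p F (\<lambda>\<eta>. of_bool (n \<le> card (reach \<eta> x)))"
      using prob_F by (intro expect_mono) auto
    then show "0 \<le> expect p F (\<lambda>\<eta>. of_bool (n \<le> card (reach \<eta> x)))" using fin by simp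
  qed
  also have "\<dots> = expect p F (\<lambda>\<eta>. \<Sum>z\<in>tile M z0. real (card (X \<eta> \<inter> tile H z)))"
    by (simp add: sum_X expect_sum)
  finally have mean: "\<theta> * real (card V0) \<le> expect p F (\<lambda>\<eta>. \<Sum>z\<in>tile M z0. real (card (X \<eta> \<inter> tile H z)))" .
  have "a * real M ^ CARD('d) \<le> \<theta> * real (card V0)"
  proof -
    have "real (card V) \<le> real (2 ^ CARD('d) * card V0)" using V0(2) by (simp only: of_nat_le_iff)
    then have "real (card V) / 2 ^ CARD('d) \<le> real (card V0)" by (simp add: field_simps)
    then have "\<theta> * (real (card V) / 2 ^ CARD('d)) \<le> \<theta> * real (card V0)"
      using assms(5) by (rule mult_left_mono)
    then show ?thesis by (simp add: cardV(1) a_def field_simps)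
  qed
  with mean have "a * (a * real M ^ CARD('d)) \<le> a * expect p F (\<lambda>\<eta>. \<Sum>z\<in>tile M z0. real (card (X \<eta> \<inter> tile H z)))"
    using a0 by (intro mult_left_mono) auto
  then have "a\<^sup>2 * real M ^ CARD('d) \<le> 2 * a * expect p F (\<lambda>\<eta>. \<Sum>z\<in>tile M z0. real (card (X \<eta> \<inter> tile H z))) - a\<^sup>2 * real M ^ CARD('d)"
    by (simp add: power2_eq_square mult.assoc)
  also have "\<dots> = expect p F (\<lambda>\<eta>. 2 * a * (\<Sum>z\<in>tile M z0. real (card (X \<eta> \<inter> tile H z))) - a\<^sup>2 * real M ^ CARD('d))"
    using fin by (simp only: expect_diff expect_cmult expect_const)
  also have "\<dots> \<le> expect p F (\<lambda>\<eta>. g * expect p G (\<lambda>\<zeta>. \<Sum>z\<in>tile M z0. real (peak (\<eta> \<union> \<zeta>) (tile H z))) + loss)"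
  proof (rule expect_mono[OF prob_F])
    fix \<eta> assume \<eta>: "\<eta> \<subseteq> F"
    have "2 * a * (\<Sum>z\<in>tile M z0. real (card (X \<eta> \<inter> tile H z))) - a\<^sup>2 * real M ^ CARD('d)
        = (\<Sum>z\<in>tile M z0. 2 * a * real (card (X \<eta> \<inter> tile H z)) - a\<^sup>2)"
      using assms(2) by (simp add: sum_subtractf sum_distrib_left card_tile mult.commute)
    also have "\<dots> \<le> (\<Sum>z\<in>tile M z0. (real (card (X \<eta> \<inter> tile H z)))\<^sup>2)"
    proof (rule sum_mono)
      fix z :: "int ^ 'd"
      have "0 \<le> (real (card (X \<eta> \<inter> tile H z)) - a)\<^sup>2" by simp
      then show "2 * a * real (card (X \<eta> \<inter> tile H z)) - a\<^sup>2 \<le> (real (card (X \<eta> \<inter> tile H z)))\<^sup>2"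
        by (simp add: power2_diff algebra_simps)
    qed
    also have "\<dots> \<le> g * expect p G (\<lambda>\<zeta>. \<Sum>z\<in>tile M z0. real (peak (\<eta> \<union> \<zeta>) (tile H z))) + loss"
      using coarse_peaks_pointwise[OF assms(1-4), of \<eta> z0] \<eta>
      by (simp add: g_def loss_def t_def G_def F_def X_def V_def)
    finally show "2 * a * (\<Sum>z\<in>tile M z0. real (card (X \<eta> \<inter> tile H z))) - a\<^sup>2 * real M ^ CARD('d)
      \<le> g * expect p G (\<lambda>\<zeta>. \<Sum>z\<in>tile M z0. real (peak (\<eta> \<union> \<zeta>) (tile H z))) + loss" .
  qed
  also have "\<dots> = g * expect p (F \<union> G) (\<lambda>\<eta>. \<Sum>z\<in>tile M z0. real (peak \<eta> (tile H z))) + loss"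
    using fin by (subst expect_union) (auto simp: G_def expect_add expect_cmult)
  also have "F \<union> G = local_pairs V r H" using F_sub by (auto simp: G_def)
  finally have main: "a\<^sup>2 * real M ^ CARD('d) \<le> g * expect p (local_pairs V r H) (\<lambda>\<eta>. \<Sum>z\<in>tile M z0. real (peak \<eta> (tile H z))) + loss" .
  define q where "q = c * (real CARD('d) * real H) powr (- s)"
  have q: "q > 0" using c_pos assms(1) by (simp add: q_def)
  have "(4::real) ^ CARD('d) = (2 ^ CARD('d))\<^sup>2"
    by (simp add: power2_eq_square power_mult_distrib[symmetric])
  then have a2: "a\<^sup>2 * real M ^ CARD('d) = g * (real (card V) * (\<theta>\<^sup>2 / 4 ^ CARD('d)))"
    by (simp add: a_def cardV(1) power_mult_distrib power_divide power2_eq_square)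
  have l: "loss = g * (real (card V) * ((2 * real r / real H) ^ CARD('d) + 8 / (real n * g * q) + real n / real (card V)))"
    unfolding loss_def t_def q_def[symmetric] using g q cardV(2) assms(3)
    by (simp add: power_divide g_def[symmetric] field_simps)
  have "g * (real (card V) * (\<theta>\<^sup>2 / 4 ^ CARD('d) - (2 * real r / real H) ^ CARD('d) - 8 / (real n * g * q) - real n / real (card V)))
      \<le> g * expect p (local_pairs V r H) (\<lambda>\<eta>. \<Sum>z\<in>tile M z0. real (peak \<eta> (tile H z)))"
    using main unfolding a2 l by (simp add: algebra_simps)
  then show ?thesis using g by (simp add: g_def q_def)
qed

end

section \<open>Clusters built from short bonds\<close>

lemma reach_card_mono:
  assumes "\<eta> \<subseteq> \<zeta>" "\<zeta> \<subseteq> pairs V" "finite V"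
  shows "card (reach \<eta> u) \<le> card (reach \<zeta> u)"
  using assms reach_finite by (intro card_mono reach_mono) auto

text \<open>Grow a connected set from \<open>u\<close> one vertex at a time; each new edge is
  shorter than \<open>r\<close>, so \<open>n\<close> vertices are found within distance
  \<open>n * r\<close>. The size event thereby becomes visible in a fixed ball.\<close>

lemma reach_localized:
  fixes \<eta> :: "(int ^ 'd::finite) set set"
  assumes short: "\<And>x y. {x, y} \<in> \<eta> \<Longrightarrow> x \<noteq> y \<and> norm1 (x - y) < real r"
    and fin: "finite (reach \<eta> u)" and "n \<le> card (reach \<eta> u)"
  shows "n \<le> card (reach (\<eta> \<inter> pairs {y. norm1 (y - u) \<le> real (n * r)}) u)"
proof (cases "n = 0")
  case False
  define B where "B = (\<lambda>n. {y. norm1 (y - u) \<le> real (n * r)})"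
  have "\<exists>S. u \<in> S \<and> card S = n \<and> S \<subseteq> reach (\<eta> \<inter> pairs (B n)) u \<inter> B n"
    using False \<open>n \<le> card (reach \<eta> u)\<close>
  proof (induction n)
    case (Suc n)
    show ?case
    proof (cases "n = 0")
      case True
      then show ?thesis by (intro exI[of _ "{u}"]) (auto simp: B_def)
    next
      case False
      with Suc obtain S where S: "u \<in> S" "card S = n" "S \<subseteq> reach (\<eta> \<inter> pairs (B n)) u \<inter> B n"
        by auto
      have finS: "finite S" using S(2) False by (auto intro: card_ge_0_finite)
      \<comment> \<open>The cluster has more than \<open>n\<close> vertices, so some edge leaves the
        current set \<open>S\<close>.\<close>
      have "\<not> reach \<eta> u \<subseteq> S"
        using card_mono[OF finS, of "reach \<eta> u"] S(2) Suc.prems(2) by linarith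
      then obtain x y where xy: "x \<in> S" "{x, y} \<in> \<eta>" "y \<notin> S"
        using reach_least[of u S \<eta>] S(1) by blast
      have B_mono: "B n \<subseteq> B (Suc n)"
        unfolding B_def by (auto intro: order_trans)
      have x: "x \<in> B n" using S(3) xy(1) by blast
      have yB: "y \<in> B (Suc n)"
      proof -
        have "norm1 (y - u) \<le> norm1 (y - x) + norm1 (x - u)" by (rule norm1_triangle_diff)
        also have "\<dots> \<le> real r + real (n * r)"
          using short[OF xy(2)] x norm1_diff_commute[of x y] by (simp add: B_def)
        finally show ?thesis by (simp add: B_def algebra_simps)
      qed
      have sub: "reach (\<eta> \<inter> pairs (B n)) u \<subseteq> reach (\<eta> \<inter> pairs (B (Suc n))) u"
        using pairs_mono[OF B_mono] by (intro reach_mono) auto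
      have "{x, y} \<in> \<eta> \<inter> pairs (B (Suc n))"
        using xy(2) short[OF xy(2)] x B_mono yB by (auto simp: pairs_def)
      moreover have "x \<in> reach (\<eta> \<inter> pairs (B (Suc n))) u" using S(3) xy(1) sub by blast
      ultimately have "y \<in> reach (\<eta> \<inter> pairs (B (Suc n))) u" by (rule reach_step[rotated])
      then show ?thesis
        using S finS xy(3) sub B_mono yB by (intro exI[of _ "insert y S"]) auto
    qed
  qed simp
  then obtain S where S: "card S = n" "S \<subseteq> reach (\<eta> \<inter> pairs (B n)) u" by blast
  have "finite (reach (\<eta> \<inter> pairs (B n)) u)"
    using reach_mono[of "\<eta> \<inter> pairs (B n)" \<eta>] fin by (auto intro: finite_subset)
  with card_mono[OF this S(2)] S(1) show ?thesis by (simp add: B_def)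
qed simp

definition big_cluster :: "nat \<Rightarrow> 'v \<Rightarrow> 'v set set \<Rightarrow> real" where
  "big_cluster n u \<eta> = of_bool (n \<le> card (reach \<eta> u))"

lemma big_cluster_mono:
  "\<eta> \<subseteq> \<zeta> \<Longrightarrow> \<zeta> \<subseteq> pairs V \<Longrightarrow> finite V \<Longrightarrow> big_cluster n u \<eta> \<le> big_cluster n u \<zeta>"
  unfolding big_cluster_def using reach_card_mono[of \<eta> \<zeta> V u] by auto

lemma expect_shift:
  fixes p :: "(int ^ 'd) set \<Rightarrow> real"
  assumes "\<And>x y a. x \<noteq> y \<Longrightarrow> p {a + x, a + y} = p {x, y}" "F \<subseteq> bonds"
  shows "expect p ((`) ((+) a) ` F) f = expect p F (\<lambda>\<eta>. f ((`) ((+) a) ` \<eta>))"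
proof (rule expect_image)
  show "inj_on ((`) ((+) a)) F"
    by (rule inj_onI) (simp add: inj_image_eq_iff)
  fix e assume "e \<in> F"
  then obtain x y where "e = {x, y}" "x \<noteq> y" using assms(2) by (auto simp: bonds_def)
  with assms(1) show "p ((+) a ` e) = p e" by simp
qed

lemma expect_big_cluster_shift:
  fixes p :: "(int ^ 'd) set \<Rightarrow> real"
  assumes "\<And>x y a. x \<noteq> y \<Longrightarrow> p {a + x, a + y} = p {x, y}" "F \<subseteq> bonds"
  shows "expect p ((`) ((+) a) ` F) (big_cluster n (a + u)) = expect p F (big_cluster n u)"
proof -
  have "expect p ((`) ((+) a) ` F) (big_cluster n (a + u))
      = expect p F (\<lambda>\<eta>. big_cluster n (a + u) ((`) ((+) a) ` \<eta>))"
    using assms by (rule expect_shift)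
  also have "\<dots> = expect p F (big_cluster n u)"
    by (simp add: big_cluster_def[abs_def] reach_image[of "(+) a"] card_image)
  finally show ?thesis .
qed

lemma doubleton_in_pairs: "{x, y} \<in> pairs V \<longleftrightarrow> x \<in> V \<and> y \<in> V \<and> x \<noteq> y"
  by (auto simp: pairs_def doubleton_eq_iff)

lemma pairs_image_shift: "(`) ((+) a) ` pairs V = pairs ((+) (a :: 'a::ab_group_add) ` V)"
proof
  show "(`) ((+) a) ` pairs V \<subseteq> pairs ((+) a ` V)"
  proof clarify
    fix e assume "e \<in> pairs V"
    then obtain x y where "e = {x, y}" "x \<in> V" "y \<in> V" "x \<noteq> y" by (auto simp: pairs_def)
    then show "(+) a ` e \<in> pairs ((+) a ` V)"
      by (simp add: doubleton_in_pairs)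
  qed
  show "pairs ((+) a ` V) \<subseteq> (`) ((+) a) ` pairs V"
  proof
    fix e assume "e \<in> pairs ((+) a ` V)"
    then obtain x y where "e = (+) a ` {x, y}" "{x, y} \<in> pairs V" by (auto simp: pairs_def)
    then show "e \<in> (`) ((+) a) ` pairs V" by (rule image_eqI)
  qed
qed

text \<open>A finite-volume form of percolation. It is equivalent to \<open>percolating\<close> by translation invariance,
  continuity of measure and the zero-one law.\<close>

definition percolates_finitely :: "((int ^ 'd) set \<Rightarrow> real) \<Rightarrow> bool" where
  "percolates_finitely p \<longleftrightarrow> (\<exists>\<theta>>0. \<forall>n. \<exists>V. finite V \<and> \<theta> \<le> expect p (pairs V) (big_cluster n 0))"

lemma filterlim_nat_powr_at_top:
  assumes "0 < a"
  shows "filterlim (\<lambda>n. real n powr a) at_top sequentially"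
proof -
  have "((\<lambda>n. real n powr (- a)) \<longlongrightarrow> 0) sequentially"
    using assms by (intro tendsto_neg_powr filterlim_real_sequentially) simp_all
  then have "filterlim (\<lambda>n. inverse (real n powr (- a))) at_top sequentially"
    by (rule filterlim_inverse_at_top) (auto intro!: eventually_sequentiallyI[of 1])
  then show ?thesis by (simp add: powr_minus)
qed

locale lattice_kernel = power_law_kernel p s c r0
  for p :: "(int ^ 'd::finite) set \<Rightarrow> real" and s c :: real and r0 :: nat +
  assumes shift: "\<And>x y a. x \<noteq> y \<Longrightarrow> p {a + x, a + y} = p {x, y}"
begin

lemma expect_mono_pairs:
  assumes "F \<subseteq> pairs V" "\<And>\<eta>. \<eta> \<subseteq> F \<Longrightarrow> f \<eta> \<le> g \<eta>"
  shows "expect p F f \<le> expect p F g"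
  using assms prob_pairs by (intro expect_mono) blast+

text \<open>Here \<open>\<theta>\<close> is the probability that the cluster of the origin is infinite, as the infimum over \<open>n\<close> of
  the supremum over \<open>V\<close>.\<close>

lemma percolates_finitely_sharp:
  assumes "percolates_finitely p"
  shows "\<exists>\<theta>>0. \<forall>\<epsilon>>0. (\<exists>n. \<forall>V. finite V \<longrightarrow> expect p (pairs V) (big_cluster n 0) \<le> \<theta> + \<epsilon>)
      \<and> (\<forall>n. \<exists>V. finite V \<and> \<theta> - \<epsilon> \<le> expect p (pairs V) (big_cluster n 0))"
proof -
  obtain \<theta>0 where \<theta>0: "\<theta>0 > 0" "\<And>n. \<exists>V. finite V \<and> \<theta>0 \<le> expect p (pairs V) (big_cluster n 0)"
    using assms unfolding percolates_finitely_def by blast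
  define A where "A = (\<lambda>n. (\<lambda>V. expect p (pairs V) (big_cluster n 0)) ` {V. finite V})"
  define B where "B = (\<lambda>n. Sup (A n))"
  have bdd: "bdd_above (A n)" for n
  proof (rule bdd_aboveI)
    fix a assume "a \<in> A n"
    then obtain V where V: "finite V" "a = expect p (pairs V) (big_cluster n 0)" by (auto simp: A_def)
    have "a \<le> expect p (pairs V) (\<lambda>_. 1)"
      unfolding V(2) by (rule expect_mono_pairs[of _ V]) (auto simp: big_cluster_def)
    then show "a \<le> 1" using V(1) by simp
  qed
  have A_ne: "A n \<noteq> {}" for n by (auto simp: A_def)
  have B_ge: "\<theta>0 \<le> B n" for n
  proof -
    obtain V where V: "finite V" "\<theta>0 \<le> expect p (pairs V) (big_cluster n 0)" using \<theta>0(2) by blast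
    have "expect p (pairs V) (big_cluster n 0) \<in> A n" using V(1) by (simp add: A_def)
    then have "expect p (pairs V) (big_cluster n 0) \<le> B n" unfolding B_def using bdd by (rule cSup_upper)
    with V(2) show ?thesis by linarith
  qed
  have bddB: "bdd_below (range B)" using B_ge by (intro bdd_belowI[of _ \<theta>0]) auto
  define \<theta> where "\<theta> = Inf (range B)"
  have "\<theta>0 \<le> \<theta>" unfolding \<theta>_def using B_ge by (intro cInf_greatest) auto
  moreover have "\<exists>n. \<forall>V. finite V \<longrightarrow> expect p (pairs V) (big_cluster n 0) \<le> \<theta> + \<epsilon>" if "\<epsilon> > 0" for \<epsilon>
  proof -
    have "Inf (range B) < \<theta> + \<epsilon>" using that by (simp add: \<theta>_def)
    then obtain n where "B n < \<theta> + \<epsilon>" by (auto dest: cInf_lessD[rotated])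
    moreover have "expect p (pairs V) (big_cluster n 0) \<le> B n" if "finite V" for V
      unfolding B_def using that bdd by (intro cSup_upper) (simp_all add: A_def)
    ultimately show ?thesis by (meson less_imp_le order_trans)
  qed
  moreover have "\<exists>V. finite V \<and> \<theta> - \<epsilon> \<le> expect p (pairs V) (big_cluster n 0)" if "\<epsilon> > 0" for \<epsilon> n
  proof -
    have "\<theta> \<le> B n" unfolding \<theta>_def using bddB by (intro cInf_lower) auto
    then have "\<theta> - \<epsilon> < Sup (A n)" using that by (simp add: B_def)
    then obtain a where "a \<in> A n" "\<theta> - \<epsilon> < a" using less_cSupD[OF A_ne] by blast
    then show ?thesis by (auto simp: A_def)
  qed
  ultimately show ?thesis using \<theta>0(1) by (intro exI[of _ \<theta>]) auto
qed

text \<open>A short-bond cluster with fewer than \<open>n0\<close> vertices rarely touches a long bond; one with between \<open>n0\<close>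
  and \<open>n\<close> vertices has all its long bonds closed with probability at least \<open>exp (- 2 n T)\<close>, and
  is then itself a full cluster with between \<open>n0\<close> and \<open>n\<close> vertices, which is an unlikely event.\<close>

lemma long_edges_bound:
  fixes \<eta> :: "(int ^ 'd) set set" and T :: real
  assumes V: "finite V" and \<eta>: "\<eta> \<subseteq> local_pairs V r 1"
    and tail: "\<And>x K. finite K \<Longrightarrow> (\<And>y. y \<in> K \<Longrightarrow> x \<noteq> y \<and> real r \<le> norm1 (x - y)) \<Longrightarrow> (\<Sum>y\<in>K. p {x, y}) \<le> T"
    and half: "\<And>x y. x \<noteq> y \<Longrightarrow> real r \<le> norm1 (x - y) \<Longrightarrow> p {x, y} \<le> 1 / 2"
    and n0: "n0 \<le> n"
  defines "G \<equiv> pairs V - local_pairs V r 1"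
  shows "expect p G (\<lambda>\<zeta>. big_cluster n 0 (\<eta> \<union> \<zeta>)) \<le> big_cluster n 0 \<eta> + real n0 * T
    + exp (2 * real n * T) * (expect p G (\<lambda>\<zeta>. big_cluster n0 0 (\<eta> \<union> \<zeta>)) - expect p G (\<lambda>\<zeta>. big_cluster n 0 (\<eta> \<union> \<zeta>)))"
proof -
  have finG: "finite G" using V by (simp add: G_def)
  have G_sub: "G \<subseteq> pairs V" by (auto simp: G_def)
  have probG: "0 \<le> p e \<and> p e \<le> 1" if "e \<in> G" for e using that G_sub prob_pairs by blast
  have T0: "0 \<le> T" using tail[of "{}"] by simp
  define C where "C = reach \<eta> 0"
  have finC: "finite C"
    unfolding C_def using \<eta> local_pairs_subset[of V r 1] V by (intro reach_finite[of _ V]) auto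
  define K where "K = (\<lambda>x. {y \<in> V. x \<noteq> y \<and> real r \<le> norm1 (x - y)})"
  define D where "D = {{x, y} | x y. x \<in> C \<and> {x, y} \<in> G}"
  have DG: "D \<subseteq> G" by (auto simp: D_def)
  have D_sum: "(\<Sum>e\<in>D. p e) \<le> real (card C) * T"
  proof -
    have sub: "D \<subseteq> (\<lambda>(x, y). {x, y}) ` Sigma C K"
    proof
      fix e assume "e \<in> D"
      then obtain x y where e: "e = {x, y}" "x \<in> C" "{x, y} \<in> G" by (auto simp: D_def)
      have "{x, y} \<in> pairs V" using e(3) G_sub by blast
      then have "x \<in> V \<and> y \<in> V \<and> x \<noteq> y" by (auto simp: pairs_def doubleton_eq_iff)
      moreover from this have "real r \<le> norm1 (x - y)"
        using e(3) by (auto simp: G_def doubleton_in_local_pairs)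
      ultimately show "e \<in> (\<lambda>(x, y). {x, y}) ` Sigma C K" using e by (auto simp: K_def)
    qed
    have finK: "finite (K x)" for x using V by (simp add: K_def)
    have nn: "0 \<le> p {x, y}" if "(x, y) \<in> Sigma C K" for x y
      using that prob[of "{x, y}"] by (auto simp: bonds_def K_def)
    have "(\<Sum>e\<in>D. p e) \<le> (\<Sum>e\<in>(\<lambda>(x, y). {x, y}) ` Sigma C K. p e)"
      using sub finC finK nn by (intro sum_mono2) auto
    also have "\<dots> \<le> (\<Sum>a\<in>Sigma C K. p (case a of (x, y) \<Rightarrow> {x, y}))"
      using sum_image_le[of "Sigma C K" p "\<lambda>(x, y). {x, y}"] finC finK nn by (auto simp: o_def)
    also have "\<dots> = (\<Sum>x\<in>C. \<Sum>y\<in>K x. p {x, y})"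
      using finC finK by (subst sum.Sigma) (auto intro: sum.cong)
    also have "\<dots> \<le> (\<Sum>x\<in>C. T)"
      using finK by (intro sum_mono tail) (auto simp: K_def)
    finally show ?thesis by simp
  qed
  have closed: "reach (\<eta> \<union> \<zeta>) 0 = C" if "\<zeta> \<subseteq> G" "\<zeta> \<inter> D = {}" for \<zeta>
  proof
    show "C \<subseteq> reach (\<eta> \<union> \<zeta>) 0" unfolding C_def by (rule reach_mono) auto
    show "reach (\<eta> \<union> \<zeta>) 0 \<subseteq> C"
    proof (rule reach_least)
      fix x y assume x: "x \<in> C" and e: "{x, y} \<in> \<eta> \<union> \<zeta>"
      have "{x, y} \<notin> \<zeta>" using x that by (auto simp: D_def)
      with e x show "y \<in> C" unfolding C_def by (blast intro: reach_step)
    qed (simp add: C_def)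
  qed
  have P_open: "expect p G (\<lambda>\<zeta>. of_bool (\<zeta> \<inter> D \<noteq> {})) \<le> real (card C) * T"
    using expect_some_open_le[OF finG DG probG] D_sum by (rule order_trans)
  have P_closed: "exp (- 2 * (real (card C) * T)) \<le> expect p G (\<lambda>\<zeta>. of_bool (\<zeta> \<inter> D = {}))"
  proof -
    have finD: "finite D" using DG finG finite_subset by blast
    have "exp (- 2 * (real (card C) * T)) \<le> exp (\<Sum>e\<in>D. - 2 * p e)"
      using D_sum by (simp add: sum_distrib_left[symmetric] sum_negf)
    also have "\<dots> = (\<Prod>e\<in>D. exp (- 2 * p e))" by (rule exp_sum[OF finD])
    also have "\<dots> \<le> (\<Prod>e\<in>D. 1 - p e)"
    proof (intro prod_mono conjI)
      fix e assume "e \<in> D"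
      then obtain x y where e: "e = {x, y}" "{x, y} \<in> G" by (auto simp: D_def)
      then have "x \<noteq> y \<and> real r \<le> norm1 (x - y)"
        using G_sub by (auto simp: G_def doubleton_in_local_pairs pairs_def doubleton_eq_iff norm1_diff_commute)
      then have "p e \<le> 1 / 2" "0 \<le> p e" using half probG e by auto
      \<comment> \<open>Here \<open>half\<close> enters: \<open>p e \<le> 1 / 2\<close> yields
        \<open>exp (- 2 * p e) \<le> 1 - p e\<close>, the origin of the 2 in the exponent.\<close>
      then have "p e * (1 - 2 * p e) \<ge> 0" by (intro mult_nonneg_nonneg) auto
      then have "1 \<le> (1 - p e) * (1 + 2 * p e)" by (simp add: algebra_simps)
      also have "\<dots> \<le> (1 - p e) * exp (2 * p e)"
        using \<open>p e \<le> 1 / 2\<close> exp_ge_add_one_self[of "2 * p e"] by (intro mult_left_mono) auto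
      finally show "exp (- 2 * p e) \<le> 1 - p e" by (simp add: exp_minus field_simps)
    qed simp
    also have "\<dots> = expect p G (\<lambda>\<zeta>. of_bool (\<zeta> \<inter> D = {}))"
      by (rule expect_all_closed[OF finG DG, symmetric])
    finally show ?thesis .
  qed
  have E_le_1: "expect p G (\<lambda>\<zeta>. big_cluster n 0 (\<eta> \<union> \<zeta>)) \<le> 1"
  proof -
    have "expect p G (\<lambda>\<zeta>. big_cluster n 0 (\<eta> \<union> \<zeta>)) \<le> expect p G (\<lambda>_. 1)"
      by (rule expect_mono_pairs[OF G_sub]) (simp add: big_cluster_def)
    then show ?thesis using finG by simp
  qed
  have n0_ge: "expect p G (\<lambda>\<zeta>. big_cluster n 0 (\<eta> \<union> \<zeta>)) \<le> expect p G (\<lambda>\<zeta>. big_cluster n0 0 (\<eta> \<union> \<zeta>))"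
    using n0 by (intro expect_mono_pairs[OF G_sub]) (auto simp: big_cluster_def)
  have gap: "0 \<le> exp (2 * real n * T) * (expect p G (\<lambda>\<zeta>. big_cluster n0 0 (\<eta> \<union> \<zeta>)) - expect p G (\<lambda>\<zeta>. big_cluster n 0 (\<eta> \<union> \<zeta>)))"
    using n0_ge by simp
  have n0T: "0 \<le> real n0 * T" using T0 by simp
  \<comment> \<open>In the first and third cases the right side is at least 1. In the third this
    holds because closing the bonds in \<open>D\<close> puts the final cluster size in [n0, n), so
    the difference of the two expectations is at least
    \<open>exp (- 2 * real n * T)\<close>.\<close>
  consider "n \<le> card C" | "card C < n0" | "n0 \<le> card C" "card C < n" by linarith
  then show ?thesis
  proof cases
    case 1
    then have "big_cluster n 0 \<eta> = 1" by (simp add: big_cluster_def C_def)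
    with E_le_1 gap n0T show ?thesis by linarith
  next
    case 2
    have "expect p G (\<lambda>\<zeta>. big_cluster n 0 (\<eta> \<union> \<zeta>)) \<le> expect p G (\<lambda>\<zeta>. of_bool (\<zeta> \<inter> D \<noteq> {}))"
    proof (rule expect_mono_pairs[OF G_sub])
      fix \<zeta> assume "\<zeta> \<subseteq> G"
      with closed 2 n0 show "big_cluster n 0 (\<eta> \<union> \<zeta>) \<le> of_bool (\<zeta> \<inter> D \<noteq> {})"
        by (cases "\<zeta> \<inter> D = {}") (auto simp: big_cluster_def)
    qed
    also note P_open
    also have "real (card C) * T \<le> real n0 * T" using 2 T0 by (intro mult_right_mono) auto
    finally show ?thesis using gap by (simp add: big_cluster_def)
  next
    case 3
    have "exp (- 2 * real n * T) \<le> exp (- 2 * (real (card C) * T))"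
      using 3 T0 by (simp add: mult_right_mono)
    also note P_closed
    also have "expect p G (\<lambda>\<zeta>. of_bool (\<zeta> \<inter> D = {}))
        \<le> expect p G (\<lambda>\<zeta>. big_cluster n0 0 (\<eta> \<union> \<zeta>) - big_cluster n 0 (\<eta> \<union> \<zeta>))"
    proof (rule expect_mono_pairs[OF G_sub])
      fix \<zeta> assume "\<zeta> \<subseteq> G"
      with closed 3 n0 show "of_bool (\<zeta> \<inter> D = {}) \<le> big_cluster n0 0 (\<eta> \<union> \<zeta>) - big_cluster n 0 (\<eta> \<union> \<zeta>)"
        by (cases "\<zeta> \<inter> D = {}") (auto simp: big_cluster_def)
    qed
    finally have "exp (2 * real n * T) * exp (- 2 * real n * T) \<le> exp (2 * real n * T) *
        (expect p G (\<lambda>\<zeta>. big_cluster n0 0 (\<eta> \<union> \<zeta>)) - expect p G (\<lambda>\<zeta>. big_cluster n 0 (\<eta> \<union> \<zeta>)))"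
      by (intro mult_left_mono) (auto simp: expect_diff)
    then have "1 \<le> exp (2 * real n * T) *
        (expect p G (\<lambda>\<zeta>. big_cluster n0 0 (\<eta> \<union> \<zeta>)) - expect p G (\<lambda>\<zeta>. big_cluster n 0 (\<eta> \<union> \<zeta>)))"
      by (simp add: exp_add[symmetric])
    with E_le_1 n0T show ?thesis by (simp add: big_cluster_def)
  qed
qed

text \<open>Averages \<open>long_edges_bound\<close> over the short bonds. By
  \<open>percolates_finitely_sharp\<close> the probabilities of at least \<open>n0\<close> and at
  least \<open>N\<close> vertices differ by at most 2 \<epsilon> in a suitable volume, so the
  mid-size term is negligible however large \<open>A\<close> is. Only the threshold
  \<open>r2\<close> depends on \<open>A\<close>.\<close>

lemma short_clusters:
  fixes C2 \<alpha> :: real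
  assumes "percolates_finitely p" "\<alpha> > 0" "C2 \<ge> 0"
    and tail: "\<And>r x K. r1 \<le> r \<Longrightarrow> finite K \<Longrightarrow> (\<And>y. y \<in> K \<Longrightarrow> x \<noteq> y \<and> real r \<le> norm1 (x - y)) \<Longrightarrow>
        (\<Sum>y\<in>K. p {x, y}) \<le> C2 * real r powr (- \<alpha>)"
    and half: "\<And>x y. x \<noteq> y \<Longrightarrow> real r1 \<le> norm1 (x - y) \<Longrightarrow> p {x, y} \<le> 1 / 2"
  shows "\<exists>\<theta>>0. \<forall>A>0. \<exists>r2. \<forall>r\<ge>r2. \<forall>n. real n \<le> A * real r powr \<alpha> \<longrightarrow>
    (\<exists>V. finite V \<and> \<theta> \<le> expect p (local_pairs V r 1) (big_cluster n 0))"
proof -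
  obtain \<theta> where \<theta>: "\<theta> > 0"
    and upper: "\<And>\<epsilon>. \<epsilon> > 0 \<Longrightarrow> \<exists>n. \<forall>V. finite V \<longrightarrow> expect p (pairs V) (big_cluster n 0) \<le> \<theta> + \<epsilon>"
    and lower': "\<And>\<epsilon> n. \<epsilon> > 0 \<Longrightarrow> \<exists>V. finite V \<and> \<theta> - \<epsilon> \<le> expect p (pairs V) (big_cluster n 0)"
    using percolates_finitely_sharp[OF assms(1)] by auto
  have "\<exists>r2. \<forall>r\<ge>r2. \<forall>n. real n \<le> A * real r powr \<alpha> \<longrightarrow>
    (\<exists>V. finite V \<and> \<theta> / 2 \<le> expect p (local_pairs V r 1) (big_cluster n 0))" if A: "A > 0" for A
  proof -
    \<comment> \<open>For N \<le> A r^\<alpha> and T = C2 r^-\<alpha> the powers of \<open>r\<close>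
      cancel, so \<kappa> bounds exp (2 N T) for all large \<open>r\<close>. The next line then
      makes the mid-size term 2 \<epsilon> \<kappa> equal to \<theta> / 8.\<close>
    define \<kappa> where "\<kappa> = exp (2 * A * C2)"
    define \<epsilon> where "\<epsilon> = \<theta> / (16 * \<kappa>)"
    have \<kappa>: "\<kappa> \<ge> 1" using A assms(3) by (simp add: \<kappa>_def)
    have \<epsilon>: "\<epsilon> > 0" using \<theta> \<kappa> by (simp add: \<epsilon>_def)
    obtain n0 where n0: "\<And>V. finite V \<Longrightarrow> expect p (pairs V) (big_cluster n0 0) \<le> \<theta> + \<epsilon>"
      using upper[OF \<epsilon>] by blast
    have lim1: "((\<lambda>r. real n0 * (C2 * real r powr (- \<alpha>))) \<longlongrightarrow> 0) sequentially"
      using assms(2) by (auto intro!: tendsto_mult_right_zero tendsto_neg_powr filterlim_real_sequentially)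
    have lim2: "filterlim (\<lambda>r. A * real r powr \<alpha>) at_top sequentially"
      using A assms(2) by (intro filterlim_tendsto_pos_mult_at_top[OF tendsto_const] filterlim_nat_powr_at_top)
    have "eventually (\<lambda>r. real n0 * (C2 * real r powr (- \<alpha>)) < \<theta> / 8) sequentially"
      using \<theta> by (intro order_tendstoD(2)[OF lim1]) auto
    moreover have "eventually (\<lambda>r. real n0 \<le> A * real r powr \<alpha>) sequentially"
      using lim2 by (auto simp: filterlim_at_top)
    ultimately have "eventually (\<lambda>r. real n0 * (C2 * real r powr (- \<alpha>)) < \<theta> / 8 \<and> real n0 \<le> A * real r powr \<alpha> \<and> max 1 r1 \<le> r) sequentially"
      by (intro eventually_conj eventually_ge_at_top)
    then obtain r2 where r2: "\<And>r. r \<ge> r2 \<Longrightarrow> real n0 * (C2 * real r powr (- \<alpha>)) < \<theta> / 8"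
      "\<And>r. r \<ge> r2 \<Longrightarrow> real n0 \<le> A * real r powr \<alpha>" "\<And>r. r \<ge> r2 \<Longrightarrow> r1 \<le> r" "\<And>r. r \<ge> r2 \<Longrightarrow> 1 \<le> r"
      unfolding eventually_sequentially by auto
    have "\<exists>V. finite V \<and> \<theta> / 2 \<le> expect p (local_pairs V r 1) (big_cluster n 0)"
      if r: "r \<ge> r2" and n: "real n \<le> A * real r powr \<alpha>" for r n
    proof -
      \<comment> \<open>Ensures \<open>n0 \<le> N\<close> for \<open>long_edges_bound\<close>;
        reaching size \<open>N\<close> is at least as demanding as reaching
        \<open>n\<close>.\<close>
      define N where "N = max n n0"
      define T where "T = C2 * real r powr (- \<alpha>)"
      have N: "real N \<le> A * real r powr \<alpha>" using n r2(2)[OF r] by (simp add: N_def max_def)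
      have rpos: "real r > 0" using r2(4)[OF r] by simp
      have T0: "T \<ge> 0" using assms(3) by (simp add: T_def)
      have NT: "exp (2 * real N * T) \<le> \<kappa>"
      proof -
        have "real N * T \<le> A * real r powr \<alpha> * T" using N T0 by (rule mult_right_mono)
        also have "\<dots> = A * C2" using rpos by (simp add: T_def powr_minus)
        finally show ?thesis by (simp add: \<kappa>_def)
      qed
      obtain V where V: "finite V" "\<theta> - \<epsilon> \<le> expect p (pairs V) (big_cluster N 0)"
        using lower'[OF \<epsilon>] by blast
      define F where "F = local_pairs V r 1"
      define G where "G = pairs V - F"
      have fin: "finite F" "finite G" using V(1) by (simp_all add: F_def G_def)
      have FG: "F \<union> G = pairs V" "F \<inter> G = {}" using local_pairs_subset by (auto simp: F_def G_def)
      have split: "expect p F (\<lambda>\<eta>. expect p G (\<lambda>\<zeta>. f (\<eta> \<union> \<zeta>))) = expect p (pairs V) f" for f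
        using expect_union[OF fin FG(2), of p f] FG(1) by simp
      have "expect p F (\<lambda>\<eta>. expect p G (\<lambda>\<zeta>. big_cluster N 0 (\<eta> \<union> \<zeta>)))
        \<le> expect p F (\<lambda>\<eta>. big_cluster N 0 \<eta> + real n0 * T
          + exp (2 * real N * T) * (expect p G (\<lambda>\<zeta>. big_cluster n0 0 (\<eta> \<union> \<zeta>)) - expect p G (\<lambda>\<zeta>. big_cluster N 0 (\<eta> \<union> \<zeta>))))"
      proof (rule expect_mono_pairs)
        show "F \<subseteq> pairs V" using FG by auto
        fix \<eta> assume "\<eta> \<subseteq> F"
        then show "expect p G (\<lambda>\<zeta>. big_cluster N 0 (\<eta> \<union> \<zeta>)) \<le> big_cluster N 0 \<eta> + real n0 * T
          + exp (2 * real N * T) * (expect p G (\<lambda>\<zeta>. big_cluster n0 0 (\<eta> \<union> \<zeta>)) - expect p G (\<lambda>\<zeta>. big_cluster N 0 (\<eta> \<union> \<zeta>)))"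
          unfolding G_def F_def
        proof (intro long_edges_bound V(1))
          show "(\<Sum>y\<in>K. p {x, y}) \<le> T"
            if "finite K" "\<And>y. y \<in> K \<Longrightarrow> x \<noteq> y \<and> real r \<le> norm1 (x - y)" for x K
            unfolding T_def using r2(3)[OF r] that by (rule tail)
          show "p {x, y} \<le> 1 / 2" if "x \<noteq> y" "real r \<le> norm1 (x - y)" for x y
            using that r2(3)[OF r] by (intro half) auto
        qed (simp_all add: N_def)
      qed
      also have "\<dots> = expect p F (big_cluster N 0) + real n0 * T
          + exp (2 * real N * T) * (expect p (pairs V) (big_cluster n0 0) - expect p (pairs V) (big_cluster N 0))"
        using fin by (simp only: expect_add expect_cmult expect_diff expect_const split)
      also have "\<dots> \<le> expect p F (big_cluster N 0) + \<theta> / 8 + \<kappa> * (2 * \<epsilon>)"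
      proof (intro add_mono)
        show "real n0 * T \<le> \<theta> / 8" using r2(1)[OF r] by (simp add: T_def)
        have "expect p (pairs V) (big_cluster n0 0) - expect p (pairs V) (big_cluster N 0) \<le> 2 * \<epsilon>"
          using n0[OF V(1)] V(2) by simp
        moreover have "0 \<le> expect p (pairs V) (big_cluster n0 0) - expect p (pairs V) (big_cluster N 0)"
          using expect_mono_pairs[of "pairs V" V "big_cluster N 0" "big_cluster n0 0"]
          by (auto simp: big_cluster_def N_def)
        ultimately show "exp (2 * real N * T) * (expect p (pairs V) (big_cluster n0 0) - expect p (pairs V) (big_cluster N 0)) \<le> \<kappa> * (2 * \<epsilon>)"
          using NT \<kappa> by (intro mult_mono) auto
      qed simp
      finally have "\<theta> - \<epsilon> \<le> expect p F (big_cluster N 0) + \<theta> / 8 + \<kappa> * (2 * \<epsilon>)"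
        using V(2) by (simp add: split)
      moreover have "\<kappa> * (2 * \<epsilon>) = \<theta> / 8" "\<epsilon> \<le> \<theta> / 16"
        using \<kappa> \<theta> by (auto simp: \<epsilon>_def field_simps)
      ultimately have "\<theta> / 2 \<le> expect p F (big_cluster N 0)" using \<theta> by linarith
      also have "\<dots> \<le> expect p F (big_cluster n 0)"
        using FG by (intro expect_mono_pairs[of _ V]) (auto simp: big_cluster_def N_def)
      finally show ?thesis using V(1) by (auto simp: F_def)
    qed
    then show ?thesis by blast
  qed
  with \<theta> show ?thesis by (intro exI[of _ "\<theta> / 2"]) auto
qed

text \<open>\<open>V\<close> comes out of a supremum and its extent is uncontrolled. Confining the
  event to a ball of radius \<open>n * r\<close>, translating it and using monotonicity moves the
  bound to any \<open>W\<close> that contains the ball around \<open>x\<close>.\<close>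

lemma short_clusters_local:
  assumes "finite V" "finite W" "{y. norm1 (y - x) \<le> real (n * r)} \<subseteq> W"
  shows "expect p (local_pairs V r 1) (big_cluster n 0) \<le> expect p (local_pairs W r 1) (big_cluster n x)"
proof -
  define B where "B = {y :: int ^ 'd. norm1 y \<le> real (n * r)}"
  have finB: "finite B"
    by (rule finite_subset[OF _ finite_norm1_ball[of "real (n * r) + 1"]]) (auto simp: B_def)
  define F where "F = local_pairs V r 1"
  have "expect p F (big_cluster n 0) \<le> expect p F (\<lambda>\<eta>. big_cluster n 0 (\<eta> \<inter> (F \<inter> pairs B)))"
  proof (rule expect_mono_pairs[of _ V])
    show "F \<subseteq> pairs V" by (simp add: F_def local_pairs_subset)
    fix \<eta> assume \<eta>: "\<eta> \<subseteq> F"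
    then have short: "x \<noteq> y \<and> norm1 (x - y) < real r" if "{x, y} \<in> \<eta>" for x y
      using subsetD[OF \<eta> that] by (auto simp: F_def doubleton_in_local_pairs)
    have fin: "finite (reach \<eta> 0)"
      using \<eta> local_pairs_subset[of V r 1] assms(1) by (intro reach_finite[of _ V]) (auto simp: F_def)
    have "\<eta> \<inter> (F \<inter> pairs B) = \<eta> \<inter> pairs {y. norm1 (y - 0) \<le> real (n * r)}"
      using \<eta> by (auto simp: B_def)
    with reach_localized[OF short fin, of n] show "big_cluster n 0 \<eta> \<le> big_cluster n 0 (\<eta> \<inter> (F \<inter> pairs B))"
      by (auto simp: big_cluster_def)
  qed
  also have "\<dots> = expect p (F \<inter> pairs B) (big_cluster n 0)"
    using assms(1) by (intro expect_restrict) (auto simp: F_def)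
  also have "\<dots> = expect p ((`) ((+) x) ` (F \<inter> pairs B)) (big_cluster n (x + 0))"
    using pairs_subset_bonds[of B] by (intro expect_big_cluster_shift[symmetric] shift) auto
  also have "\<dots> \<le> expect p (local_pairs W r 1) (big_cluster n x)"
  proof (simp only: add_0_right, rule expect_mono_set)
    show "(`) ((+) x) ` (F \<inter> pairs B) \<subseteq> local_pairs W r 1"
    proof clarify
      fix e assume e: "e \<in> F" "e \<in> pairs B"
      then obtain a b where ab: "e = {a, b}" "a \<in> B" "b \<in> B" "a \<noteq> b" by (auto simp: pairs_def)
      with e have "norm1 (a - b) < real r" by (auto simp: F_def doubleton_in_local_pairs)
      moreover have "x + a \<in> W" "x + b \<in> W" using ab assms(3) by (auto simp: B_def)
      ultimately show "(+) x ` e \<in> local_pairs W r 1" using ab by (simp add: doubleton_in_local_pairs)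
    qed
    show "0 \<le> p e \<and> p e \<le> 1" if "e \<in> local_pairs W r 1" for e
      using that local_pairs_subset[of W r 1] prob_pairs[of e W] by auto
    show "big_cluster n x \<eta> \<le> big_cluster n x \<zeta>" if "\<eta> \<subseteq> \<zeta>" "\<zeta> \<subseteq> local_pairs W r 1" for \<eta> \<zeta>
      using that local_pairs_subset[of W r 1] assms(2) by (intro big_cluster_mono[of _ _ W]) auto
  qed (use assms(2) in auto)
  finally show ?thesis by (simp add: F_def)
qed

end

section \<open>Stability of finitary percolation\<close>

lemma tile_shift: "(+) (\<chi> i. int R * z $ i) ` tile R (0 :: int ^ 'd) = tile R z" if "R > 0"
proof
  show "(+) (\<chi> i. int R * z $ i) ` tile R 0 \<subseteq> tile R z"
    using that by (auto simp: tile_def cell_def vec_eq_iff)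
  show "tile R z \<subseteq> (+) (\<chi> i. int R * z $ i) ` tile R 0"
  proof
    fix x assume "x \<in> tile R z"
    then have "x - (\<chi> i. int R * z $ i) \<in> tile R 0"
      using that by (auto simp: tile_conv_box algebra_simps)
    then show "x \<in> (+) (\<chi> i. int R * z $ i) ` tile R 0"
      by (intro image_eqI[of _ _ "x - (\<chi> i. int R * z $ i)"]) auto
  qed
qed

lemma peak_image:
  assumes "inj \<phi>"
  shows "peak ((`) \<phi> ` \<eta>) (\<phi> ` B) = peak \<eta> B"
proof -
  have "card (reach ((`) \<phi> ` \<eta>) (\<phi> u) \<inter> \<phi> ` B) = card (reach \<eta> u \<inter> B)" for u
    using assms by (simp add: reach_image image_Int[symmetric] card_image inj_on_subset)
  then show ?thesis by (simp add: peak_def image_image)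
qed

context lattice_kernel
begin

lemma expect_peak_tile:
  assumes "R > 0"
  shows "expect p (pairs (tile R z)) (\<lambda>\<eta>. real (peak \<eta> (tile R z)))
    = expect p (pairs (tile R 0)) (\<lambda>\<eta>. real (peak \<eta> (tile R 0)))"
proof -
  define a where "a = (\<chi> i. int R * z $ i)"
  have "expect p ((`) ((+) a) ` pairs (tile R 0)) (\<lambda>\<eta>. real (peak \<eta> (tile R z)))
      = expect p (pairs (tile R 0)) (\<lambda>\<eta>. real (peak ((`) ((+) a) ` \<eta>) (tile R z)))"
    using shift pairs_subset_bonds by (rule expect_shift)
  then show ?thesis
    unfolding pairs_image_shift a_def tile_shift[OF assms, of z, symmetric]
    by (simp add: peak_image)
qed

text \<open>The starting point for merging copies of a good box: each tile keeps at least the peak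
  produced by its own bonds, and all tiles have the same expectation by translation.\<close>

lemma expect_sum_peaks_ge:
  assumes "R > 0" "M > 0"
  shows "real M ^ CARD('d) * expect p (pairs (tile R 0)) (\<lambda>\<eta>. real (peak \<eta> (tile R 0)))
    \<le> expect p (local_pairs (tile (R * M) 0) r R) (\<lambda>\<eta>. \<Sum>z\<in>tile M 0. real (peak \<eta> (tile R z)))"
proof -
  define F where "F = local_pairs (tile (R * M) (0 :: int ^ 'd)) r R"
  have finF: "finite F" using assms by (simp add: F_def)
  have "real M ^ CARD('d) * expect p (pairs (tile R 0)) (\<lambda>\<eta>. real (peak \<eta> (tile R 0)))
      = (\<Sum>z\<in>tile M (0 :: int ^ 'd). expect p (pairs (tile R z)) (\<lambda>\<eta>. real (peak \<eta> (tile R z))))"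
    using assms(2) by (subst sum.cong[OF refl expect_peak_tile[OF assms(1)]]) (simp add: card_tile)
  also have "\<dots> \<le> (\<Sum>z\<in>tile M 0. expect p F (\<lambda>\<eta>. real (peak \<eta> (tile R z))))"
  proof (rule sum_mono)
    fix z :: "int ^ 'd" assume z: "z \<in> tile M 0"
    show "expect p (pairs (tile R z)) (\<lambda>\<eta>. real (peak \<eta> (tile R z))) \<le> expect p F (\<lambda>\<eta>. real (peak \<eta> (tile R z)))"
    proof (rule expect_mono_set[OF finF])
      show "pairs (tile R z) \<subseteq> F"
      proof
        fix e assume "e \<in> pairs (tile R z)"
        then obtain x y where e: "e = {x, y}" "x \<in> tile R z" "y \<in> tile R z" "x \<noteq> y" by (auto simp: pairs_def)
        with z show "e \<in> F" by (auto simp: F_def doubleton_in_local_pairs mem_tile cell_mult)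
      qed
      show "0 \<le> p e \<and> p e \<le> 1" if "e \<in> F" for e
        using that local_pairs_subset[of "tile (R * M) 0" r R] prob_pairs unfolding F_def by blast
      show "real (peak \<eta> (tile R z)) \<le> real (peak \<zeta> (tile R z))" if "\<eta> \<subseteq> \<zeta>" for \<eta> \<zeta>
        using that assms(1) tile_nonempty by (intro of_nat_mono peak_mono) auto
    qed
  qed
  finally show ?thesis by (simp add: F_def expect_sum)
qed

text \<open>A peak of at least \<open>n\<close> is bounded by the number of vertices whose cluster
  has \<open>n\<close> or more vertices, since each vertex of the largest cluster is one of them.
  Averaging over the box yields a good vertex, which is translated to the origin.\<close>

lemma percolates_finitely_of_peaks:
  assumes "R > 0" "\<kappa> > 0"
    and peaks: "\<And>J. \<kappa> * real (R * 2 ^ J) ^ CARD('d) \<le> expect p (pairs (tile (R * 2 ^ J) 0)) (\<lambda>\<eta>. real (peak \<eta> (tile (R * 2 ^ J) 0)))"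
  shows "percolates_finitely p"
proof -
  have "\<exists>V. finite V \<and> \<kappa> / 2 \<le> expect p (pairs V) (big_cluster n 0)" for n
  proof -
    \<comment> \<open>A box so large that \<open>n\<close> uses up at most half of the guaranteed
      expected peak.\<close>
    obtain J where J: "2 * real n / \<kappa> < 2 ^ J" using real_arch_pow[of 2] by auto
    define N where "N = R * 2 ^ J"
    define \<Lambda> where "\<Lambda> = tile N (0 :: int ^ 'd)"
    have N0: "N > 0" using assms(1) by (simp add: N_def)
    have fin: "finite \<Lambda>" "finite (pairs \<Lambda>)" using N0 by (simp_all add: \<Lambda>_def)
    have card\<Lambda>: "real (card \<Lambda>) = real N ^ CARD('d)" using N0 by (simp add: \<Lambda>_def card_tile)
    have big: "real n \<le> \<kappa> / 2 * real N ^ CARD('d)"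
    proof -
      have "(2::real) ^ J \<le> real N" using assms(1) by (simp add: N_def)
      also have "\<dots> \<le> real N ^ CARD('d)"
        using N0 power_increasing[of 1 "CARD('d)" "real N"] by (simp add: Suc_le_eq)
      finally have "2 * real n / \<kappa> \<le> real N ^ CARD('d)" using J by linarith
      then show ?thesis using assms(2) by (simp add: field_simps)
    qed
    have "\<kappa> * real N ^ CARD('d) \<le> expect p (pairs \<Lambda>) (\<lambda>\<eta>. real (peak \<eta> \<Lambda>))"
      using peaks[of J] by (simp add: N_def \<Lambda>_def)
    also have "\<dots> \<le> expect p (pairs \<Lambda>) (\<lambda>\<eta>. (\<Sum>x\<in>\<Lambda>. big_cluster n x \<eta>) + real n)"
    proof (rule expect_mono_pairs[of _ \<Lambda>])
      fix \<eta> assume \<eta>: "\<eta> \<subseteq> pairs \<Lambda>"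
      show "real (peak \<eta> \<Lambda>) \<le> (\<Sum>x\<in>\<Lambda>. big_cluster n x \<eta>) + real n"
      proof (cases "n \<le> peak \<eta> \<Lambda>")
        case True
        obtain u where u: "u \<in> \<Lambda>" "card (reach \<eta> u \<inter> \<Lambda>) = peak \<eta> \<Lambda>"
          using peak_attained[OF fin(1)] tile_nonempty[OF N0] unfolding \<Lambda>_def by metis
        have sub: "reach \<eta> u \<subseteq> \<Lambda>" using \<eta> u(1) by (rule reach_subset)
        then have card_u: "card (reach \<eta> u) = peak \<eta> \<Lambda>" using u(2) by (simp add: Int_absorb2)
        have "real (peak \<eta> \<Lambda>) = (\<Sum>x\<in>reach \<eta> u. big_cluster n x \<eta>)"
          using True card_u by (simp add: big_cluster_def reach_eq)
        also have "\<dots> \<le> (\<Sum>x\<in>\<Lambda>. big_cluster n x \<eta>)"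
          using sub fin by (intro sum_mono2) (auto simp: big_cluster_def)
        finally show ?thesis by simp
      next
        case False
        moreover have "0 \<le> (\<Sum>x\<in>\<Lambda>. big_cluster n x \<eta>)" by (intro sum_nonneg) (simp add: big_cluster_def)
        ultimately show ?thesis by simp
      qed
    qed simp
    also have "\<dots> = (\<Sum>x\<in>\<Lambda>. expect p (pairs \<Lambda>) (big_cluster n x)) + real n"
      using fin by (simp add: expect_add expect_sum)
    finally have mean: "real (card \<Lambda>) * (\<kappa> / 2) \<le> (\<Sum>x\<in>\<Lambda>. expect p (pairs \<Lambda>) (big_cluster n x))"
      using big by (simp add: card\<Lambda> field_simps)
    have "\<exists>x\<in>\<Lambda>. \<kappa> / 2 \<le> expect p (pairs \<Lambda>) (big_cluster n x)"
    proof (rule ccontr)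
      assume "\<not> ?thesis"
      then have "(\<Sum>x\<in>\<Lambda>. expect p (pairs \<Lambda>) (big_cluster n x)) < (\<Sum>x\<in>\<Lambda>. \<kappa> / 2)"
        using fin tile_nonempty[OF N0] by (intro sum_strict_mono) (auto simp: \<Lambda>_def not_le)
      with mean show False by simp
    qed
    then obtain x where x: "\<kappa> / 2 \<le> expect p (pairs \<Lambda>) (big_cluster n x)" by blast
    have "expect p (pairs ((+) (- x) ` \<Lambda>)) (big_cluster n (- x + x)) = expect p (pairs \<Lambda>) (big_cluster n x)"
      unfolding pairs_image_shift[symmetric] using shift pairs_subset_bonds by (rule expect_big_cluster_shift)
    with x fin show ?thesis by (intro exI[of _ "(+) (- x) ` \<Lambda>"]) auto
  qed
  then show ?thesis unfolding percolates_finitely_def using assms(2) by (intro exI[of _ "\<kappa> / 2"]) auto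
qed

text \<open>\<open>V0\<close> consists of the vertices whose ball of radius \<open>n * r\<close>
  stays in the box. By \<open>4 * (n * r) \<le> R\<close> it is a cube of side at least
  \<open>R / 2\<close>, hence the factor 2^d.\<close>

lemma many_short_clusters:
  fixes \<theta> :: real
  assumes "R > 0" "4 * (n * r) \<le> R" "finite V" "\<theta> \<le> expect p (local_pairs V r 1) (big_cluster n 0)"
  shows "\<exists>V0\<subseteq>tile R 0. card (tile R 0 :: (int ^ 'd) set) \<le> 2 ^ CARD('d) * card V0
    \<and> (\<forall>x\<in>V0. \<theta> \<le> expect p (local_pairs (tile R 0) r 1) (big_cluster n x))"
proof -
  define V0 where "V0 = {x :: int ^ 'd. \<forall>i. x $ i \<in> {int (n * r)..<int R - int (n * r)}}"
  have tile0: "tile R 0 = {x :: int ^ 'd. \<forall>i. x $ i \<in> {0..<int R}}"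
    using assms(1) by (simp add: tile_conv_box)
  have "V0 \<subseteq> tile R 0"
  proof
    fix x assume "x \<in> V0"
    then have "int (n * r) \<le> x $ i \<and> x $ i < int R - int (n * r)" for i by (simp add: V0_def)
    moreover have "0 \<le> int (n * r)" by (rule of_nat_0_le_iff)
    ultimately have "0 \<le> x $ i \<and> x $ i < int R" for i by (smt (verit))
    then show "x \<in> tile R 0" by (simp add: tile0)
  qed
  moreover have "card (tile R 0 :: (int ^ 'd) set) \<le> 2 ^ CARD('d) * card V0"
  proof -
    have "card V0 = (R - 2 * (n * r)) ^ CARD('d)"
      unfolding V0_def by (subst card_vec_box) (simp add: nat_diff_distrib' nat_mult_distrib flip: of_nat_mult; simp add: algebra_simps)
    moreover have "R ^ CARD('d) \<le> (2 * (R - 2 * (n * r))) ^ CARD('d)"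
      using assms(2) by (intro power_mono) auto
    ultimately show ?thesis using assms(1) by (simp add: card_tile power_mult_distrib)
  qed
  moreover have "\<theta> \<le> expect p (local_pairs (tile R 0) r 1) (big_cluster n x)" if x: "x \<in> V0" for x
  proof -
    have sub: "{y. norm1 (y - x) \<le> real (n * r)} \<subseteq> tile R 0"
    proof
      fix y assume y: "y \<in> {y. norm1 (y - x) \<le> real (n * r)}"
      have "0 \<le> y $ i \<and> y $ i < int R" for i
      proof -
        have "\<bar>real_of_int (y $ i - x $ i)\<bar> \<le> real (n * r)"
          using abs_component_le_norm1[of "y - x" i] y by simp
        then have "\<bar>y $ i - x $ i\<bar> \<le> int (n * r)" by linarith
        moreover have "int (n * r) \<le> x $ i \<and> x $ i < int R - int (n * r)"
          using x by (simp add: V0_def)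
        ultimately show ?thesis by linarith
      qed
      then show "y \<in> tile R 0" by (simp add: tile0)
    qed
    from assms(4) short_clusters_local[OF assms(3) _ sub] assms(1) show ?thesis by (auto intro: order_trans)
  qed
  ultimately show ?thesis by blast
qed

text \<open>The constants are fixed in the order \<theta>, \<kappa>, \<open>h\<close>,
  \<open>A\<close>, \<open>r\<close>, \<open>n\<close>, \<open>J\<close>. The merging loss is
  bounded for every \<open>r' \<ge> r\<close>, because merging is later restarted from a larger
  cutoff with the same \<open>h\<close>.\<close>

lemma coarse_density:
  fixes C2 Ca Cb :: real
  assumes "percolates_finitely p" "C2 \<ge> 0" "Ca > 0" "Cb > 0"
    and tail: "\<And>r x K. r1 \<le> r \<Longrightarrow> finite K \<Longrightarrow> (\<And>y. y \<in> K \<Longrightarrow> x \<noteq> y \<and> real r \<le> norm1 (x - y)) \<Longrightarrow>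
        (\<Sum>y\<in>K. p {x, y}) \<le> C2 * real r powr (real CARD('d) - s)"
    and half: "\<And>x y. x \<noteq> y \<Longrightarrow> real r1 \<le> norm1 (x - y) \<Longrightarrow> p {x, y} \<le> 1 / 2"
  shows "\<exists>\<kappa>>0. \<exists>h>0. \<exists>r>0. \<exists>J. r0 \<le> r \<and>
    (\<forall>r'\<ge>r. Ca * real h powr (- real CARD('d)) + Cb * real h powr s * real r' powr (s - 2 * real CARD('d)) \<le> \<kappa> / 16) \<and>
    \<kappa> / 2 * real (h * r * 2 ^ J) ^ CARD('d) \<le>
      expect p (local_pairs (tile (h * r * 2 ^ J) 0) r (h * r)) (\<lambda>\<eta>. \<Sum>z\<in>tile (2 ^ J) 0. real (peak \<eta> (tile (h * r) z)))"
proof -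
  define d where "d = real CARD('d)"
  define \<alpha> where "\<alpha> = s - d"
  have d: "d \<ge> 1" by (simp add: d_def Suc_le_eq)
  have \<alpha>: "\<alpha> > 0" "s - 2 * d < 0" using s_gt s_lt by (simp_all add: \<alpha>_def d_def)
  have "\<exists>\<theta>>0. \<forall>A>0. \<exists>r2. \<forall>r\<ge>r2. \<forall>n. real n \<le> A * real r powr \<alpha> \<longrightarrow>
    (\<exists>V. finite V \<and> \<theta> \<le> expect p (local_pairs V r 1) (big_cluster n 0))"
    using \<alpha>(1) tail half by (intro short_clusters[OF assms(1) _ assms(2)]) (auto simp: \<alpha>_def d_def)
  then obtain \<theta> where \<theta>: "\<theta> > 0"
    and clusters: "\<And>A. A > 0 \<Longrightarrow> \<exists>r2. \<forall>r\<ge>r2. \<forall>n. real n \<le> A * real r powr \<alpha> \<longrightarrow>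
      (\<exists>V. finite V \<and> \<theta> \<le> expect p (local_pairs V r 1) (big_cluster n 0))" by blast
  define \<kappa> where "\<kappa> = \<theta>\<^sup>2 / 4 ^ CARD('d)"
  have \<kappa>: "\<kappa> > 0" using \<theta> by (simp add: \<kappa>_def)
  have neg: "((\<lambda>h. real h powr (- d)) \<longlongrightarrow> 0) sequentially"
    using d by (intro tendsto_neg_powr filterlim_real_sequentially) simp_all
  have "eventually (\<lambda>h. Ca * real h powr (- d) < \<kappa> / 32) sequentially"
    using \<kappa> by (intro order_tendstoD(2)[OF tendsto_mult_right_zero[OF neg]]) simp
  moreover have "eventually (\<lambda>h. 2 powr d * real h powr (- d) < \<kappa> / 8) sequentially"
    using \<kappa> by (intro order_tendstoD(2)[OF tendsto_mult_right_zero[OF neg]]) simp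
  ultimately have "eventually (\<lambda>h. Ca * real h powr (- d) < \<kappa> / 32 \<and> 2 powr d * real h powr (- d) < \<kappa> / 8 \<and> 1 \<le> h) sequentially"
    by (intro eventually_conj eventually_ge_at_top)
  then obtain h where h: "Ca * real h powr (- d) < \<kappa> / 32" "2 powr d * real h powr (- d) < \<kappa> / 8" "h > 0"
    by (auto simp: eventually_sequentially)
  \<comment> \<open>Chosen so that \<open>e2\<close> comes out as exactly \<kappa> / 8. It depends
    on \<open>h\<close>, which is legitimate because \<theta> and \<kappa> were fixed without
    reference to \<open>A\<close>.\<close>
  define A where "A = 16 * d powr s * real h powr \<alpha> / c / (\<kappa> / 8)"
  have A: "A > 0" using d h(3) c_pos \<kappa> by (simp add: A_def)
  obtain r2 where r2: "\<And>r n. r \<ge> r2 \<Longrightarrow> real n \<le> A * real r powr \<alpha> \<Longrightarrow>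
      \<exists>V. finite V \<and> \<theta> \<le> expect p (local_pairs V r 1) (big_cluster n 0)"
    using clusters[OF A] by blast
  have lim1: "filterlim (\<lambda>r. A * real r powr \<alpha>) at_top sequentially"
    using A \<alpha> by (intro filterlim_tendsto_pos_mult_at_top[OF tendsto_const] filterlim_nat_powr_at_top)
  have lim2: "((\<lambda>r. Cb * real h powr s * real r powr (s - 2 * d)) \<longlongrightarrow> 0) sequentially"
    using \<alpha> by (intro tendsto_mult_right_zero tendsto_neg_powr filterlim_real_sequentially)
  have "eventually (\<lambda>r. 2 \<le> A * real r powr \<alpha>) sequentially"
    using lim1 by (auto simp: filterlim_at_top)
  moreover have "eventually (\<lambda>r. Cb * real h powr s * real r powr (s - 2 * d) < \<kappa> / 32) sequentially"
    using \<kappa> by (intro order_tendstoD(2)[OF lim2]) simp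
  moreover have "eventually (\<lambda>r. 8 / \<kappa> \<le> real r) sequentially"
    using filterlim_real_sequentially by (auto simp: filterlim_at_top)
  ultimately have "eventually (\<lambda>r. 2 \<le> A * real r powr \<alpha> \<and> Cb * real h powr s * real r powr (s - 2 * d) < \<kappa> / 32
      \<and> 8 / \<kappa> \<le> real r \<and> max (max 1 r0) r2 \<le> r) sequentially"
    by (intro eventually_conj eventually_ge_at_top)
  then obtain r where r: "2 \<le> A * real r powr \<alpha>" "Cb * real h powr s * real r powr (s - 2 * d) < \<kappa> / 32"
      "8 / \<kappa> \<le> real r" "r > 0" "r0 \<le> r" "r2 \<le> r"
    by (auto simp: eventually_sequentially)
  \<comment> \<open>As A r^\<alpha> is at least 2, rounding down loses at most half of it.\<close>
  define n where "n = nat \<lfloor>A * real r powr \<alpha>\<rfloor>"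
  have n: "real n \<le> A * real r powr \<alpha>" "A * real r powr \<alpha> / 2 \<le> real n" "n > 0"
    using r(1) unfolding n_def by linarith+
  obtain V where V: "finite V" "\<theta> \<le> expect p (local_pairs V r 1) (big_cluster n 0)"
    using r2[OF r(6) n(1)] by blast
  \<comment> \<open>The box grows with \<open>n\<close>: clusters of \<open>n\<close> vertices made
    of bonds shorter than \<open>r\<close> may extend to distance \<open>n * r\<close>.\<close>
  obtain J where J: "4 * real n < 2 ^ J" using real_arch_pow[of 2] by auto
  have J: "4 * n \<le> 2 ^ J"
  proof -
    have "real (4 * n) \<le> real (2 ^ J)" using J by simp
    then show ?thesis by (simp only: of_nat_le_iff)
  qed
  define H where "H = h * r"
  define R where "R = h * r * 2 ^ J"
  have H0: "H > 0" using h r by (simp add: H_def)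
  have nrR: "4 * (n * r) \<le> R"
  proof -
    have "4 * n * r \<le> 2 ^ J * r" using J by (rule mult_right_mono) simp
    also have "\<dots> \<le> R" using h(3) by (simp add: R_def)
    finally show ?thesis by (simp add: mult_ac)
  qed
  have R0: "R > 0" using h r by (simp add: R_def)
  have HR: "H * 2 ^ J = R" by (simp add: H_def R_def)
  obtain V0 where V0: "V0 \<subseteq> tile R 0" "card (tile R 0 :: (int ^ 'd) set) \<le> 2 ^ CARD('d) * card V0"
      "\<And>x. x \<in> V0 \<Longrightarrow> \<theta> \<le> expect p (local_pairs (tile R 0) r 1) (big_cluster n x)"
    using many_short_clusters[OF R0 nrR V] by blast
  have cardR: "real (card (tile R (0 :: int ^ 'd))) = real R ^ CARD('d)"
    using R0 by (simp add: card_tile)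
  have "real (card (tile (H * 2 ^ J) (0 :: int ^ 'd))) * (\<theta>\<^sup>2 / 4 ^ CARD('d) - (2 * real r / real H) ^ CARD('d)
        - 8 / (real n * real H ^ CARD('d) * (c * (real CARD('d) * real H) powr (- s))) - real n / real (card (tile (H * 2 ^ J) (0 :: int ^ 'd))))
    \<le> expect p (local_pairs (tile (H * 2 ^ J) 0) r H) (\<lambda>\<eta>. \<Sum>z\<in>tile (2 ^ J) 0. real (peak \<eta> (tile H z)))"
    using H0 n(3) r(5) \<theta> V0 by (intro coarse_peaks) (auto simp: HR big_cluster_def[abs_def])
  then have main: "real R ^ CARD('d) * (\<kappa> - (2 * real r / real H) ^ CARD('d)
        - 8 / (real n * real H ^ CARD('d) * (c * (d * real H) powr (- s))) - real n / real R ^ CARD('d))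
    \<le> expect p (local_pairs (tile R 0) r H) (\<lambda>\<eta>. \<Sum>z\<in>tile (2 ^ J) 0. real (peak \<eta> (tile H z)))"
    by (simp only: HR cardR \<kappa>_def d_def)
  have hr: "real h > 0" "real r > 0" using h r by auto
  \<comment> \<open>The three errors of \<open>coarse_peaks\<close> are pairs closer than
    \<open>r\<close>, far pairs left disconnected, and failure of the union bound. Each is at most
    \<kappa> / 8, which leaves more than \<kappa> / 2.\<close>
  have e1: "(2 * real r / real H) ^ CARD('d) \<le> \<kappa> / 8"
  proof -
    have "(2 * real r / real H) ^ CARD('d) = (2 / real h) powr d"
      using hr by (simp add: H_def d_def powr_realpow)
    also have "\<dots> = 2 powr d * real h powr (- d)"
      using hr by (simp add: powr_divide powr_minus field_simps)
    finally show ?thesis using h(2) by simp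
  qed
  have e2: "8 / (real n * real H ^ CARD('d) * (c * (d * real H) powr (- s))) \<le> \<kappa> / 8"
  proof -
    have H1: "real H ^ CARD('d) = real h powr d * real r powr d"
      using hr by (simp add: H_def d_def powr_realpow[symmetric] powr_mult)
    have H2: "(d * real H) powr (- s) = 1 / (d powr s * real h powr s * real r powr s)"
      using hr d by (simp add: H_def powr_mult powr_minus field_simps)
    have "8 / (real n * real H ^ CARD('d) * (c * (d * real H) powr (- s)))
        = 8 * d powr s * (real h powr s / real h powr d) * (real r powr s / real r powr d) / c / real n"
      unfolding H1 H2 using hr d c_pos n(3) by (simp add: field_simps)
    also have "\<dots> = 8 * d powr s * real h powr \<alpha> * real r powr \<alpha> / c / real n"
      by (simp add: \<alpha>_def powr_diff)
    also have "\<dots> \<le> 8 * d powr s * real h powr \<alpha> * real r powr \<alpha> / c / (A * real r powr \<alpha> / 2)"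
      using n(2) A hr c_pos by (intro divide_left_mono) (auto intro!: mult_pos_pos n(3))
    also have "\<dots> = \<kappa> / 8"
      using hr d c_pos \<kappa> by (simp add: A_def field_simps)
    finally show ?thesis .
  qed
  have e3: "real n / real R ^ CARD('d) \<le> \<kappa> / 8"
  proof -
    have "real (4 * (n * r)) \<le> real R" using nrR by (simp only: of_nat_le_iff)
    then have "4 * (real n * real r) \<le> real R" by simp
    also have "\<dots> \<le> real R ^ CARD('d)"
      using R0 power_increasing[of 1 "CARD('d)" "real R"] by (simp add: Suc_le_eq)
    finally have "real n * real r \<le> real R ^ CARD('d)" using n(3) hr
      by (smt (verit) mult_nonneg_nonneg of_nat_0_le_iff)
    then have "real n / real R ^ CARD('d) \<le> 1 / real r"
      using R0 hr by (simp add: field_simps)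
    also have "\<dots> \<le> \<kappa> / 8" using r(3) hr \<kappa> by (simp add: field_simps)
    finally show ?thesis .
  qed
  have "real R ^ CARD('d) * (\<kappa> / 2) \<le> real R ^ CARD('d) * (\<kappa> - (2 * real r / real H) ^ CARD('d)
        - 8 / (real n * real H ^ CARD('d) * (c * (d * real H) powr (- s))) - real n / real R ^ CARD('d))"
    using e1 e2 e3 \<kappa> by (intro mult_left_mono) auto
  also note main
  finally have dens: "\<kappa> / 2 * real (h * r * 2 ^ J) ^ CARD('d) \<le>
      expect p (local_pairs (tile (h * r * 2 ^ J) 0) r (h * r)) (\<lambda>\<eta>. \<Sum>z\<in>tile (2 ^ J) 0. real (peak \<eta> (tile (h * r) z)))"
    by (simp add: R_def H_def mult.commute)
  have loss: "Ca * real h powr (- real CARD('d)) + Cb * real h powr s * real r' powr (s - 2 * real CARD('d)) \<le> \<kappa> / 16" if "r' \<ge> r" for r'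
  proof -
    have "real r' powr (s - 2 * d) \<le> real r powr (s - 2 * d)"
      using that hr \<alpha> by (intro powr_mono2') auto
    then have "Cb * real h powr s * real r' powr (s - 2 * d) \<le> Cb * real h powr s * real r powr (s - 2 * d)"
      using assms(4) by (intro mult_left_mono) auto
    then show ?thesis using h(1) r(2) unfolding d_def by linarith
  qed
  show ?thesis using \<kappa> h(3) r(4,5) loss dens by blast
qed

end

text \<open>An expected peak in one box that exceeds all later merging losses is a finite criterion,
  hence open in the bond probabilities. The losses must not depend on \<epsilon>, so
  \<open>dyadic_merging\<close> is taken with \<open>c / 2\<close>, valid for every \<epsilon> \<le>
  1/2.\<close>

lemma percolates_finitely_stable:
  fixes p :: "(int ^ 'd::finite) set \<Rightarrow> real" and C2 :: real
  assumes ker: "lattice_kernel p s c r0" and "percolates_finitely p" "C2 \<ge> 0"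
    and tail: "\<And>r x K. r1 \<le> r \<Longrightarrow> finite K \<Longrightarrow> (\<And>y. y \<in> K \<Longrightarrow> x \<noteq> y \<and> real r \<le> norm1 (x - y)) \<Longrightarrow>
        (\<Sum>y\<in>K. p {x, y}) \<le> C2 * real r powr (real CARD('d) - s)"
    and half: "\<And>x y. x \<noteq> y \<Longrightarrow> real r1 \<le> norm1 (x - y) \<Longrightarrow> p {x, y} \<le> 1 / 2"
  shows "\<exists>\<epsilon>>0. \<epsilon> < 1 \<and> percolates_finitely (\<lambda>e. (1 - \<epsilon>) * p e)"
proof -
  interpret lattice_kernel p s c r0 by (rule ker)
  have scaled: "lattice_kernel (\<lambda>e. (1 - \<epsilon>) * p e) s (c / 2) r0" if "0 \<le> \<epsilon>" "\<epsilon> \<le> 1 / 2" for \<epsilon>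
  proof
    show "0 \<le> (1 - \<epsilon>) * p e \<and> (1 - \<epsilon>) * p e \<le> 1" if "e \<in> bonds" for e
      using prob[OF that] \<open>0 \<le> \<epsilon>\<close> \<open>\<epsilon> \<le> 1 / 2\<close> by (auto intro: mult_le_one)
    show "c / 2 * norm1 (x - y) powr - s \<le> (1 - \<epsilon>) * p {x, y}" if "x \<noteq> y" "real r0 \<le> norm1 (x - y)" for x y
    proof -
      have "c / 2 * norm1 (x - y) powr - s = 1 / 2 * (c * norm1 (x - y) powr - s)" by simp
      also have "\<dots> \<le> (1 - \<epsilon>) * (c * norm1 (x - y) powr - s)"
        using \<open>\<epsilon> \<le> 1 / 2\<close> c_pos by (intro mult_right_mono) auto
      also have "\<dots> \<le> (1 - \<epsilon>) * p {x, y}"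
        using lower[OF that] \<open>\<epsilon> \<le> 1 / 2\<close> by (intro mult_left_mono) auto
      finally show ?thesis .
    qed
  qed (use c_pos s_gt s_lt shift in auto)
  define d where "d = CARD('d)"
  obtain Ca Cb where C: "Ca > 0" "Cb > 0" and merge: "\<And>p r0 h r J. power_law_kernel p s (c / 2) r0 \<Longrightarrow> h > 0 \<Longrightarrow> r > 0 \<Longrightarrow> r0 \<le> r \<Longrightarrow>
    expect p (local_pairs (tile (h * r * 2 ^ J) (0 :: int ^ 'd)) r (h * r)) (\<lambda>\<eta>. \<Sum>z\<in>tile (2 ^ J) 0. real (peak \<eta> (tile (h * r) z)))
    \<le> expect p (pairs (tile (h * r * 2 ^ J) 0)) (\<lambda>\<eta>. real (peak \<eta> (tile (h * r * 2 ^ J) 0)))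
      + real (h * r * 2 ^ J) ^ d * (Ca * real h powr (- real CARD('d)) + Cb * real h powr s * real r powr (s - 2 * real CARD('d)))"
    using dyadic_merging[where 'd='d, of s "c / 2"] s_gt s_lt c_pos unfolding d_def by auto
  obtain \<kappa> h r J where \<kappa>: "\<kappa> > 0" and hr: "h > 0" "r > 0" "r0 \<le> r"
    and loss: "\<And>r'. r' \<ge> r \<Longrightarrow> Ca * real h powr (- real CARD('d)) + Cb * real h powr s * real r' powr (s - 2 * real CARD('d)) \<le> \<kappa> / 16"
    and dens: "\<kappa> / 2 * real (h * r * 2 ^ J) ^ d \<le>
      expect p (local_pairs (tile (h * r * 2 ^ J) 0) r (h * r)) (\<lambda>\<eta>. \<Sum>z\<in>tile (2 ^ J) 0. real (peak \<eta> (tile (h * r) z)))"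
    unfolding d_def using coarse_density[OF assms(2,3) C tail half] by blast
  define R where "R = h * r * 2 ^ J"
  define peakR where "peakR = (\<lambda>\<eta>. real (peak \<eta> (tile R (0 :: int ^ 'd))))"
  have R0: "R > 0" using hr by (simp add: R_def)
  have Rd: "real R ^ d > 0" using R0 by simp
  have "power_law_kernel p s (c / 2) r0"
    using lattice_kernel.axioms(1)[OF scaled[of 0]] by simp
  from merge[OF this hr, of J] dens
  have "\<kappa> / 2 * real R ^ d \<le> expect p (pairs (tile R 0)) peakR
      + real R ^ d * (Ca * real h powr (- real CARD('d)) + Cb * real h powr s * real r powr (s - 2 * real CARD('d)))"
    unfolding R_def peakR_def by linarith
  also have "\<dots> \<le> expect p (pairs (tile R 0)) peakR + real R ^ d * (\<kappa> / 16)"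
    using loss[of r] Rd by (intro add_left_mono mult_left_mono) auto
  \<comment> \<open>Density \<kappa> / 2 minus the loss \<kappa> / 16 leaves a strict surplus over
    \<kappa> / 4, which is what continuity at \<epsilon> = 0 preserves.\<close>
  finally have "\<kappa> / 4 * real R ^ d < expect p (pairs (tile R 0)) peakR"
    using mult_pos_pos[OF \<kappa> Rd] by (simp add: algebra_simps)
  moreover have "((\<lambda>\<epsilon>. expect (\<lambda>e. (1 - \<epsilon>) * p e) (pairs (tile R 0)) peakR) \<longlongrightarrow> expect p (pairs (tile R 0)) peakR) (at_right 0)"
    by (rule tendsto_expect) (auto intro!: tendsto_eq_intros)
  ultimately have "eventually (\<lambda>\<epsilon>. \<kappa> / 4 * real R ^ d < expect (\<lambda>e. (1 - \<epsilon>) * p e) (pairs (tile R 0)) peakR) (at_right 0)"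
    by (rule order_tendstoD(1)[rotated])
  moreover have "eventually (\<lambda>\<epsilon>::real. \<epsilon> \<in> {0<..<1/2}) (at_right 0)"
    by (rule eventually_at_right_real) simp
  ultimately have "eventually (\<lambda>\<epsilon>. \<kappa> / 4 * real R ^ d < expect (\<lambda>e. (1 - \<epsilon>) * p e) (pairs (tile R 0)) peakR \<and> \<epsilon> \<in> {0<..<1/2}) (at_right 0)"
    by (rule eventually_conj)
  then obtain \<epsilon> where \<epsilon>: "\<kappa> / 4 * real R ^ d < expect (\<lambda>e. (1 - \<epsilon>) * p e) (pairs (tile R 0)) peakR" "0 < \<epsilon>" "\<epsilon> < 1 / 2"
    using eventually_happens'[OF trivial_limit_at_right_real] by force
  define p' where "p' = (\<lambda>e. (1 - \<epsilon>) * p e)"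
  interpret P': lattice_kernel p' s "c / 2" r0
    unfolding p'_def using \<epsilon> by (intro scaled) auto
  have "percolates_finitely p'"
  proof (rule P'.percolates_finitely_of_peaks[OF R0])
    show "\<kappa> / 8 > 0" using \<kappa> by simp
    fix K
    define N where "N = R * 2 ^ K"
    \<comment> \<open>The side \<open>R\<close> is read as \<open>h\<close> times the new cutoff
      \<open>r * 2 ^ J\<close>, so the merging bound applies again with the same \<open>h\<close>,
      and \<kappa> / 4 - \<kappa> / 16 still exceeds \<kappa> / 8.\<close>
    have N: "h * (r * 2 ^ J) * 2 ^ K = N" "h * (r * 2 ^ J) = R" by (simp_all add: N_def R_def mult_ac)
    have "\<kappa> / 4 * real N ^ d = real (2 ^ K) ^ d * (\<kappa> / 4 * real R ^ d)"
      by (simp add: N_def power_mult_distrib)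
    also have "\<dots> \<le> real (2 ^ K) ^ d * expect p' (pairs (tile R 0)) peakR"
      using \<epsilon>(1) by (intro mult_left_mono) (auto simp: p'_def)
    also have "\<dots> \<le> expect p' (local_pairs (tile N 0) (r * 2 ^ J) R) (\<lambda>\<eta>. \<Sum>z\<in>tile (2 ^ K) 0. real (peak \<eta> (tile R z)))"
      unfolding N_def d_def peakR_def using R0 by (intro P'.expect_sum_peaks_ge) auto
    also have "\<dots> \<le> expect p' (pairs (tile N 0)) (\<lambda>\<eta>. real (peak \<eta> (tile N 0)))
      + real N ^ d * (Ca * real h powr (- real CARD('d)) + Cb * real h powr s * real (r * 2 ^ J) powr (s - 2 * real CARD('d)))"
      using merge[OF P'.power_law_kernel_axioms hr(1), of "r * 2 ^ J" K] hr
      unfolding N(2) N_def by (simp add: order_trans[OF hr(3)])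
    also have "\<dots> \<le> expect p' (pairs (tile N 0)) (\<lambda>\<eta>. real (peak \<eta> (tile N 0))) + real N ^ d * (\<kappa> / 16)"
      using loss[of "r * 2 ^ J"] by (intro add_left_mono mult_left_mono) auto
    finally have "\<kappa> / 4 * real N ^ d \<le> expect p' (pairs (tile N 0)) (\<lambda>\<eta>. real (peak \<eta> (tile N 0))) + \<kappa> / 16 * real N ^ d"
      by (simp add: mult.commute)
    moreover have "0 \<le> \<kappa> * real N ^ d" using \<kappa> by simp
    ultimately have "\<kappa> / 8 * real N ^ d \<le> expect p' (pairs (tile N 0)) (\<lambda>\<eta>. real (peak \<eta> (tile N 0)))"
      by linarith
    then show "\<kappa> / 8 * real (R * 2 ^ K) ^ CARD('d) \<le> expect p' (pairs (tile (R * 2 ^ K) 0)) (\<lambda>\<eta>. real (peak \<eta> (tile (R * 2 ^ K) 0)))"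
      by (simp only: N_def d_def)
  qed
  then show ?thesis using \<epsilon> unfolding p'_def by (intro exI[of _ \<epsilon>]) auto
qed

section \<open>Transfer to the infinite product measure\<close>

definition norm_ball :: "nat \<Rightarrow> (int ^ 'd) set" where
  "norm_ball L = {x. norm1 x < real L}"

lemma finite_norm_ball [simp]: "finite (norm_ball L :: (int ^ 'd::finite) set)"
  by (simp add: norm_ball_def finite_norm1_ball)

lemma norm_ball_mono: "L \<le> L' \<Longrightarrow> norm_ball L \<subseteq> norm_ball L'"
  by (auto simp: norm_ball_def)

lemma finite_subset_norm_ball:
  fixes V :: "(int ^ 'd::finite) set"
  assumes "finite V"
  shows "\<exists>L. V \<subseteq> norm_ball L"
proof -
  obtain L where L: "Max (insert 0 (norm1 ` V)) < real L" using reals_Archimedean2 by blast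
  have "norm1 x < real L" if "x \<in> V" for x
    using Max_ge[of "insert 0 (norm1 ` V)" "norm1 x"] assms that L by auto
  then show ?thesis by (auto simp: norm_ball_def)
qed

text \<open>Clusters in growing balls exhaust the whole cluster. An infinite cluster thus becomes a
  countable combination of finite-volume events, which gives measurability and allows continuity of
  measure.\<close>

lemma infinite_reach_iff:
  fixes S :: "(int ^ 'd::finite) set set"
  assumes "S \<subseteq> bonds"
  shows "infinite (reach S u) \<longleftrightarrow> (\<forall>n. \<exists>L. n \<le> card (reach (S \<inter> pairs (norm_ball L)) u))"
proof
  assume inf: "infinite (reach S u)"
  show "\<forall>n. \<exists>L. n \<le> card (reach (S \<inter> pairs (norm_ball L)) u)"
  proof
    fix n
    have mono: "reach (S \<inter> pairs (norm_ball L)) u \<subseteq> reach (S \<inter> pairs (norm_ball L')) u" if "L \<le> L'" for L L'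
      using pairs_mono[OF norm_ball_mono[OF that]] by (intro reach_mono) blast
    have "reach S u \<subseteq> (\<Union>L. reach (S \<inter> pairs (norm_ball L)) u)"
    proof (rule reach_least)
      fix x y assume x: "x \<in> (\<Union>L. reach (S \<inter> pairs (norm_ball L)) u)" and e: "{x, y} \<in> S"
      then obtain L where L: "x \<in> reach (S \<inter> pairs (norm_ball L)) u" by blast
      obtain L' where L': "{x, y} \<subseteq> norm_ball L'" using finite_subset_norm_ball[of "{x, y}"] by auto
      have "x \<noteq> y" using e assms by (auto simp: bonds_def doubleton_eq_iff)
      then have "{x, y} \<in> S \<inter> pairs (norm_ball (max L L'))"
        using e L' norm_ball_mono[of L' "max L L'"] by (auto simp: doubleton_in_pairs)
      moreover have "x \<in> reach (S \<inter> pairs (norm_ball (max L L'))) u" using L mono[of L "max L L'"] by auto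
      ultimately show "y \<in> (\<Union>L. reach (S \<inter> pairs (norm_ball L)) u)"
        using reach_step by fast
    qed auto
    moreover obtain T where T: "finite T" "card T = n" "T \<subseteq> reach S u"
      using infinite_arbitrarily_large[OF inf] by blast
    ultimately have "\<forall>x\<in>T. \<exists>L. x \<in> reach (S \<inter> pairs (norm_ball L)) u" by blast
    then obtain f where f: "\<And>x. x \<in> T \<Longrightarrow> x \<in> reach (S \<inter> pairs (norm_ball (f x))) u" by metis
    define L where "L = Max (insert 0 (f ` T))"
    have "T \<subseteq> reach (S \<inter> pairs (norm_ball L)) u"
    proof
      fix x assume "x \<in> T"
      then have "f x \<le> L" unfolding L_def using T(1) by (intro Max_ge) auto
      then show "x \<in> reach (S \<inter> pairs (norm_ball L)) u" using f[OF \<open>x \<in> T\<close>] mono by blast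
    qed
    moreover have "finite (reach (S \<inter> pairs (norm_ball L)) u)"
      by (rule reach_finite[of _ "norm_ball L"]) auto
    ultimately show "\<exists>L. n \<le> card (reach (S \<inter> pairs (norm_ball L)) u)"
      using T(2) card_mono by blast
  qed
next
  assume all: "\<forall>n. \<exists>L. n \<le> card (reach (S \<inter> pairs (norm_ball L)) u)"
  show "infinite (reach S u)"
  proof
    assume fin: "finite (reach S u)"
    obtain L where "Suc (card (reach S u)) \<le> card (reach (S \<inter> pairs (norm_ball L)) u)" using all by blast
    also have "\<dots> \<le> card (reach S u)" using fin by (intro card_mono reach_mono) auto
    finally show False by simp
  qed
qed

text \<open>Without the edge, the cluster of \<open>u\<close> is covered by those of
  \<open>u\<close>, \<open>a\<close> and \<open>b\<close>, so one of the three is infinite.\<close>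

lemma infinite_reach_remove_edge:
  assumes "infinite (reach S u)"
  shows "\<exists>v. infinite (reach (S - {{a, b}}) v)"
proof (rule ccontr)
  assume "\<not> ?thesis"
  moreover have "reach S u \<subseteq> reach (S - {{a, b}}) u \<union> reach (S - {{a, b}}) a \<union> reach (S - {{a, b}}) b"
  proof (rule reach_least)
    fix x y assume x: "x \<in> reach (S - {{a, b}}) u \<union> reach (S - {{a, b}}) a \<union> reach (S - {{a, b}}) b" and e: "{x, y} \<in> S"
    show "y \<in> reach (S - {{a, b}}) u \<union> reach (S - {{a, b}}) a \<union> reach (S - {{a, b}}) b"
    proof (cases "{x, y} = {a, b}")
      case True
      then have "y = a \<or> y = b" by (auto simp: doubleton_eq_iff)
      then show ?thesis by auto
    next
      case False
      with e have "{x, y} \<in> S - {{a, b}}" by simp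
      with x show ?thesis by (elim UnE) (simp_all add: reach_step[of x _ _ y])
    qed
  qed simp
  ultimately show False using assms by (auto dest: finite_subset)
qed

lemma infinite_reach_remove_finite:
  assumes "finite D" "D \<subseteq> bonds"
  shows "(\<exists>u. infinite (reach S u)) \<longleftrightarrow> (\<exists>u. infinite (reach (S - D) u))"
proof
  show "\<exists>u. infinite (reach (S - D) u)" if "\<exists>u. infinite (reach S u)"
    using assms that
  proof (induction D rule: finite_induct)
    case (insert e D)
    then obtain u where u: "infinite (reach (S - D) u)" by auto
    obtain a b where e: "e = {a, b}" using insert.prems by (auto simp: bonds_def)
    have "S - insert e D = S - D - {{a, b}}" unfolding e by (rule Diff_insert)
    with infinite_reach_remove_edge[OF u, of a b] show ?case by (simp only:)
  qed simp
  show "\<exists>u. infinite (reach S u)" if "\<exists>u. infinite (reach (S - D) u)"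
    using that reach_mono[of "S - D" S] infinite_super by (metis Diff_subset)
qed

section \<open>Measurability, cylinder probabilities and the zero-one law\<close>

lemma cluster_conv_reach: "cluster \<omega> u = reach {e \<in> bonds. \<omega> e} u"
proof -
  have "open_bond \<omega> = (\<lambda>x y. {x, y} \<in> {e \<in> bonds. \<omega> e})"
    by (auto simp: fun_eq_iff open_bond_def bonds_def doubleton_eq_iff)
  then show ?thesis by (simp add: cluster_def reach_def)
qed

lemma measurable_finite_configuration:
  assumes "finite F" "\<And>e. e \<in> F \<Longrightarrow> Measurable.pred K (\<lambda>\<omega>. \<omega> e)"
  shows "Measurable.pred K (\<lambda>\<omega>. Q {e \<in> F. \<omega> e})"
proof -
  have "(\<lambda>\<omega>. Q {e \<in> F. \<omega> e}) = (\<lambda>\<omega>. \<exists>\<eta>\<in>{\<eta> \<in> Pow F. Q \<eta>}. \<forall>e\<in>F. \<omega> e = (e \<in> \<eta>))"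
  proof (rule ext, rule iffI)
    fix \<omega> :: "'a \<Rightarrow> bool"
    assume "Q {e \<in> F. \<omega> e}"
    then show "\<exists>\<eta>\<in>{\<eta> \<in> Pow F. Q \<eta>}. \<forall>e\<in>F. \<omega> e = (e \<in> \<eta>)"
      by (intro bexI[of _ "{e \<in> F. \<omega> e}"]) auto
  next
    fix \<omega> :: "'a \<Rightarrow> bool"
    assume "\<exists>\<eta>\<in>{\<eta> \<in> Pow F. Q \<eta>}. \<forall>e\<in>F. \<omega> e = (e \<in> \<eta>)"
    then obtain \<eta> where "\<eta> \<subseteq> F" "Q \<eta>" "\<forall>e\<in>F. \<omega> e = (e \<in> \<eta>)" by blast
    moreover from this have "{e \<in> F. \<omega> e} = \<eta>" by auto
    ultimately show "Q {e \<in> F. \<omega> e}" by simp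
  qed
  moreover have "Measurable.pred K (\<lambda>\<omega>. \<exists>\<eta>\<in>{\<eta> \<in> Pow F. Q \<eta>}. \<forall>e\<in>F. \<omega> e = (e \<in> \<eta>))"
    using assms by (intro pred_intros_finite pred_intros_logic) auto
  ultimately show ?thesis by simp
qed

text \<open>\<open>K\<close> is an arbitrary measurable space in which only the bonds outside
  \<open>D\<close> need be observable; this form serves the tail sigma-algebras.\<close>

lemma measurable_infinite_reach:
  fixes D :: "(int ^ 'd::finite) set set"
  assumes "\<And>e. e \<in> bonds - D \<Longrightarrow> Measurable.pred K (\<lambda>\<omega>. \<omega> e)"
  shows "Measurable.pred K (\<lambda>\<omega>. infinite (reach ({e \<in> bonds. \<omega> e} - D) u))"
proof -
  have eq: "({e \<in> bonds. \<omega> e} - D) \<inter> pairs (norm_ball L) = {e \<in> pairs (norm_ball L) - D. \<omega> e}" for \<omega> L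
    using pairs_subset_bonds[of "norm_ball L"] by blast
  have sub: "{e \<in> bonds. \<omega> e} - D \<subseteq> bonds" for \<omega> by auto
  show ?thesis
    unfolding infinite_reach_iff[OF sub] eq
    using assms pairs_subset_bonds
    by (intro pred_intros_countable measurable_finite_configuration) auto
qed

locale percolation_model =
  fixes P :: "int ^ 'd::finite \<Rightarrow> real"
  assumes P_nonneg: "\<And>k. 0 \<le> P k" and P_sym: "\<And>k. P k = P (- k)" and P_less_1: "\<And>k. P k < 1"
begin

abbreviation "p \<equiv> bond_prob P"
abbreviation "M \<equiv> percolation_measure P"
abbreviation "N \<equiv> \<lambda>e. measure_pmf (bernoulli_pmf (p e))"

lemma p_doubleton: "x \<noteq> y \<Longrightarrow> p {x, y} = P (x - y)"
  using P_sym by (rule bond_prob_doubleton)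

lemma p_bounds: "e \<in> bonds \<Longrightarrow> 0 \<le> p e \<and> p e \<le> 1"
  using P_nonneg P_less_1 by (auto simp: bonds_def p_doubleton less_imp_le)

lemma p_shift: "x \<noteq> y \<Longrightarrow> p {a + x, a + y} = p {x, y}"
  by (simp add: p_doubleton)

sublocale product_prob_space N bonds
  by (intro product_prob_spaceI prob_space_measure_pmf)

sublocale M: prob_space M
  unfolding percolation_measure_def by (rule prob_space_PiM) (rule prob_space_measure_pmf)

lemma space_M: "space M = PiE bonds (\<lambda>_. UNIV)"
  by (simp add: percolation_measure_def space_PiM)

lemma pred_bond: "e \<in> bonds \<Longrightarrow> Measurable.pred M (\<lambda>\<omega>. \<omega> e)"
  unfolding percolation_measure_def
  using measurable_component_singleton[of e bonds N]
  by (simp add: measurable_cong_sets[OF refl sets_measure_pmf_count_space])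

text \<open>The bridge from the product measure to \<open>expect\<close>: the event is a disjoint
  union of cylinders, and a cylinder has measure \<open>weight\<close>.\<close>

lemma prob_finite_configuration:
  assumes "finite F" "F \<subseteq> bonds"
  shows "measure M {\<omega> \<in> space M. Q {e \<in> F. \<omega> e}} = expect p F (\<lambda>\<eta>. of_bool (Q \<eta>))"
proof -
  define cyl where "cyl = (\<lambda>\<eta>. {\<omega> \<in> space M. \<forall>e\<in>F. \<omega> e = (e \<in> \<eta>)})"
  have cyl_emb: "cyl \<eta> = prod_emb bonds N F (PiE F (\<lambda>e. {e \<in> \<eta>}))" for \<eta>
    using assms(2) by (auto simp: cyl_def prod_emb_def space_M PiE_iff extensional_def)
  have cyl_sets: "cyl \<eta> \<in> sets M" for \<eta>
    unfolding cyl_emb percolation_measure_def using assms by (intro sets_PiM_I) auto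
  have cyl_measure: "measure M (cyl \<eta>) = weight p F \<eta>" for \<eta>
  proof -
    have "measure M (cyl \<eta>) = (\<Prod>e\<in>F. measure (N e) {e \<in> \<eta>})"
      unfolding cyl_emb percolation_measure_def using assms by (intro measure_PiM_emb) auto
    also have "\<dots> = weight p F \<eta>"
      unfolding weight_def
    proof (rule prod.cong)
      fix e assume "e \<in> F"
      then have "0 \<le> p e" "p e \<le> 1" using assms(2) p_bounds by auto
      then show "measure (N e) {e \<in> \<eta>} = (if e \<in> \<eta> then p e else 1 - p e)"
        by (simp add: measure_pmf_single)
    qed simp
    finally show ?thesis .
  qed
  have "{\<omega> \<in> space M. Q {e \<in> F. \<omega> e}} = (\<Union>\<eta>\<in>{\<eta> \<in> Pow F. Q \<eta>}. cyl \<eta>)"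
  proof (intro set_eqI iffI)
    fix \<omega> assume "\<omega> \<in> {\<omega> \<in> space M. Q {e \<in> F. \<omega> e}}"
    then show "\<omega> \<in> (\<Union>\<eta>\<in>{\<eta> \<in> Pow F. Q \<eta>}. cyl \<eta>)"
      by (intro UN_I[of "{e \<in> F. \<omega> e}"]) (auto simp: cyl_def)
  next
    fix \<omega> assume "\<omega> \<in> (\<Union>\<eta>\<in>{\<eta> \<in> Pow F. Q \<eta>}. cyl \<eta>)"
    then obtain \<eta> where "\<eta> \<subseteq> F" "Q \<eta>" "\<omega> \<in> space M" "\<forall>e\<in>F. \<omega> e = (e \<in> \<eta>)" by (auto simp: cyl_def)
    moreover from this have "{e \<in> F. \<omega> e} = \<eta>" by auto
    ultimately show "\<omega> \<in> {\<omega> \<in> space M. Q {e \<in> F. \<omega> e}}" by simp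
  qed
  also have "measure M \<dots> = (\<Sum>\<eta>\<in>{\<eta> \<in> Pow F. Q \<eta>}. measure M (cyl \<eta>))"
  proof (rule M.finite_measure_finite_Union)
    show "disjoint_family_on cyl {\<eta> \<in> Pow F. Q \<eta>}"
      by (auto simp: disjoint_family_on_def cyl_def)
  qed (use assms(1) cyl_sets in auto)
  also have "\<dots> = (\<Sum>\<eta>\<in>Pow F. weight p F \<eta> * of_bool (Q \<eta>))"
    using assms(1) by (intro sum.mono_neutral_cong_left) (auto simp: cyl_measure)
  finally show ?thesis by (simp add: expect_def)
qed

definition large :: "int ^ 'd \<Rightarrow> nat \<Rightarrow> nat \<Rightarrow> ((int ^ 'd) set \<Rightarrow> bool) set" where
  "large u n L = {\<omega> \<in> space M. n \<le> card (reach {e \<in> pairs (norm_ball L). \<omega> e} u)}"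

lemma large_sets [measurable]: "large u n L \<in> sets M"
  unfolding large_def
  by (intro predE measurable_finite_configuration[where Q="\<lambda>\<eta>. n \<le> card (reach \<eta> u)"] pred_bond)
    (auto intro: subsetD[OF pairs_subset_bonds])

lemma prob_large: "measure M (large u n L) = expect p (pairs (norm_ball L)) (big_cluster n u)"
  unfolding large_def big_cluster_def[abs_def]
  by (rule prob_finite_configuration) (simp_all add: pairs_subset_bonds)

lemma large_mono: "L \<le> L' \<Longrightarrow> large u n L \<subseteq> large u n L'"
  using pairs_mono[OF norm_ball_mono[of L L']]
  by (auto simp: large_def elim!: order_trans intro!: reach_card_mono[of _ _ "norm_ball L'"])

definition inf_at :: "int ^ 'd \<Rightarrow> ((int ^ 'd) set \<Rightarrow> bool) set" where
  "inf_at u = {\<omega> \<in> space M. infinite (cluster \<omega> u)}"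

lemma inf_at_conv: "inf_at u = (\<Inter>n. \<Union>L. large u n L)"
proof -
  have eq: "{e \<in> bonds. \<omega> e} \<inter> pairs (norm_ball L) = {e \<in> pairs (norm_ball L). \<omega> e}"
    for \<omega> :: "(int ^ 'd) set \<Rightarrow> bool" and L
    using pairs_subset_bonds[of "norm_ball L"] by blast
  have "infinite (cluster \<omega> u) \<longleftrightarrow> (\<forall>n. \<exists>L. n \<le> card (reach {e \<in> pairs (norm_ball L). \<omega> e} u))" for \<omega>
    unfolding cluster_conv_reach by (subst infinite_reach_iff) (auto simp: eq)
  then show ?thesis by (auto simp: inf_at_def large_def)
qed

lemma inf_at_sets [measurable]: "inf_at u \<in> sets M"
  unfolding inf_at_conv by measurable

lemma prob_Union_large:
  assumes "a < measure M (\<Union>L. large u n L)"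
  shows "\<exists>L. a < expect p (pairs (norm_ball L)) (big_cluster n u)"
proof -
  have "(\<lambda>L. measure M (large u n L)) \<longlonglongrightarrow> measure M (\<Union>L. large u n L)"
    by (rule M.finite_Lim_measure_incseq) (auto simp: incseq_def dest: large_mono)
  from order_tendstoD(1)[OF this assms] show ?thesis
    by (auto simp: prob_large eventually_sequentially)
qed

text \<open>There are countably many vertices, so some \<open>u\<close> lies in an infinite cluster
  with positive probability; translation moves it to the origin.\<close>

lemma percolates_finitely_of_percolating:
  assumes "percolating P"
  shows "percolates_finitely p"
proof -
  have "\<exists>u. measure M (inf_at u) > 0"
  proof (rule ccontr)
    assume "\<not> ?thesis"
    then have "measure M (inf_at u) = 0" for u
      using zero_less_measure_iff by blast
    then have "AE \<omega> in M. \<omega> \<notin> inf_at u" for u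
      by (subst (asm) M.prob_eq_0) auto
    then have "AE \<omega> in M. \<forall>u. \<omega> \<notin> inf_at u" by (simp add: AE_all_countable)
    moreover have "AE \<omega> in M. \<exists>u. infinite (cluster \<omega> u)"
      using assms by (simp add: percolating_def)
    ultimately have "AE \<omega> in M. False"
      by (rule AE_mp[OF AE_conjI]) (auto simp: inf_at_def intro!: AE_I2)
    then show False by simp
  qed
  then obtain u where u: "measure M (inf_at u) > 0" by blast
  define \<theta> where "\<theta> = measure M (inf_at u) / 2"
  have "\<exists>V. finite V \<and> \<theta> \<le> expect p (pairs V) (big_cluster n 0)" for n
  proof -
    have "\<theta> < measure M (inf_at u)" using u by (simp add: \<theta>_def)
    also have "\<dots> \<le> measure M (\<Union>L. large u n L)"
      by (intro M.finite_measure_mono) (auto simp: inf_at_conv)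
    finally obtain L where L: "\<theta> < expect p (pairs (norm_ball L)) (big_cluster n u)"
      using prob_Union_large by blast
    have "expect p ((`) ((+) (- u)) ` pairs (norm_ball L)) (big_cluster n (- u + u)) = expect p (pairs (norm_ball L)) (big_cluster n u)"
      using p_shift pairs_subset_bonds by (rule expect_big_cluster_shift)
    with L show ?thesis
      unfolding pairs_image_shift by (intro exI[of _ "(+) (- u) ` norm_ball L"]) auto
  qed
  with u show ?thesis unfolding percolates_finitely_def by (intro exI[of _ \<theta>]) (auto simp: \<theta>_def)
qed

definition inf_event :: "((int ^ 'd) set \<Rightarrow> bool) set" where
  "inf_event = {\<omega> \<in> space M. \<exists>u. infinite (cluster \<omega> u)}"

lemma inf_event_conv: "inf_event = (\<Union>u. inf_at u)"
  by (auto simp: inf_event_def inf_at_def)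

lemma inf_event_sets [measurable]: "inf_event \<in> sets M"
  unfolding inf_event_conv by (intro sets.countable_UN') auto

text \<open>The zero-one law of Kolmogorov for the bonds enumerated by \<open>b\<close>: changing
  finitely many bonds does not affect whether an infinite cluster exists.\<close>

lemma inf_event_0_1: "measure M inf_event = 0 \<or> measure M inf_event = 1"
proof -
  have count: "countable (bonds :: (int ^ 'd) set set)"
  proof -
    have "bonds \<subseteq> (\<lambda>(x, y). {x, y :: int ^ 'd}) ` UNIV" by (auto simp: bonds_def)
    then show ?thesis by (rule countable_subset) simp
  qed
  have inf: "infinite (bonds :: (int ^ 'd) set set)"
  proof
    assume fin: "finite (bonds :: (int ^ 'd) set set)"
    have "inj_on (\<lambda>n. {0, (\<chi> i. int (Suc n)) :: int ^ 'd}) UNIV"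
      by (auto simp: inj_on_def doubleton_eq_iff vec_eq_iff)
    moreover have "range (\<lambda>n. {0, (\<chi> i. int (Suc n)) :: int ^ 'd}) \<subseteq> bonds"
      by (auto simp: bonds_def vec_eq_iff intro!: exI[of _ "0 :: int ^ 'd"] exI)
    ultimately show False using fin finite_imageD finite_subset by blast
  qed
  define b where "b = from_nat_into (bonds :: (int ^ 'd) set set)"
  have b: "bij_betw b UNIV bonds" unfolding b_def using count inf by (rule bij_betw_from_nat_into)
  then have b_in: "b i \<in> bonds" for i by (auto simp: bij_betw_def)
  have b_inj: "inj b" using b by (simp add: bij_betw_def)
  define A where "A = (\<lambda>i. {{\<omega> \<in> space M. \<omega> (b i) \<in> X} | X. True})"
  have A_emb: "{\<omega> \<in> space M. \<forall>j\<in>J. \<omega> (b j) \<in> X j} = prod_emb bonds N (b ` J) (PiE (b ` J) (\<lambda>e. X (the_inv b e)))" for J X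
    using b_in b_inj by (auto simp: prod_emb_def space_M PiE_iff extensional_def the_inv_f_f)
  have A_prob: "measure M {\<omega> \<in> space M. \<forall>j\<in>J. \<omega> (b j) \<in> X j} = (\<Prod>j\<in>J. measure (N (b j)) (X j))"
    if "finite J" for J X
  proof -
    have "measure M {\<omega> \<in> space M. \<forall>j\<in>J. \<omega> (b j) \<in> X j} = (\<Prod>e\<in>b ` J. measure (N e) (X (the_inv b e)))"
      unfolding A_emb unfolding percolation_measure_def using b_in that by (intro measure_PiM_emb) auto
    also have "\<dots> = (\<Prod>j\<in>J. measure (N (b j)) (X j))"
      using b_inj by (subst prod.reindex) (auto simp: the_inv_f_f inj_on_def)
    finally show ?thesis .
  qed
  have A_sets: "{\<omega> \<in> space M. \<omega> (b i) \<in> X} \<in> sets M" for i X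
  proof -
    have "{\<omega> \<in> space M. \<forall>j\<in>{i}. \<omega> (b j) \<in> X} \<in> sets M"
      unfolding A_emb[of "{i}" "\<lambda>_. X"] unfolding percolation_measure_def using b_in by (intro sets_PiM_I) auto
    then show ?thesis by simp
  qed
  have sigma: "sigma_algebra (space M) (A i)" for i
  proof -
    have "A i = sets (vimage_algebra (space M) (\<lambda>\<omega>. \<omega> (b i)) (N (b i)))"
      by (subst sets_vimage_algebra2) (auto simp: A_def vimage_def Int_def conj_commute)
    moreover have "sigma_algebra (space M) (sets (vimage_algebra (space M) (\<lambda>\<omega>. \<omega> (b i)) (N (b i))))"
      using sets.sigma_algebra_axioms[of "vimage_algebra (space M) (\<lambda>\<omega>. \<omega> (b i)) (N (b i))"] by simp
    ultimately show ?thesis by simp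
  qed
  have indep: "M.indep_sets A UNIV"
  proof (rule M.indep_setsI)
    show "A i \<subseteq> sets M" for i using A_sets by (auto simp: A_def)
    fix B J assume J: "J \<noteq> {}" "finite J" "\<forall>j\<in>J. B j \<in> A j"
    then have "\<forall>j\<in>J. \<exists>X. B j = {\<omega> \<in> space M. \<omega> (b j) \<in> X}" by (auto simp: A_def)
    then have "\<exists>X. \<forall>j\<in>J. B j = {\<omega> \<in> space M. \<omega> (b j) \<in> X j}" by (rule bchoice)
    then obtain X where X: "\<And>j. j \<in> J \<Longrightarrow> B j = {\<omega> \<in> space M. \<omega> (b j) \<in> X j}" by blast
    have "(\<Inter>j\<in>J. B j) = {\<omega> \<in> space M. \<forall>j\<in>J. \<omega> (b j) \<in> X j}" using X J(1) by auto
    then have "measure M (\<Inter>j\<in>J. B j) = (\<Prod>j\<in>J. measure (N (b j)) (X j))" using A_prob[OF J(2)] by simp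
    also have "\<dots> = (\<Prod>j\<in>J. measure M (B j))"
    proof (rule prod.cong)
      fix j assume "j \<in> J"
      then show "measure (N (b j)) (X j) = measure M (B j)"
        using A_prob[of "{j}" X] X by simp
    qed simp
    finally show "measure M (\<Inter>j\<in>J. B j) = (\<Prod>j\<in>J. measure M (B j))" .
  qed
  have "inf_event \<in> M.tail_events A"
    unfolding M.tail_events_def
  proof
    fix n
    define K where "K = sigma (space M) (\<Union>i\<in>{n..}. A i)"
    have sub: "(\<Union>i\<in>{n..}. A i) \<subseteq> Pow (space M)" by (auto simp: A_def)
    have K: "space K = space M" "sets K = sigma_sets (space M) (\<Union>i\<in>{n..}. A i)"
      using sub by (simp_all add: K_def space_measure_of sets_measure_of)
    \<comment> \<open>With the first \<open>n\<close> bonds deleted the event is unchanged, and it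
      is then measurable with respect to the bonds from index \<open>n\<close> on.\<close>
    define D where "D = b ` {..<n}"
    have pred: "Measurable.pred K (\<lambda>\<omega>. \<omega> e)" if e: "e \<in> bonds - D" for e
    proof -
      obtain i where i: "e = b i" using e b by (auto simp: bij_betw_def)
      with e have "n \<le> i" by (auto simp: D_def not_less[symmetric])
      then have "{\<omega> \<in> space M. \<omega> (b i) \<in> {True}} \<in> (\<Union>i\<in>{n..}. A i)" unfolding A_def by blast
      then have "{\<omega> \<in> space M. \<omega> e} \<in> sets K" unfolding K(2) i by (intro sigma_sets.Basic) simp
      then show ?thesis by (simp add: pred_def K(1))
    qed
    have "inf_event = {\<omega> \<in> space K. \<exists>u. infinite (reach ({e \<in> bonds. \<omega> e} - D) u)}"
      unfolding inf_event_def cluster_conv_reach K(1)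
      using infinite_reach_remove_finite[of D] b_in by (auto simp: D_def)
    also have "\<dots> \<in> sets K"
      using pred by (intro predE pred_intros_countable measurable_infinite_reach)
    finally show "inf_event \<in> sigma_sets (space M) (\<Union>i\<in>{n..}. A i)" by (simp add: K(2))
  qed
  from M.kolmogorov_0_1_law[OF sigma indep this] show ?thesis .
qed

text \<open>Continuity of measure, first in the volume and then in \<open>n\<close>, gives the
  origin an infinite cluster with probability at least \<theta>; the zero-one law raises existence
  to probability one.\<close>

lemma percolating_of_percolates_finitely:
  assumes "percolates_finitely p"
  shows "percolating P"
proof -
  obtain \<theta> where \<theta>: "\<theta> > 0" "\<And>n. \<exists>V. finite V \<and> \<theta> \<le> expect p (pairs V) (big_cluster n 0)"
    using assms unfolding percolates_finitely_def by blast
  have large: "\<theta> \<le> measure M (\<Union>L. large 0 n L)" for n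
  proof -
    obtain V where V: "finite V" "\<theta> \<le> expect p (pairs V) (big_cluster n 0)" using \<theta>(2) by blast
    obtain L where L: "V \<subseteq> norm_ball L" using finite_subset_norm_ball[OF V(1)] by blast
    note V(2)
    also have "expect p (pairs V) (big_cluster n 0) \<le> expect p (pairs (norm_ball L)) (big_cluster n 0)"
      using pairs_mono[OF L] p_bounds pairs_subset_bonds
      by (intro expect_mono_set) (auto intro!: big_cluster_mono[of _ _ "norm_ball L"])
    also have "\<dots> = measure M (large 0 n L)" by (simp add: prob_large)
    also have "\<dots> \<le> measure M (\<Union>L. large 0 n L)"
      by (intro M.finite_measure_mono) auto
    finally show ?thesis .
  qed
  have "(\<lambda>n. measure M (\<Union>L. large 0 n L)) \<longlonglongrightarrow> measure M (\<Inter>n. \<Union>L. large 0 n L)"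
  proof (rule M.finite_Lim_measure_decseq)
    show "decseq (\<lambda>n. \<Union>L. large 0 n L)"
      by (auto simp: decseq_def large_def intro: order_trans)
  qed auto
  then have "\<theta> \<le> measure M (inf_at 0)"
    unfolding inf_at_conv using large by (intro LIMSEQ_le_const) auto
  also have "\<dots> \<le> measure M inf_event"
    by (intro M.finite_measure_mono) (auto simp: inf_event_conv)
  finally have "measure M inf_event = 1" using inf_event_0_1 \<theta>(1) by auto
  then have "AE \<omega> in M. \<omega> \<in> inf_event" by (rule M.AE_prob_1)
  then show ?thesis unfolding percolating_def by (rule AE_mp) (auto simp: inf_event_def)
qed

end

section \<open>From the asymptotics of \<open>P\<close> to explicit kernel bounds\<close>

theorem theorem1p5:
  fixes P :: "int ^ 'd \<Rightarrow> real" and s \<beta> :: real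
  assumes "real CARD('d) < s" and "s < 2 * real CARD('d)"
    and "\<beta> > 0"
    and "\<And>k. 0 \<le> P k" and "\<And>k. P k = P (- k)" and "\<And>k. P k < 1"
    and "((\<lambda>k. P k / (\<beta> * norm1 k powr (- s))) \<longlongrightarrow> 1) (filtercomap norm1 at_top)"
    and "percolating P"
  shows "\<exists>\<epsilon>::real. 0 < \<epsilon> \<and> \<epsilon> < 1 \<and> percolating (\<lambda>k. (1 - \<epsilon>) * P k)"
proof -
  interpret percolation_model P using assms(4-6) by unfold_locales
  have s0: "s > 0" using assms(1) by (rule le_less_trans[rotated]) simp
  have "eventually (\<lambda>k. P k / (\<beta> * norm1 k powr (- s)) \<in> {1/2<..<2}) (filtercomap norm1 at_top)"
    by (rule topological_tendstoD[OF assms(7)]) auto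
  then obtain a where a: "\<And>k. a \<le> norm1 k \<Longrightarrow> P k / (\<beta> * norm1 k powr (- s)) \<in> {1/2<..<2}"
    by (auto simp: eventually_filtercomap_at_top_linorder)
  \<comment> \<open>At least 1, so that the norm is positive from \<open>r0\<close> on and the ratio
    can be cleared.\<close>
  obtain r0 where r0: "max 1 a \<le> real r0" using real_arch_simple by blast
  have asym: "\<beta> / 2 * norm1 k powr (- s) \<le> P k \<and> P k \<le> 2 * \<beta> * norm1 k powr (- s)" if "real r0 \<le> norm1 k" for k
  proof -
    have "0 < \<beta> * norm1 k powr (- s)" using assms(3) r0 that by simp
    then show ?thesis using a[of k] r0 that by (simp add: field_simps)
  qed
  \<comment> \<open>The tail sum needs a bound at all nonzero \<open>k\<close>. Below
    \<open>r0\<close> the trivial bound \<open>P k \<le> 1\<close> is absorbed by the constant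
    \<open>real r0 powr s\<close>.\<close>
  have upper: "P k \<le> max (2 * \<beta>) (real r0 powr s) * norm1 k powr (- s)" if "k \<noteq> 0" for k
  proof (cases "real r0 \<le> norm1 k")
    case True
    have "P k \<le> 2 * \<beta> * norm1 k powr (- s)" using asym[OF True] by simp
    also have "\<dots> \<le> max (2 * \<beta>) (real r0 powr s) * norm1 k powr (- s)" by (intro mult_right_mono) auto
    finally show ?thesis .
  next
    case False
    have k: "1 \<le> norm1 k" using that by (rule norm1_ge_1)
    have "P k \<le> 1" using assms(6) by (rule less_imp_le)
    also have "1 = norm1 k powr s * norm1 k powr (- s)" using k by (simp add: powr_minus)
    also have "\<dots> \<le> max (2 * \<beta>) (real r0 powr s) * norm1 k powr (- s)"
    proof (rule mult_right_mono)
      have "norm1 k powr s \<le> real r0 powr s" using False k s0 by (intro powr_mono2) auto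
      then show "norm1 k powr s \<le> max (2 * \<beta>) (real r0 powr s)" by simp
    qed simp
    finally show ?thesis .
  qed
  obtain C2 where C2: "C2 \<ge> 0" "\<And>r K. 1 \<le> r \<Longrightarrow> finite K \<Longrightarrow> \<forall>k\<in>K. real r \<le> norm1 k \<Longrightarrow>
      (\<Sum>k\<in>K. P k) \<le> C2 * real r powr (real CARD('d) - s)"
    using lattice_tail_sum[OF assms(1) _ upper] assms(3) by (auto simp: le_max_iff_disj)
  have "((\<lambda>r. 2 * \<beta> * real r powr (- s)) \<longlongrightarrow> 0) sequentially"
    using s0 by (intro tendsto_mult_right_zero tendsto_neg_powr filterlim_real_sequentially) simp_all
  then have "eventually (\<lambda>r. 2 * \<beta> * real r powr (- s) < 1 / 2 \<and> max 1 r0 \<le> r) sequentially"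
    using s0 by (intro eventually_conj order_tendstoD(2)[where y=0] eventually_ge_at_top) simp_all
  then obtain r1 where r1: "2 * \<beta> * real r1 powr (- s) < 1 / 2" "1 \<le> r1" "r0 \<le> r1"
    by (auto simp: eventually_sequentially)
  have ker: "lattice_kernel p s (\<beta> / 2) r0"
  proof
    show "\<beta> / 2 * norm1 (x - y) powr - s \<le> p {x, y}" if "x \<noteq> y" "real r0 \<le> norm1 (x - y)" for x y
      using asym[OF that(2)] p_doubleton[OF that(1)] by simp
  qed (use p_bounds assms(1-3) p_shift in auto)
  have tail: "(\<Sum>y\<in>K. p {x, y}) \<le> C2 * real r powr (real CARD('d) - s)"
    if "r1 \<le> r" "finite K" "\<And>y. y \<in> K \<Longrightarrow> x \<noteq> y \<and> real r \<le> norm1 (x - y)" for r x K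
  proof -
    have "(\<Sum>y\<in>K. p {x, y}) = (\<Sum>k\<in>(\<lambda>y. x - y) ` K. P k)"
      using that(3) by (subst sum.reindex) (auto simp: inj_on_def p_doubleton intro!: sum.cong)
    also have "\<dots> \<le> C2 * real r powr (real CARD('d) - s)"
      using that r1 by (intro C2(2)) auto
    finally show ?thesis .
  qed
  have half: "p {x, y} \<le> 1 / 2" if "x \<noteq> y" "real r1 \<le> norm1 (x - y)" for x y
  proof -
    have "p {x, y} \<le> 2 * \<beta> * norm1 (x - y) powr (- s)"
      using asym[of "x - y"] that r1(3) p_doubleton[OF that(1)] by simp
    also have "\<dots> \<le> 2 * \<beta> * real r1 powr (- s)"
      using that r1(2) s0 assms(3) by (intro mult_left_mono powr_mono2') auto
    finally show ?thesis using r1(1) by simp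
  qed
  obtain \<epsilon> where \<epsilon>: "\<epsilon> > 0" "\<epsilon> < 1" "percolates_finitely (\<lambda>e. (1 - \<epsilon>) * p e)"
    using percolates_finitely_stable[OF ker percolates_finitely_of_percolating[OF assms(8)] C2(1) tail half] by blast
  have "percolation_model (\<lambda>k. (1 - \<epsilon>) * P k)"
  proof
    show "0 \<le> (1 - \<epsilon>) * P k" for k using \<epsilon>(2) assms(4) by simp
    show "(1 - \<epsilon>) * P k = (1 - \<epsilon>) * P (- k)" for k using assms(5)[of k] by simp
    show "(1 - \<epsilon>) * P k < 1" for k
      using mult_right_mono[of "1 - \<epsilon>" 1 "P k"] \<epsilon>(1) assms(4,6)[of k] by simp
  qed
  then interpret P': percolation_model "\<lambda>k. (1 - \<epsilon>) * P k" .
  have "bond_prob (\<lambda>k. (1 - \<epsilon>) * P k) e = (1 - \<epsilon>) * p e" if "e \<in> bonds" for e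
    using that by (auto simp: bonds_def P'.p_doubleton p_doubleton)
  then have "expect (bond_prob (\<lambda>k. (1 - \<epsilon>) * P k)) (pairs V) f = expect (\<lambda>e. (1 - \<epsilon>) * p e) (pairs V) f" for V f
    using pairs_subset_bonds by (intro expect_cong_prob) blast
  with \<epsilon>(3) have "percolates_finitely (bond_prob (\<lambda>k. (1 - \<epsilon>) * P k))" by (simp add: percolates_finitely_def)
  then have "percolating (\<lambda>k. (1 - \<epsilon>) * P k)" by (rule P'.percolating_of_percolates_finitely)
  with \<epsilon> show ?thesis by blast
qed

end
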